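(* Let $1<\alpha<\beta$ and let $P_B=P_{w,\phi,\psi,\theta}$ be the selfadjoint momentum operator on $[0,1]\cup[\alpha,\beta]$ associated with the unitary matrix $$B=\begin{pmatrix} w\,e(\phi) & -\sqrt{1-w^2}\,e(\theta-\psi)\\ \sqrt{1-w^2}\,e(\psi) & w\,e(\theta-\phi)\end{pmatrix},\qquad 0\le w\le 1,\ \phi,\psi,\theta\in\mathbb{R}.$$ Then $P_B$ has pure point spectrum. In fact, the spectrum of $P_B$ is the set of all real solutions $\lambda$ to the equation $$\bigl(e(\phi+\lambda)-w\bigr)\,e\bigl(\theta-\phi+(\beta-\alpha)\lambda\bigr)=w\,e(\phi+\lambda)-1.$$
   Context: $e(x):=e^{i2\pi x}$. $I_1=[0,1]$, $I_2=[\alpha,\beta]$. The maximal momentum operator is $P=\frac{1}{i2\pi}\frac{d}{dt}$ on $L^2(I_1\cup I_2)$, with domain $\mathscr{D}(P)$ the absolutely continuous functions $f$ on $I_1\cup I_2$ with $f'\in L^2(I_1\cup I_2)$. $P_B$ is the (selfadjoint) restriction of $P$ to $$\mathscr{D}(P_B)=\left\{f\in\mathscr{D}(P) : B\begin{pmatrix}f(1)\\ f(\beta)\end{pmatrix}=\begin{pmatrix}f(0)\\ f(\alpha)\end{pmatrix}\right\}.$$ *)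

theory Defs
  imports "HOL-Analysis.Analysis"
begin

subsection \<open>Unbounded operators on $L^2(M)$\<close>

text \<open>
  Elements of $L^2(M)$ are represented by functions, two functions representing the same
  element iff they agree almost everywhere. Hence every equation in $L^2(M)$ below is read
  as an equation holding almost everywhere.
\<close>

definition L2 :: "'a measure \<Rightarrow> ('a \<Rightarrow> complex) set" where
  "L2 M = {f. f \<in> borel_measurable M \<and> integrable M (\<lambda>x. (cmod (f x))\<^sup>2)}"

definition l2norm :: "'a measure \<Rightarrow> ('a \<Rightarrow> complex) \<Rightarrow> real" where
  "l2norm M f = sqrt (\<integral>x. (cmod (f x))\<^sup>2 \<partial>M)"

text \<open>An operator is a pair consisting of its domain and its action on the domain.\<close>

type_synonym 'a l2_operator = "('a \<Rightarrow> complex) set \<times> (('a \<Rightarrow> complex) \<Rightarrow> 'a \<Rightarrow> complex)"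

abbreviation op_dom :: "'a l2_operator \<Rightarrow> ('a \<Rightarrow> complex) set" where
  "op_dom T \<equiv> fst T"

abbreviation op_app :: "'a l2_operator \<Rightarrow> ('a \<Rightarrow> complex) \<Rightarrow> 'a \<Rightarrow> complex" where
  "op_app T \<equiv> snd T"

definition shifted :: "'a l2_operator \<Rightarrow> complex \<Rightarrow> ('a \<Rightarrow> complex) \<Rightarrow> 'a \<Rightarrow> complex" where
  "shifted T z f = (\<lambda>x. op_app T f x - z * f x)"

text \<open>
  \<open>z\<close> is in the resolvent set iff $T - z$ is a bijection from the domain of $T$
  onto $L^2(M)$ with bounded inverse.
\<close>

definition resolvent_set :: "'a measure \<Rightarrow> 'a l2_operator \<Rightarrow> complex set" where
  "resolvent_set M T = {z.
     (\<forall>f\<in>op_dom T. (AE x in M. shifted T z f x = 0) \<longrightarrow> (AE x in M. f x = 0)) \<and>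
     (\<forall>g\<in>L2 M. \<exists>f\<in>op_dom T. AE x in M. shifted T z f x = g x) \<and>
     (\<exists>C. \<forall>f\<in>op_dom T. l2norm M f \<le> C * l2norm M (shifted T z f))}"

definition spectrum :: "'a measure \<Rightarrow> 'a l2_operator \<Rightarrow> complex set" where
  "spectrum M T = - resolvent_set M T"

definition eigenvector :: "'a measure \<Rightarrow> 'a l2_operator \<Rightarrow> complex \<Rightarrow> ('a \<Rightarrow> complex) \<Rightarrow> bool" where
  "eigenvector M T z f \<longleftrightarrow>
     f \<in> op_dom T \<and> \<not> (AE x in M. f x = 0) \<and> (AE x in M. op_app T f x = z * f x)"

definition point_spectrum :: "'a measure \<Rightarrow> 'a l2_operator \<Rightarrow> complex set" where
  "point_spectrum M T = {z. \<exists>f. eigenvector M T z f}"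

text \<open>
  Two meanings of ``pure point spectrum'' are in use for a selfadjoint operator: every point
  of the spectrum is an eigenvalue, or the eigenvectors form a complete system (equivalently,
  all spectral measures are purely atomic). Completeness alone only makes the eigenvalues
  dense in the spectrum; both properties are required here.
\<close>

definition pure_point_spectrum :: "'a measure \<Rightarrow> 'a l2_operator \<Rightarrow> bool" where
  "pure_point_spectrum M T \<longleftrightarrow>
     spectrum M T = point_spectrum M T \<and>
     (\<forall>g\<in>L2 M. \<forall>\<epsilon>>0. \<exists>F c. finite F \<and> F \<subseteq> {f. \<exists>z. eigenvector M T z f} \<and>
        l2norm M (\<lambda>x. g x - (\<Sum>f\<in>F. c f * f x)) < \<epsilon>)"


subsection \<open>Momentum operators on two intervals\<close>

definition abs_continuous_on :: "real set \<Rightarrow> (real \<Rightarrow> 'a::real_normed_vector) \<Rightarrow> bool" where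
  "abs_continuous_on S f \<longleftrightarrow>
     (\<forall>\<epsilon>>0. \<exists>\<delta>>0. \<forall>(n::nat) a b.
        (\<forall>i<n. a i \<le> b i \<and> {a i..b i} \<subseteq> S) \<and>
        disjoint_family_on (\<lambda>i. {a i<..<b i}) {..<n} \<and>
        (\<Sum>i<n. b i - a i) < \<delta>
        \<longrightarrow> (\<Sum>i<n. norm (f (b i) - f (a i))) < \<epsilon>)"

definition two_intervals :: "real \<Rightarrow> real \<Rightarrow> real set" where
  "two_intervals \<alpha> \<beta> = {0..1} \<union> {\<alpha>..\<beta>}"

text \<open>
  \<^const>\<open>vector_derivative\<close> is unspecified where the derivative does not exist, so the
  domain mentions almost everywhere differentiability explicitly, although it is a
  consequence of absolute continuity. A function in the domain is the absolutely continuous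
  representative of its class, so that its values at the endpoints are meaningful; its values
  outside the two intervals play no role.
\<close>

definition derivative_on :: "real set \<Rightarrow> (real \<Rightarrow> complex) \<Rightarrow> real \<Rightarrow> complex" where
  "derivative_on S f = (\<lambda>x. vector_derivative f (at x within S))"

definition momentum_max :: "real \<Rightarrow> real \<Rightarrow> real l2_operator" where
  "momentum_max \<alpha> \<beta> =
     ({f. abs_continuous_on (two_intervals \<alpha> \<beta>) f \<and>
          (AE x in lebesgue_on (two_intervals \<alpha> \<beta>).
             f differentiable (at x within two_intervals \<alpha> \<beta>)) \<and>
          derivative_on (two_intervals \<alpha> \<beta>) f \<in> L2 (lebesgue_on (two_intervals \<alpha> \<beta>))},
      \<lambda>f x. 1 / (\<i> * 2 * of_real pi) * derivative_on (two_intervals \<alpha> \<beta>) f x)"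

definition momentum :: "real \<Rightarrow> real \<Rightarrow> complex^2^2 \<Rightarrow> real l2_operator" where
  "momentum \<alpha> \<beta> B =
     ({f \<in> op_dom (momentum_max \<alpha> \<beta>). B *v vector [f 1, f \<beta>] = vector [f 0, f \<alpha>]},
      op_app (momentum_max \<alpha> \<beta>))"

definition e :: "real \<Rightarrow> complex" where
  "e x = exp (\<i> * 2 * of_real pi * of_real x)"

definition boundary_matrix :: "real \<Rightarrow> real \<Rightarrow> real \<Rightarrow> real \<Rightarrow> complex^2^2" where
  "boundary_matrix w \<phi> \<psi> \<theta> =
     vector [vector [of_real w * e \<phi>, - of_real (sqrt (1 - w\<^sup>2)) * e (\<theta> - \<psi>)],
             vector [of_real (sqrt (1 - w\<^sup>2)) * e \<psi>, of_real w * e (\<theta> - \<phi>)]]"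

end

theory Submission
  imports Defs "HOL-Complex_Analysis.Great_Picard"
begin

text \<open>
  A function in the domain of the momentum operator solves \<open>(P - z) f = g\<close> iff on each of the two
  intervals it is given by variation of constants from its value at the left endpoint. The boundary
  condition turns into a linear system for the two left endpoint values, whose determinant \<open>chi z\<close> is
  an entire function of \<open>z\<close>. Where it does not vanish, Cramer's rule provides a solution and bounds
  it by the norm of \<open>g\<close>, so that \<open>z\<close> is in the resolvent set; where it vanishes, a vector in the kernel of
  the system is a piecewise exponential eigenfunction. The boundary matrix preserves norms, which
  forces the eigenvalues to be real, and for real \<open>z\<close> the equation \<open>chi z = 0\<close> is the one in the
  theorem. This gives the spectrum (\<open>spectrum_eq_chi_zeros\<close>, \<open>chi_zero_real\<close>).

  For the completeness of the eigenfunctions fix a real \<open>\<mu>\<close> with \<open>chi \<mu> \<noteq> 0\<close>; it exists by the identity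
  theorem. The resolvent at \<open>\<mu>\<close> is symmetric, by integration by parts and because the boundary matrix
  preserves inner products, and it maps bounded sets of \<open>L\<^sup>2\<close> to bounded equicontinuous families, so
  that it is compact by the theorem of Arzela and Ascoli (\<open>compact_symmetric_res\<close>). The range of a
  compact symmetric operator lies in the closed span of its eigenvectors
  (\<open>range_in_closure_of_eigenvectors\<close>). Here the range is the domain of the momentum operator,
  which is dense (\<open>dom_dense\<close>), and the eigenvectors of the resolvent are those of the momentum
  operator.

  Two facts about absolutely continuous functions connect the domain with integration: such a
  function is the integral of its derivative (\<open>fundamental_theorem_abs_continuous\<close>), and the
  primitive of a square integrable function is absolutely continuous and has that function as its
  derivative almost everywhere (\<open>abs_continuous_on_integral\<close>,
  \<open>indefinite_integral_has_vector_derivative_AE\<close>).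
\<close>

section \<open>Absolutely continuous functions\<close>

text \<open>
  Families of intervals arise below as tagged divisions and as subfamilies of indexed families, so
  the index set is made an arbitrary finite set.
\<close>

lemma abs_continuous_onD:
  fixes f :: "real \<Rightarrow> 'a::real_normed_vector"
  assumes "abs_continuous_on S f" "0 < \<epsilon>"
  shows "\<exists>\<delta>>0. \<forall>(I::'i set) a b. finite I \<longrightarrow> (\<forall>i\<in>I. a i \<le> b i \<and> {a i..b i} \<subseteq> S) \<longrightarrow>
       disjoint_family_on (\<lambda>i. {a i<..<b i}) I \<longrightarrow> (\<Sum>i\<in>I. b i - a i) < \<delta> \<longrightarrow>
       (\<Sum>i\<in>I. norm (f (b i) - f (a i))) < \<epsilon>"
proof -
  obtain \<delta> where \<delta>: "0 < \<delta>"
    and *: "\<forall>(n::nat) a b. (\<forall>i<n. a i \<le> b i \<and> {a i..b i} \<subseteq> S) \<and>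
        disjoint_family_on (\<lambda>i. {a i<..<b i}) {..<n} \<and> (\<Sum>i<n. b i - a i) < \<delta>
        \<longrightarrow> (\<Sum>i<n. norm (f (b i) - f (a i))) < \<epsilon>"
    using assms unfolding abs_continuous_on_def by blast
  show ?thesis
  proof (intro exI[of _ \<delta>] conjI \<delta> allI impI)
    fix I :: "'i set" and a b
    assume I: "finite I" and sub: "\<forall>i\<in>I. a i \<le> b i \<and> {a i..b i} \<subseteq> S"
      and dis: "disjoint_family_on (\<lambda>i. {a i<..<b i}) I" and len: "(\<Sum>i\<in>I. b i - a i) < \<delta>"
    obtain h where h: "bij_betw h {..<card I} I"
      using ex_bij_betw_nat_finite[OF I] by (auto simp: atLeast0LessThan)
    have "(\<Sum>i<card I. norm (f (b (h i)) - f (a (h i)))) < \<epsilon>"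
    proof (rule *[rule_format], intro conjI)
      show "\<forall>i<card I. a (h i) \<le> b (h i) \<and> {a (h i)..b (h i)} \<subseteq> S"
        using sub bij_betwE[OF h] by blast
      show "disjoint_family_on (\<lambda>i. {a (h i)<..<b (h i)}) {..<card I}"
        unfolding disjoint_family_on_def
      proof (intro ballI impI)
        fix m n assume "m \<in> {..<card I}" "n \<in> {..<card I}" "m \<noteq> n"
        then have "h m \<in> I" "h n \<in> I" "h m \<noteq> h n"
          using h by (auto simp: bij_betw_def inj_on_def)
        then show "{a (h m)<..<b (h m)} \<inter> {a (h n)<..<b (h n)} = {}"
          by (rule disjoint_family_onD[OF dis])
      qed
      show "(\<Sum>i<card I. b (h i) - a (h i)) < \<delta>"
        using len sum.reindex_bij_betw[OF h, of "\<lambda>i. b i - a i"] by simp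
    qed
    then show "(\<Sum>i\<in>I. norm (f (b i) - f (a i))) < \<epsilon>"
      using sum.reindex_bij_betw[OF h, of "\<lambda>i. norm (f (b i) - f (a i))"] by simp
  qed
qed

lemma abs_continuous_on_subset:
  "abs_continuous_on T f \<Longrightarrow> S \<subseteq> T \<Longrightarrow> abs_continuous_on S f"
  unfolding abs_continuous_on_def by (meson order_trans)

lemma abs_continuous_on_imp_continuous_on:
  assumes "abs_continuous_on {a..b} f"
  shows "continuous_on {a..b} f"
  unfolding continuous_on_iff
proof (intro ballI allI impI)
  fix x and \<epsilon> :: real assume x: "x \<in> {a..b}" and "0 < \<epsilon>"
  obtain \<delta> where \<delta>: "0 < \<delta>" and *: "\<forall>(I::unit set) p q. finite I \<longrightarrow>
       (\<forall>i\<in>I. p i \<le> q i \<and> {p i..q i} \<subseteq> {a..b}) \<longrightarrow>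
       disjoint_family_on (\<lambda>i. {p i<..<q i}) I \<longrightarrow> (\<Sum>i\<in>I. q i - p i) < \<delta> \<longrightarrow>
       (\<Sum>i\<in>I. norm (f (q i) - f (p i))) < \<epsilon>"
    using abs_continuous_onD[OF assms \<open>0 < \<epsilon>\<close>] by blast
  have "dist (f y) (f x) < \<epsilon>" if "y \<in> {a..b}" "dist y x < \<delta>" for y
  proof (cases "x \<le> y")
    case True
    then show ?thesis
      using *[rule_format, of "{()}" "\<lambda>_. x" "\<lambda>_. y"] that x
      by (auto simp: disjoint_family_on_def dist_norm)
  next
    case False
    then show ?thesis
      using *[rule_format, of "{()}" "\<lambda>_. y" "\<lambda>_. x"] that x
      by (auto simp: disjoint_family_on_def dist_norm norm_minus_commute)
  qed
  with \<delta> show "\<exists>d>0. \<forall>y\<in>{a..b}. dist y x < d \<longrightarrow> dist (f y) (f x) < \<epsilon>"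
    by blast
qed

text \<open>All closure properties come from bounding the increments of one function by those of others.\<close>

lemma abs_continuous_on_dominated:
  assumes f: "abs_continuous_on S f" and g: "abs_continuous_on S g" and D: "0 < D"
    and le: "\<And>x y. x \<le> y \<Longrightarrow> {x..y} \<subseteq> S \<Longrightarrow>
      norm (h y - h x) \<le> D * (norm (f y - f x) + norm (g y - g x))"
  shows "abs_continuous_on S h"
  unfolding abs_continuous_on_def
proof (intro allI impI)
  let ?fine = "\<lambda>n a b \<delta>. (\<forall>i<n. a i \<le> b i \<and> {a i..b i} \<subseteq> S) \<and>
      disjoint_family_on (\<lambda>i. {a i<..<b i}) {..<n} \<and> (\<Sum>i<n. b i - a i) < \<delta>"
  fix \<epsilon> :: real assume \<epsilon>: "0 < \<epsilon>"
  with D have \<eta>: "0 < \<epsilon> / (2 * D)" by simp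
  from f \<eta> obtain \<delta>1 where 1: "0 < \<delta>1" "\<forall>(n::nat) a b. ?fine n a b \<delta>1 \<longrightarrow>
      (\<Sum>i<n. norm (f (b i) - f (a i))) < \<epsilon> / (2 * D)"
    unfolding abs_continuous_on_def by blast
  from g \<eta> obtain \<delta>2 where 2: "0 < \<delta>2" "\<forall>(n::nat) a b. ?fine n a b \<delta>2 \<longrightarrow>
      (\<Sum>i<n. norm (g (b i) - g (a i))) < \<epsilon> / (2 * D)"
    unfolding abs_continuous_on_def by blast
  have "(\<Sum>i<n. norm (h (b i) - h (a i))) < \<epsilon>"
    if ab: "?fine n a b (min \<delta>1 \<delta>2)" for n :: nat and a b
  proof -
    have "(\<Sum>i<n. norm (h (b i) - h (a i))) \<le>
        (\<Sum>i<n. D * (norm (f (b i) - f (a i)) + norm (g (b i) - g (a i))))"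
      using ab by (intro sum_mono le) auto
    also have "\<dots> = D * ((\<Sum>i<n. norm (f (b i) - f (a i))) + (\<Sum>i<n. norm (g (b i) - g (a i))))"
      by (simp only: sum_distrib_left[symmetric] sum.distrib)
    also have "\<dots> < D * (\<epsilon> / (2 * D) + \<epsilon> / (2 * D))"
      using 1(2)[rule_format, of n a b] 2(2)[rule_format, of n a b] ab D
      by (intro mult_strict_left_mono add_strict_mono) auto
    also have "\<dots> = \<epsilon>" using D by (simp add: field_simps)
    finally show ?thesis .
  qed
  then show "\<exists>\<delta>>0. \<forall>(n::nat) a b. ?fine n a b \<delta> \<longrightarrow>
      (\<Sum>i<n. norm (h (b i) - h (a i))) < \<epsilon>"
    using 1(1) 2(1) by (intro exI[of _ "min \<delta>1 \<delta>2"]) auto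
qed

lemma abs_continuous_on_transform:
  assumes "abs_continuous_on S f" "\<And>x. x \<in> S \<Longrightarrow> g x = f x"
  shows "abs_continuous_on S g"
proof (rule abs_continuous_on_dominated[OF assms(1,1), of 1])
  fix x y :: real assume "x \<le> y" "{x..y} \<subseteq> S"
  then have "x \<in> S" "y \<in> S" by auto
  then show "norm (g y - g x) \<le> 1 * (norm (f y - f x) + norm (f y - f x))" by (simp add: assms(2))
qed simp

lemma abs_continuous_on_lipschitz:
  assumes lip: "\<And>x y. x \<le> y \<Longrightarrow> {x..y} \<subseteq> S \<Longrightarrow> norm (f y - f x) \<le> C * (y - x)"
  shows "abs_continuous_on S f"
proof -
  have ident: "abs_continuous_on S (\<lambda>x::real. x)"
    unfolding abs_continuous_on_def
  proof (intro allI impI)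
    fix \<epsilon> :: real assume "0 < \<epsilon>"
    moreover have "(\<Sum>i<n. norm (b i - a i)) = (\<Sum>i<n. b i - a i)"
      if "\<forall>i<n. a i \<le> b i \<and> {a i..b i} \<subseteq> S" for n :: nat and a b :: "nat \<Rightarrow> real"
      using that by (intro sum.cong) auto
    ultimately show "\<exists>\<delta>>0. \<forall>(n::nat) a b. (\<forall>i<n. a i \<le> b i \<and> {a i..b i} \<subseteq> S) \<and>
        disjoint_family_on (\<lambda>i. {a i<..<b i}) {..<n} \<and> (\<Sum>i<n. b i - a i) < \<delta> \<longrightarrow>
        (\<Sum>i<n. norm (b i - a i)) < \<epsilon>"
      by (intro exI[of _ \<epsilon>]) simp
  qed
  show ?thesis
  proof (rule abs_continuous_on_dominated[OF ident ident, of "\<bar>C\<bar> + 1"])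
    fix x y :: real assume "x \<le> y" "{x..y} \<subseteq> S"
    moreover from this have "C * (y - x) \<le> (\<bar>C\<bar> + 1) * (norm (y - x) + norm (y - x))"
      by (intro mult_mono) auto
    ultimately show "norm (f y - f x) \<le> (\<bar>C\<bar> + 1) * (norm (y - x) + norm (y - x))"
      using lip[of x y] by linarith
  qed simp
qed

lemma abs_continuous_on_C1:
  fixes f :: "real \<Rightarrow> 'a::real_normed_vector"
  assumes der: "\<And>x. x \<in> {a..b} \<Longrightarrow> (f has_vector_derivative f' x) (at x)"
    and cont: "continuous_on {a..b} f'"
  shows "abs_continuous_on {a..b} f"
proof -
  have "bounded (f' ` {a..b})"
    using cont compact_continuous_image compact_imp_bounded by blast
  then obtain C where C: "\<And>x. x \<in> {a..b} \<Longrightarrow> norm (f' x) \<le> C"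
    by (metis bounded_iff imageI)
  show ?thesis
  proof (rule abs_continuous_on_lipschitz)
    fix x y :: real assume "x \<le> y" and sub: "{x..y} \<subseteq> {a..b}"
    have "norm (f y - f x) \<le> C * norm (y - x)"
    proof (rule differentiable_bound[where S="{x..y}" and f'="\<lambda>u v. v *\<^sub>R f' u" and f=f])
      fix u assume u: "u \<in> {x..y}"
      then show "(f has_derivative (\<lambda>v. v *\<^sub>R f' u)) (at u within {x..y})"
        using der sub has_vector_derivative_at_within has_vector_derivative_def by blast
      show "onorm (\<lambda>v. v *\<^sub>R f' u) \<le> C"
        using C[of u] u sub by (intro onorm_le) (auto simp: mult.commute[of C] intro!: mult_left_mono)
    qed (use \<open>x \<le> y\<close> in auto)
    then show "norm (f y - f x) \<le> C * (y - x)"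
      using \<open>x \<le> y\<close> by simp
  qed
qed

lemma abs_continuous_on_add:
  assumes "abs_continuous_on S f" "abs_continuous_on S g"
  shows "abs_continuous_on S (\<lambda>x. f x + g x)"
proof (rule abs_continuous_on_dominated[OF assms, of 1])
  show "norm (f y + g y - (f x + g x)) \<le> 1 * (norm (f y - f x) + norm (g y - g x))" for x y
    by (metis add_diff_add mult_1 norm_triangle_ineq)
qed simp

text \<open>
  An increment of the product is an increment of one factor times a value of the other, twice, and
  both factors are bounded.
\<close>

lemma (in bounded_bilinear) abs_continuous_on_prod_interval:
  assumes f: "abs_continuous_on {a..b} f" and g: "abs_continuous_on {a..b} g"
  shows "abs_continuous_on {a..b} (\<lambda>x. prod (f x) (g x))"
proof -
  have "bounded (f ` {a..b})" "bounded (g ` {a..b})"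
    using f g abs_continuous_on_imp_continuous_on compact_continuous_image compact_imp_bounded
    by blast+
  then obtain C1 C2 where C1: "\<And>x. x \<in> {a..b} \<Longrightarrow> norm (f x) \<le> C1" and C2: "\<And>x. x \<in> {a..b} \<Longrightarrow> norm (g x) \<le> C2"
    by (metis bounded_iff imageI)
  obtain K where K: "0 < K" "\<And>u v. norm (prod u v) \<le> norm u * norm v * K"
    using pos_bounded by blast
  define C where "C = \<bar>C1\<bar> + \<bar>C2\<bar> + 1"
  show ?thesis
  proof (rule abs_continuous_on_dominated[OF f g, of "C * K"])
    show "0 < C * K" using K(1) by (simp add: C_def add_nonneg_pos)
    fix x y :: real assume xy: "x \<le> y" "{x..y} \<subseteq> {a..b}"
    then have "norm (f x) \<le> C" "norm (g y) \<le> C"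
      using C1[of x] C2[of y] by (auto simp: C_def)
    then have "norm (f y - f x) * norm (g y) * K + norm (f x) * norm (g y - g x) * K
        \<le> norm (f y - f x) * C * K + C * norm (g y - g x) * K"
      using K by (intro add_mono mult_right_mono mult_left_mono) auto
    moreover have "prod (f y) (g y) - prod (f x) (g x) = prod (f y - f x) (g y) + prod (f x) (g y - g x)"
      by (simp add: diff_left diff_right)
    then have "norm (prod (f y) (g y) - prod (f x) (g x)) \<le>
        norm (f y - f x) * norm (g y) * K + norm (f x) * norm (g y - g x) * K"
      using K(2)[of "f y - f x" "g y"] K(2)[of "f x" "g y - g x"] by (metis add_mono norm_triangle_mono)
    ultimately show "norm (prod (f y) (g y) - prod (f x) (g x)) \<le> C * K * (norm (f y - f x) + norm (g y - g x))"
      by (simp add: algebra_simps)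
  qed
qed

text \<open>
  On the exceptional set the derivative may be taken to be 0. A gauge that keeps the intervals
  tagged there inside an open set of small measure makes the total increment of \<open>f\<close> over those
  intervals small, and this is exactly what absolute continuity provides; over the other
  intervals the increment is approximated by the derivative, as in the classical proof.
\<close>

theorem fundamental_theorem_abs_continuous:
  fixes f :: "real \<Rightarrow> 'a::banach"
  assumes "a \<le> b" and ac: "abs_continuous_on {a..b} f" and N: "negligible N"
    and der: "\<And>x. x \<in> {a..b} - N \<Longrightarrow> (f has_vector_derivative f' x) (at x within {a..b})"
  shows "(f' has_integral f b - f a) {a..b}"
proof -
  define g where "g x = (if x \<in> N then 0 else f' x)" for x
  have "(g has_integral f b - f a) {a..b}"
    unfolding has_integral_real
  proof (intro allI impI)
    fix e :: real assume e: "0 < e"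
    define e' where "e' = e / 4 / (b - a + 1)"
    have "0 < e'"
      using e \<open>a \<le> b\<close> by (simp add: e'_def)
    moreover have "e' * (b - a) \<le> e' * (b - a + 1)"
      using \<open>0 < e'\<close> by (intro mult_left_mono) auto
    moreover have "e' * (b - a + 1) = e / 4"
    proof -
      have "b - a + 1 \<noteq> 0" using \<open>a \<le> b\<close> by linarith
      then show ?thesis unfolding e'_def by (rule nonzero_divide_eq_eq[THEN iffD1, OF _ refl, symmetric])
    qed
    ultimately have e': "0 < e'" "e' * (b - a) < e / 2"
      using e by auto
    have "\<exists>d>0. \<forall>y\<in>{a..b}. norm (y - x) < d \<longrightarrow> norm (f y - f x - (y - x) *\<^sub>R f' x) \<le> e' * norm (y - x)"
      if "x \<in> {a..b} - N" for x
      using der[OF that] e'(1) unfolding has_vector_derivative_def has_derivative_within_alt by blast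
    then obtain d where d: "\<And>x. x \<in> {a..b} - N \<Longrightarrow> 0 < d x"
      "\<And>x y. x \<in> {a..b} - N \<Longrightarrow> y \<in> {a..b} \<Longrightarrow> norm (y - x) < d x \<Longrightarrow>
        norm (f y - f x - (y - x) *\<^sub>R f' x) \<le> e' * norm (y - x)"
      by metis
    have "0 < e / 2" using e by simp
    from abs_continuous_onD[OF ac this, where 'i = "real \<times> real set"]
    obtain \<delta> where \<delta>: "0 < \<delta>" and small: "\<forall>(I::(real \<times> real set) set) p q. finite I \<longrightarrow>
        (\<forall>i\<in>I. p i \<le> q i \<and> {p i..q i} \<subseteq> {a..b}) \<longrightarrow>
        disjoint_family_on (\<lambda>i. {p i<..<q i}) I \<longrightarrow> (\<Sum>i\<in>I. q i - p i) < \<delta> \<longrightarrow>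
        (\<Sum>i\<in>I. norm (f (q i) - f (p i))) < e / 2"
      by blast
    obtain U where U: "open U" "N \<subseteq> U" "U - N \<in> lmeasurable" "emeasure lebesgue (U - N) < ennreal \<delta>"
      using sets_lebesgue_outer_open[OF negligible_imp_sets[OF N] \<delta>] by blast
    have Ulm: "U \<in> lmeasurable" and mU: "measure lebesgue U < \<delta>"
    proof -
      have eq: "U = (U - N) \<union> N" using U(2) by blast
      show "U \<in> lmeasurable"
        using fmeasurable.Un[OF U(3) negligible_imp_measurable[OF N]] unfolding eq[symmetric] .
      have "measure lebesgue U = measure lebesgue (U - N)"
        using N \<open>U \<in> lmeasurable\<close>
        by (intro measure_Diff_null_set[symmetric]) (auto simp: negligible_iff_null_sets)
      then show "measure lebesgue U < \<delta>"
        using U(3,4) \<delta> by (simp add: emeasure_eq_measure2 ennreal_less_iff)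
    qed
    have "\<exists>r>0. ball x r \<subseteq> U" if "x \<in> N" for x
      using that U open_contains_ball by blast
    then obtain r where r: "\<And>x. x \<in> N \<Longrightarrow> 0 < r x" "\<And>x. x \<in> N \<Longrightarrow> ball x (r x) \<subseteq> U"
      by metis
    define \<gamma> where "\<gamma> x = ball x (if x \<in> N then r x else if x \<in> {a..b} then d x else 1)" for x
    show "\<exists>\<gamma>. gauge \<gamma> \<and> (\<forall>\<D>. \<D> tagged_division_of {a..b} \<and> \<gamma> fine \<D> \<longrightarrow>
        norm ((\<Sum>(x, k)\<in>\<D>. measure lborel k *\<^sub>R g x) - (f b - f a)) < e)"
    proof (intro exI[of _ \<gamma>] conjI allI impI; (elim conjE)?)
      show "gauge \<gamma>"
        unfolding gauge_def \<gamma>_def using r(1) d(1) by auto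
      fix p assume p: "p tagged_division_of {a..b}" and fine: "\<gamma> fine p"
      note pD = tagged_division_ofD[OF p]
      have K: "\<exists>u v. K = {u..v} \<and> u \<le> v \<and> a \<le> u \<and> v \<le> b \<and> Inf K = u \<and> Sup K = v \<and> u \<le> x \<and> x \<le> v"
        if xK: "(x, K) \<in> p" for x K
      proof -
        obtain u v where "K = cbox u v" using pD(4)[OF xK] by blast
        then show ?thesis using pD(2,3)[OF xK] by (intro exI[of _ u] exI[of _ v]) auto
      qed
      \<comment> \<open>\<open>?A\<close> collects the intervals tagged in the exceptional set\<close>
      let ?A = "{xK \<in> p. fst xK \<in> N}" and ?B = "{xK \<in> p. fst xK \<notin> N}"
      let ?t = "\<lambda>(x, K). measure lborel K *\<^sub>R g x - (f (Sup K) - f (Inf K))"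
      have fin: "finite ?A" "finite ?B" using pD(1) by auto
      have content: "measure lborel K = Sup K - Inf K" if xK: "(x, K) \<in> p" for x K
      proof -
        obtain u v where "K = {u..v}" "u \<le> v" "Inf K = u" "Sup K = v"
          using K[OF xK] by blast
        then show ?thesis by simp
      qed
      have B: "norm (sum ?t ?B) \<le> e' * (b - a)"
      proof -
        have "norm (sum ?t ?B) \<le> (\<Sum>(x, K)\<in>?B. e' * measure lborel K)"
        proof (rule sum_norm_le, clarify)
          fix x K assume xK: "(x, K) \<in> p" and nN: "fst (x, K) \<notin> N"
          obtain u v where uv: "K = {u..v}" "u \<le> v" "a \<le> u" "v \<le> b" "Inf K = u" "Sup K = v"
            "u \<le> x" "x \<le> v"
            using K[OF xK] by blast
          have x: "x \<in> {a..b} - N" using uv nN by auto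
          have "K \<subseteq> ball x (d x)"
            using fine xK x unfolding fine_def \<gamma>_def by fastforce
          moreover have "u \<in> K" "v \<in> K" using uv by auto
          ultimately have "norm (v - x) < d x" "norm (u - x) < d x"
            by (auto simp: dist_norm subset_iff abs_minus_commute)
          then have 1: "norm (f v - f x - (v - x) *\<^sub>R f' x) \<le> e' * (v - x)"
            and 2: "norm (f u - f x - (u - x) *\<^sub>R f' x) \<le> e' * (x - u)"
            using d(2)[OF x, of v] d(2)[OF x, of u] uv by auto
          have "measure lborel K *\<^sub>R g x - (f (Sup K) - f (Inf K)) =
              (f u - f x - (u - x) *\<^sub>R f' x) - (f v - f x - (v - x) *\<^sub>R f' x)"
            using x uv content[OF xK] by (simp add: g_def algebra_simps)
          then have "norm (measure lborel K *\<^sub>R g x - (f (Sup K) - f (Inf K))) \<le> e' * (x - u) + e' * (v - x)"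
            using add_mono[OF 2 1] by (simp only: norm_triangle_le_diff)
          also have "\<dots> = e' * measure lborel K"
            using content[OF xK] uv by (simp add: algebra_simps)
          finally show "norm (measure lborel K *\<^sub>R g x - (f (Sup K) - f (Inf K))) \<le> e' * measure lborel K" .
        qed
        also have "\<dots> \<le> (\<Sum>(x, K)\<in>p. e' * measure lborel K)"
          using pD(1) e'(1) by (intro sum_mono2) auto
        also have "\<dots> = e' * (b - a)"
          using additive_content_tagged_division[of p a b] p \<open>a \<le> b\<close>
          by (simp add: sum_distrib_left[symmetric] split_def)
        finally show ?thesis .
      qed
      have I: "Inf (snd xK) \<le> Sup (snd xK)" "{Inf (snd xK)..Sup (snd xK)} = snd xK" "snd xK \<subseteq> {a..b}"
        if "xK \<in> p" for xK
      proof -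
        obtain u v where "snd xK = {u..v}" "u \<le> v" "a \<le> u" "v \<le> b" "Inf (snd xK) = u" "Sup (snd xK) = v"
          using K[of "fst xK" "snd xK"] \<open>xK \<in> p\<close> by auto
        then show "Inf (snd xK) \<le> Sup (snd xK)" "{Inf (snd xK)..Sup (snd xK)} = snd xK" "snd xK \<subseteq> {a..b}"
          by auto
      qed
      have dis: "disjoint_family_on (\<lambda>xK. {Inf (snd xK)<..<Sup (snd xK)}) ?A"
        unfolding disjoint_family_on_def
      proof (intro ballI impI)
        fix s t assume st: "s \<in> ?A" "t \<in> ?A" "s \<noteq> t"
        have "{Inf (snd s)<..<Sup (snd s)} = interior (snd s)" if "s \<in> p" for s
          using I(2)[OF that] interior_atLeastAtMost_real[of "Inf (snd s)" "Sup (snd s)"] by simp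
        then show "{Inf (snd s)<..<Sup (snd s)} \<inter> {Inf (snd t)<..<Sup (snd t)} = {}"
          using pD(5)[of "fst s" "snd s" "fst t" "snd t"] st by (auto simp: prod_eq_iff)
      qed
      have A: "norm (sum ?t ?A) < e / 2"
      proof -
        have "norm (sum ?t ?A) \<le> (\<Sum>xK\<in>?A. norm (f (Sup (snd xK)) - f (Inf (snd xK))))"
          by (rule sum_norm_le) (auto simp: g_def norm_minus_commute)
        also have "\<dots> < e / 2"
        proof (rule small[rule_format, OF fin(1) _ dis])
          show "Inf (snd xK) \<le> Sup (snd xK) \<and> {Inf (snd xK)..Sup (snd xK)} \<subseteq> {a..b}" if "xK \<in> ?A" for xK
            using I that by simp
          have "(\<Sum>xK\<in>?A. Sup (snd xK) - Inf (snd xK))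
              = (\<Sum>xK\<in>?A. measure lebesgue {Inf (snd xK)<..<Sup (snd xK)})"
            using I(1) by (intro sum.cong) auto
          also have "\<dots> = measure lebesgue (\<Union>xK\<in>?A. {Inf (snd xK)<..<Sup (snd xK)})"
          proof (rule measure_finite_Union[symmetric, OF fin(1) _ dis])
            show "emeasure lebesgue {Inf (snd xK)<..<Sup (snd xK)} \<noteq> \<infinity>" if "xK \<in> ?A" for xK
              using I(1)[of xK] that by simp
          qed auto
          also have "\<dots> \<le> measure lebesgue U"
          proof (intro measure_mono_fmeasurable Ulm UN_least)
            fix xK assume xK: "xK \<in> ?A"
            then have "snd xK \<subseteq> ball (fst xK) (r (fst xK))"
              using fine unfolding fine_def \<gamma>_def by fastforce
            then have "snd xK \<subseteq> U" using r(2) xK by blast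
            then show "{Inf (snd xK)<..<Sup (snd xK)} \<subseteq> U"
              using I(2)[of xK] greaterThanLessThan_subseteq_atLeastAtMost_iff xK by auto
          qed (use fin(1) in auto)
          also have "\<dots> < \<delta>" by (rule mU)
          finally show "(\<Sum>xK\<in>?A. Sup (snd xK) - Inf (snd xK)) < \<delta>" .
        qed
        finally show ?thesis .
      qed
      have "(\<Sum>(x, k)\<in>p. measure lborel k *\<^sub>R g x) - (f b - f a) = sum ?t p"
        using additive_tagged_division_1[OF \<open>a \<le> b\<close> p, of f]
        by (simp add: sum_subtractf split_def)
      also have "sum ?t p = sum ?t ?A + sum ?t ?B"
      proof -
        have "p = ?A \<union> ?B" by blast
        then show ?thesis
          using sum.union_disjoint[OF fin, of ?t] by auto
      qed
      finally have "norm ((\<Sum>(x, k)\<in>p. measure lborel k *\<^sub>R g x) - (f b - f a)) \<le> norm (sum ?t ?A) + norm (sum ?t ?B)"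
        by (simp add: norm_triangle_ineq)
      then show "norm ((\<Sum>(x, k)\<in>p. measure lborel k *\<^sub>R g x) - (f b - f a)) < e"
        using A B e'(2) by linarith
    qed
  qed
  then show ?thesis
    by (rule has_integral_spike[OF N, rotated]) (auto simp: g_def)
qed

section \<open>Square integrable functions\<close>

text \<open>
  This is the real part of the usual inner product. It suffices because only symmetric operators
  and real eigenvalues are considered.
\<close>

definition l2inner :: "'a measure \<Rightarrow> ('a \<Rightarrow> complex) \<Rightarrow> ('a \<Rightarrow> complex) \<Rightarrow> real" where
  "l2inner M f g = (\<integral>x. f x \<bullet> g x \<partial>M)"

lemma L2_D:
  assumes "f \<in> L2 M"
  shows "f \<in> borel_measurable M" "integrable M (\<lambda>x. (cmod (f x))\<^sup>2)"
  using assms by (auto simp: L2_def)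

lemma L2_bound:
  assumes "f \<in> borel_measurable M" "integrable M g" "AE x in M. (cmod (f x))\<^sup>2 \<le> g x"
  shows "f \<in> L2 M"
proof -
  have "integrable M (\<lambda>x. (cmod (f x))\<^sup>2)"
    using assms(1) by (intro Bochner_Integration.integrable_bound[OF assms(2)] eventually_mono[OF assms(3)]) auto
  then show ?thesis using assms(1) by (simp add: L2_def)
qed

lemma cmod_add_square_le: "(cmod (x + y))\<^sup>2 \<le> 2 * (cmod x)\<^sup>2 + 2 * (cmod y)\<^sup>2"
proof -
  have "(cmod (x + y))\<^sup>2 \<le> (cmod x + cmod y)\<^sup>2"
    by (intro power_mono norm_triangle_ineq) auto
  also have "\<dots> \<le> 2 * (cmod x)\<^sup>2 + 2 * (cmod y)\<^sup>2"
    using sum_squares_bound[of "cmod x" "cmod y"] by (simp add: power2_sum)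
  finally show ?thesis .
qed

lemma L2_add [simp, intro]:
  assumes "f \<in> L2 M" "g \<in> L2 M"
  shows "(\<lambda>x. f x + g x) \<in> L2 M"
  using assms[THEN L2_D(1)] assms[THEN L2_D(2)]
  by (intro L2_bound[where g="\<lambda>x. 2 * (cmod (f x))\<^sup>2 + 2 * (cmod (g x))\<^sup>2"])
    (auto simp: cmod_add_square_le)

lemma L2_cmult [simp, intro]:
  assumes "f \<in> L2 M"
  shows "(\<lambda>x. c * f x) \<in> L2 M"
  using L2_D[OF assms]
  by (intro L2_bound[where g="\<lambda>x. (cmod c)\<^sup>2 * (cmod (f x))\<^sup>2"]) (auto simp: norm_mult power_mult_distrib)

lemma L2_uminus [simp, intro]: "f \<in> L2 M \<Longrightarrow> (\<lambda>x. - f x) \<in> L2 M"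
  using L2_cmult[of f M "-1"] by simp

lemma L2_zero [simp, intro]: "(\<lambda>x. 0) \<in> L2 M"
  by (simp add: L2_def)

lemma L2_diff [simp, intro]:
  assumes "f \<in> L2 M" "g \<in> L2 M"
  shows "(\<lambda>x. f x - g x) \<in> L2 M"
  using L2_add[OF assms(1) L2_cmult[OF assms(2), of "-1"]] by simp

lemma integrable_inner_L2:
  assumes "f \<in> L2 M" "g \<in> L2 M"
  shows "integrable M (\<lambda>x. f x \<bullet> g x)"
proof (rule Bochner_Integration.integrable_bound)
  show "integrable M (\<lambda>x. (cmod (f x))\<^sup>2 + (cmod (g x))\<^sup>2)"
    using assms by (auto dest: L2_D)
  show "(\<lambda>x. f x \<bullet> g x) \<in> borel_measurable M"
    using assms[THEN L2_D(1)] by measurable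
  have "\<bar>a \<bullet> b\<bar> \<le> (cmod a)\<^sup>2 + (cmod b)\<^sup>2" for a b :: complex
    using Cauchy_Schwarz_ineq2[of a b] sum_squares_bound[of "cmod a" "cmod b"]
      mult_nonneg_nonneg[OF norm_ge_zero[of a] norm_ge_zero[of b]] by linarith
  then show "AE x in M. norm (f x \<bullet> g x) \<le> norm ((cmod (f x))\<^sup>2 + (cmod (g x))\<^sup>2)"
    by simp
qed

lemma l2inner_commute: "l2inner M f g = l2inner M g f"
  by (simp add: l2inner_def inner_commute)

lemma l2inner_add_left:
  assumes "f \<in> L2 M" "g \<in> L2 M" "h \<in> L2 M"
  shows "l2inner M (\<lambda>x. f x + g x) h = l2inner M f h + l2inner M g h"
  using assms by (simp add: l2inner_def inner_add_left integrable_inner_L2)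

lemma l2inner_diff_left:
  assumes "f \<in> L2 M" "g \<in> L2 M" "h \<in> L2 M"
  shows "l2inner M (\<lambda>x. f x - g x) h = l2inner M f h - l2inner M g h"
  using assms by (simp add: l2inner_def inner_diff_left integrable_inner_L2)

lemma l2inner_scale_left: "l2inner M (\<lambda>x. of_real c * f x) h = c * l2inner M f h"
  by (simp add: l2inner_def scaleR_conv_of_real[symmetric] del: Bochner_Integration.integral_mult_right_zero)
    (simp add: integral_mult_right_zero)

lemma l2inner_diff_right:
  "f \<in> L2 M \<Longrightarrow> g \<in> L2 M \<Longrightarrow> h \<in> L2 M \<Longrightarrow> l2inner M h (\<lambda>x. f x - g x) = l2inner M h f - l2inner M h g"
  using l2inner_diff_left[of f M g h] by (simp add: l2inner_commute[of M h])

lemma l2inner_scale_right: "l2inner M h (\<lambda>x. of_real c * f x) = c * l2inner M h f"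
  using l2inner_scale_left[of M c f h] by (simp add: l2inner_commute[of M h])

lemma l2inner_cong_AE:
  assumes "f \<in> L2 M" "f' \<in> L2 M" "h \<in> L2 M" "AE x in M. f x = f' x"
  shows "l2inner M f h = l2inner M f' h"
  unfolding l2inner_def
  by (intro integral_cong_AE) (use assms(4) in \<open>auto intro!: borel_measurable_inner L2_D(1)[OF assms(1)] L2_D(1)[OF assms(2)] L2_D(1)[OF assms(3)]\<close>)

lemma l2norm_nonneg [simp]: "0 \<le> l2norm M f"
  by (simp add: l2norm_def integral_nonneg_AE)

lemma l2norm_pos: "l2norm M f \<noteq> 0 \<Longrightarrow> 0 < l2norm M f"
  using l2norm_nonneg[of M f] by linarith

lemma l2norm_square: "(l2norm M f)\<^sup>2 = l2inner M f f"
  by (simp add: l2norm_def l2inner_def power2_norm_eq_inner integral_nonneg_AE)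

lemma l2norm_square': "(l2norm M f)\<^sup>2 = (\<integral>x. (cmod (f x))\<^sup>2 \<partial>M)"
  by (simp add: l2norm_def integral_nonneg_AE)

lemma l2norm_eq_0_iff:
  assumes "f \<in> L2 M"
  shows "l2norm M f = 0 \<longleftrightarrow> (AE x in M. f x = 0)"
  using integral_nonneg_eq_0_iff_AE[OF L2_D(2)[OF assms]] by (simp add: l2norm_def)

lemma l2norm_cmult: "l2norm M (\<lambda>x. c * f x) = cmod c * l2norm M f"
  by (simp add: l2norm_def norm_mult power_mult_distrib real_sqrt_mult)

lemma l2norm_cong_AE:
  assumes "f \<in> borel_measurable M" "g \<in> borel_measurable M" "AE x in M. f x = g x"
  shows "l2norm M f = l2norm M g"
  unfolding l2norm_def using assms(1,2)
  by (intro arg_cong[where f=sqrt] integral_cong_AE) (use assms(3) in auto)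

lemma l2norm_minus_commute: "l2norm M (\<lambda>x. f x - g x) = l2norm M (\<lambda>x. g x - f x)"
  by (simp add: l2norm_def norm_minus_commute)

lemma l2norm_diff_scale_square:
  assumes "f \<in> L2 M" "g \<in> L2 M"
  shows "(l2norm M (\<lambda>x. f x - of_real t * g x))\<^sup>2 =
    (l2norm M f)\<^sup>2 - 2 * t * l2inner M f g + t\<^sup>2 * (l2norm M g)\<^sup>2"
proof -
  have tg: "(\<lambda>x. of_real t * g x) \<in> L2 M" using assms by simp
  have "l2inner M g f = l2inner M f g" by (rule l2inner_commute)
  with assms tg show ?thesis
    unfolding l2norm_square
    by (simp add: l2inner_diff_left l2inner_diff_right l2inner_scale_left l2inner_scale_right)
      (simp add: power2_eq_square algebra_simps)
qed

text \<open>
  Besides the Cauchy-Schwarz inequality, this yields that almost minimal distance from a subspace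
  means almost orthogonality to it.
\<close>

lemma nonneg_quadratic_discriminant:
  fixes a p q :: real
  assumes "\<And>t. 0 \<le> a - 2 * t * p + t\<^sup>2 * q" and "0 \<le> q"
  shows "p\<^sup>2 \<le> a * q"
proof (cases "q = 0")
  case True
  have "p = 0"
  proof (rule ccontr)
    assume "p \<noteq> 0"
    then show False using assms(1)[of "(a + 1) / (2 * p)"] True by simp
  qed
  then show ?thesis using True by simp
next
  case False
  with assms(2) have q: "0 < q" by simp
  have "0 \<le> (a - 2 * (p / q) * p + (p / q)\<^sup>2 * q) * q"
    using assms(1)[of "p/q"] q by (intro mult_nonneg_nonneg) auto
  also have "\<dots> = a * q - p\<^sup>2"
    using q by (simp add: power2_eq_square field_simps)
  finally show ?thesis by simp
qed

lemma l2inner_Cauchy_Schwarz: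
  assumes "f \<in> L2 M" "g \<in> L2 M"
  shows "\<bar>l2inner M f g\<bar> \<le> l2norm M f * l2norm M g"
proof -
  have "(l2inner M f g)\<^sup>2 \<le> (l2norm M f)\<^sup>2 * (l2norm M g)\<^sup>2"
    by (rule nonneg_quadratic_discriminant) (simp_all add: l2norm_diff_scale_square[OF assms, symmetric])
  then have "\<bar>l2inner M f g\<bar>\<^sup>2 \<le> (l2norm M f * l2norm M g)\<^sup>2"
    by (simp only: power2_abs power_mult_distrib)
  then show ?thesis
    by (rule power2_le_imp_le) simp
qed

lemma l2norm_triangle:
  assumes "f \<in> L2 M" "g \<in> L2 M"
  shows "l2norm M (\<lambda>x. f x + g x) \<le> l2norm M f + l2norm M g"
proof (rule power2_le_imp_le)
  have "(l2norm M (\<lambda>x. f x + g x))\<^sup>2 = (l2norm M f)\<^sup>2 + 2 * l2inner M f g + (l2norm M g)\<^sup>2"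
    using l2norm_diff_scale_square[OF assms, of "-1"] by simp
  also have "\<dots> \<le> (l2norm M f + l2norm M g)\<^sup>2"
    using l2inner_Cauchy_Schwarz[OF assms] by (simp add: power2_sum)
  finally show "(l2norm M (\<lambda>x. f x + g x))\<^sup>2 \<le> (l2norm M f + l2norm M g)\<^sup>2" .
qed simp

lemma l2norm_triangle_diff:
  assumes "f \<in> L2 M" "g \<in> L2 M" "h \<in> L2 M"
  shows "l2norm M (\<lambda>x. f x - h x) \<le> l2norm M (\<lambda>x. f x - g x) + l2norm M (\<lambda>x. g x - h x)"
  using l2norm_triangle[of "\<lambda>x. f x - g x" M "\<lambda>x. g x - h x"] assms by simp

lemma l2norm_reverse_triangle:
  assumes "f \<in> L2 M" "g \<in> L2 M"
  shows "\<bar>l2norm M f - l2norm M g\<bar> \<le> l2norm M (\<lambda>x. f x - g x)"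
  using l2norm_triangle[of "\<lambda>x. f x - g x" M g] l2norm_triangle[of "\<lambda>x. g x - f x" M f] assms
    l2norm_minus_commute[of M f g] by simp

lemma tendsto_zero_squeeze:
  fixes a b :: "nat \<Rightarrow> real"
  assumes "\<And>n. 0 \<le> a n" "\<And>n. a n \<le> b n" "b \<longlonglongrightarrow> 0"
  shows "a \<longlonglongrightarrow> 0"
  by (rule tendsto_sandwich[OF _ _ tendsto_const assms(3)]) (simp_all add: assms)

lemma tendsto_l2inner:
  assumes "\<And>n. f n \<in> L2 M" "h \<in> L2 M" "y \<in> L2 M" "(\<lambda>n. l2norm M (\<lambda>x. f n x - h x)) \<longlonglongrightarrow> 0"
  shows "(\<lambda>n. l2inner M (f n) y) \<longlonglongrightarrow> l2inner M h y"
proof (rule LIM_zero_cancel, rule tendsto_rabs_zero_cancel, rule tendsto_sandwich[OF _ _ tendsto_const])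
  show "(\<lambda>n. l2norm M (\<lambda>x. f n x - h x) * l2norm M y) \<longlonglongrightarrow> 0"
    using tendsto_mult_right[OF assms(4), of "l2norm M y"] by simp
  show "\<forall>\<^sub>F n in sequentially. \<bar>l2inner M (f n) y - l2inner M h y\<bar> \<le> l2norm M (\<lambda>x. f n x - h x) * l2norm M y"
    using l2inner_Cauchy_Schwarz[of "\<lambda>x. f _ x - h x" M y] assms by (simp add: l2inner_diff_left)
qed simp

lemma tendsto_l2norm:
  assumes "\<And>n. f n \<in> L2 M" "h \<in> L2 M" "(\<lambda>n. l2norm M (\<lambda>x. f n x - h x)) \<longlonglongrightarrow> 0"
  shows "(\<lambda>n. l2norm M (f n)) \<longlonglongrightarrow> l2norm M h"
proof (rule LIM_zero_cancel, rule tendsto_rabs_zero_cancel, rule tendsto_sandwich[OF _ _ tendsto_const assms(3)])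
  show "\<forall>\<^sub>F n in sequentially. \<bar>l2norm M (f n) - l2norm M h\<bar> \<le> l2norm M (\<lambda>x. f n x - h x)"
    by (intro always_eventually allI l2norm_reverse_triangle assms)
qed simp

section \<open>Compact symmetric operators on \<open>L\<^sup>2\<close>\<close>

text \<open>
  Additivity and homogeneity hold pointwise, so they can be used as rewrite rules under \<open>K\<close>. All limits
  come from the last assumption, compactness in terms of sequences.
\<close>

locale compact_symmetric =
  fixes M :: "'a measure" and K :: "('a \<Rightarrow> complex) \<Rightarrow> 'a \<Rightarrow> complex" and C :: real
  assumes K_L2 [simp, intro]: "f \<in> L2 M \<Longrightarrow> K f \<in> L2 M"
    and K_add: "f \<in> L2 M \<Longrightarrow> g \<in> L2 M \<Longrightarrow> K (\<lambda>x. f x + g x) = (\<lambda>x. K f x + K g x)"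
    and K_scale: "f \<in> L2 M \<Longrightarrow> K (\<lambda>x. of_real c * f x) = (\<lambda>x. of_real c * K f x)"
    and bounded: "f \<in> L2 M \<Longrightarrow> l2norm M (K f) \<le> C * l2norm M f"
    and symmetric: "f \<in> L2 M \<Longrightarrow> g \<in> L2 M \<Longrightarrow> l2inner M (K f) g = l2inner M f (K g)"
    and compact: "(\<And>n::nat. s n \<in> L2 M) \<Longrightarrow> (\<And>n. l2norm M (s n) \<le> R) \<Longrightarrow>
      \<exists>h\<in>L2 M. \<exists>r::nat \<Rightarrow> nat. strict_mono r \<and> (\<lambda>n. l2norm M (\<lambda>x. K (s (r n)) x - h x)) \<longlonglongrightarrow> 0"
begin

lemma K_diff: "f \<in> L2 M \<Longrightarrow> g \<in> L2 M \<Longrightarrow> K (\<lambda>x. f x - g x) = (\<lambda>x. K f x - K g x)"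
  using K_add[of f "\<lambda>x. of_real (-1) * g x"] K_scale[of g "-1"] by simp

lemma C_nonneg: "f \<in> L2 M \<Longrightarrow> l2norm M f \<noteq> 0 \<Longrightarrow> 0 \<le> C"
  using bounded[of f] l2norm_nonneg[of M "K f"] l2norm_nonneg[of M f]
  by (metis linorder_not_less mult_neg_pos order_le_less order_less_le_trans)

text \<open>
  The subspace of all functions orthogonal to \<open>Y\<close> is invariant, and \<open>K\<close> vanishes on it:
  otherwise let \<open>\<nu>\<close> be its norm there and let \<open>v\<^sub>n\<close> be in the unit ball with \<open>\<parallel>K v\<^sub>n\<parallel> \<longrightarrow> \<nu>\<close>. Symmetry gives
  \<open>K\<^sup>2 v\<^sub>n - \<nu>\<^sup>2 v\<^sub>n \<longrightarrow> 0\<close>, so a limit point \<open>u\<close> of \<open>K v\<^sub>n\<close> satisfies \<open>(K - \<nu>) (K + \<nu>) u = 0\<close>, and one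
  of \<open>u\<close>, \<open>(K + \<nu>) u\<close> is an eigenvector orthogonal to itself. Once \<open>K\<close> vanishes there, every element of
  the subspace is an eigenvector with eigenvalue 0, orthogonal to itself again.
\<close>

lemma orthogonal_to_eigenvectors:
  assumes Y: "Y \<subseteq> L2 M" and KY: "\<And>y. y \<in> Y \<Longrightarrow> K y \<in> Y"
    and eig: "\<And>f \<nu>. f \<in> L2 M \<Longrightarrow> (AE x in M. K f x = of_real \<nu> * f x) \<Longrightarrow> f \<in> Y"
    and v: "v \<in> L2 M" and orth: "\<And>y. y \<in> Y \<Longrightarrow> l2inner M v y = 0"
  shows "l2norm M v = 0"
proof -
  define V where "V = {v \<in> L2 M. \<forall>y\<in>Y. l2inner M v y = 0}"
  have VL2: "f \<in> L2 M" if "f \<in> V" for f using that by (simp add: V_def)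
  have KV: "K f \<in> V" if "f \<in> V" for f
    using that KY Y by (auto simp: V_def symmetric subset_iff)
  have V_add: "(\<lambda>x. f x + g x) \<in> V" if "f \<in> V" "g \<in> V" for f g
    using that Y by (auto simp: V_def l2inner_add_left subset_iff)
  have V_scale: "(\<lambda>x. of_real c * f x) \<in> V" if "f \<in> V" for f c
    using that by (auto simp: V_def l2inner_scale_left)
  have VY: "l2norm M f = 0" if "f \<in> V" "f \<in> Y" for f
    using that l2norm_square[of M f] by (auto simp: V_def)
  have eig0: "l2norm M f = 0" if "f \<in> V" "l2norm M (\<lambda>x. K f x - of_real \<nu> * f x) = 0" for f \<nu>
    using that VL2 by (intro VY[OF that(1)] eig[of f \<nu>]) (auto simp: l2norm_eq_0_iff)
  have K0: "l2norm M (K f) = 0" if f: "f \<in> V" for f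
  proof (rule ccontr)
    assume "l2norm M (K f) \<noteq> 0"
    then have Kf: "0 < l2norm M (K f)" using l2norm_nonneg[of M "K f"] by linarith
    have C0: "0 \<le> C"
      using C_nonneg[OF VL2[OF f]] bounded[OF VL2[OF f]] Kf by fastforce
    have Nf: "0 < l2norm M f"
      using bounded[OF VL2[OF f]] Kf by (intro l2norm_pos) auto
    define W where "W = {l2norm M (K g) |g. g \<in> V \<and> l2norm M g \<le> 1}"
    define \<nu> where "\<nu> = Sup W"
    have bdd: "bdd_above W"
      unfolding W_def
    proof (rule bdd_aboveI[of _ C], clarify)
      fix g assume "g \<in> V" "l2norm M g \<le> 1"
      then show "l2norm M (K g) \<le> C"
        using bounded[OF VL2, of g] mult_left_mono[of "l2norm M g" 1 C] C0 by simp
    qed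
    have normalize: "l2norm M (K g) / l2norm M g \<in> W" if "g \<in> V" "0 < l2norm M g" for g
    proof -
      let ?g = "\<lambda>x. of_real (1 / l2norm M g) * g x"
      have 1: "?g \<in> V" by (rule V_scale[OF that(1)])
      have 2: "l2norm M ?g \<le> 1" and 3: "l2norm M (K ?g) = l2norm M (K g) / l2norm M g"
        using that by (simp_all only: K_scale[OF VL2[OF that(1)]] l2norm_cmult) (simp_all add: norm_divide)
      then show ?thesis
        unfolding W_def by (intro CollectI exI[of _ ?g] conjI 1 2 3[symmetric])
    qed
    have \<nu>: "0 < \<nu>"
      using cSup_upper[OF normalize[OF f Nf] bdd] Kf Nf unfolding \<nu>_def
      by (meson divide_pos_pos order_less_le_trans)
    define m where "m = \<nu>\<^sup>2"
    have m0: "0 \<le> m" by (simp add: m_def)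
    have K\<nu>: "l2norm M (K g) \<le> \<nu> * l2norm M g" if "g \<in> V" for g
    proof (cases "l2norm M g = 0")
      case True
      then show ?thesis using bounded[OF VL2[OF that]] by simp
    next
      case False
      then have "0 < l2norm M g" using l2norm_nonneg[of M g] by linarith
      then show ?thesis
        using cSup_upper[OF normalize[OF that] bdd] by (simp add: \<nu>_def pos_divide_le_eq)
    qed
    have "\<exists>g. g \<in> V \<and> l2norm M g \<le> 1 \<and> \<nu> - 1 / real (Suc n) < l2norm M (K g)" for n
    proof -
      have "W \<noteq> {}" using normalize[OF f Nf] by blast
      moreover have "\<nu> - 1 / real (Suc n) < Sup W" by (simp add: \<nu>_def)
      ultimately show ?thesis using less_cSup_iff[OF _ bdd] unfolding W_def by blast
    qed
    then obtain g where g: "\<And>n. g n \<in> V" "\<And>n. l2norm M (g n) \<le> 1"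
      and g\<nu>: "\<And>n. \<nu> - 1 / real (Suc n) < l2norm M (K (g n))"
      by metis
    have gL2 [simp]: "g n \<in> L2 M" for n using g VL2 by blast
    have lim\<nu>: "(\<lambda>n. l2norm M (K (g n))) \<longlonglongrightarrow> \<nu>"
    proof (rule tendsto_sandwich[OF _ _ _ tendsto_const])
      show "(\<lambda>n. \<nu> - 1 / real (Suc n)) \<longlonglongrightarrow> \<nu>"
        using tendsto_diff[OF tendsto_const LIMSEQ_Suc[OF lim_1_over_n], of \<nu>] by simp
      show "\<forall>\<^sub>F n in sequentially. \<nu> - 1 / real (Suc n) \<le> l2norm M (K (g n))"
        using g\<nu> by (simp add: less_imp_le)
      show "\<forall>\<^sub>F n in sequentially. l2norm M (K (g n)) \<le> \<nu>"
      proof (intro always_eventually allI)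
        show "l2norm M (K (g n)) \<le> \<nu>" for n
          using K\<nu>[OF g(1), of n] mult_left_mono[OF g(2) less_imp_le[OF \<nu>], of n] by linarith
      qed
    qed
    let ?d = "\<lambda>n x. K (K (g n)) x - of_real (m) * g n x"
    \<comment> \<open>expanding the square; the mixed term is \<open>\<parallel>K (g n)\<parallel>\<^sup>2\<close> by symmetry\<close>
    have d_le: "(l2norm M (?d n))\<^sup>2 \<le> m * (m - (l2norm M (K (g n)))\<^sup>2)" for n
    proof -
      have "l2inner M (K (K (g n))) (g n) = (l2norm M (K (g n)))\<^sup>2"
        by (simp add: symmetric l2norm_square)
      then have "(l2norm M (?d n))\<^sup>2 = (l2norm M (K (K (g n))))\<^sup>2 - 2 * m * (l2norm M (K (g n)))\<^sup>2
          + (m)\<^sup>2 * (l2norm M (g n))\<^sup>2"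
        by (subst l2norm_diff_scale_square) auto
      moreover have "(l2norm M (K (K (g n))))\<^sup>2 \<le> m * (l2norm M (K (g n)))\<^sup>2"
        using power_mono[OF K\<nu>[OF KV[OF g(1)]], of n 2] by (simp add: power_mult_distrib m_def)
      moreover have "(m)\<^sup>2 * (l2norm M (g n))\<^sup>2 \<le> (m)\<^sup>2 * 1"
        using power_mono[OF g(2), of n 2] by (intro mult_left_mono) auto
      ultimately show ?thesis by (simp add: power2_eq_square algebra_simps)
    qed
    have lim_d: "(\<lambda>n. l2norm M (?d n)) \<longlonglongrightarrow> 0"
    proof -
      have "(\<lambda>n. m * (m - (l2norm M (K (g n)))\<^sup>2)) \<longlonglongrightarrow> m * (m - \<nu>\<^sup>2)"
        by (intro tendsto_intros lim\<nu>)
      then have "(\<lambda>n. (l2norm M (?d n))\<^sup>2) \<longlonglongrightarrow> 0"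
        by (intro tendsto_zero_squeeze[OF _ d_le]) (auto simp: m_def)
      then show ?thesis using tendsto_real_sqrt[of "\<lambda>n. (l2norm M (?d n))\<^sup>2" 0] by simp
    qed
    obtain u r where u: "u \<in> L2 M" and r: "strict_mono r"
      and lim: "(\<lambda>n. l2norm M (\<lambda>x. K (g (r n)) x - u x)) \<longlonglongrightarrow> 0"
      using compact[of g 1] g gL2 by blast
    have uV: "u \<in> V"
    proof -
      have "l2inner M u y = 0" if "y \<in> Y" for y
        using tendsto_l2inner[OF _ u _ lim, of y] that Y KV[OF g(1)]
        by (auto simp: V_def subset_iff LIMSEQ_const_iff)
      then show ?thesis using u by (simp add: V_def)
    qed
    have Nu: "l2norm M u = \<nu>"
      using LIMSEQ_unique[OF tendsto_l2norm[OF _ u lim] LIMSEQ_subseq_LIMSEQ[OF lim\<nu> r, unfolded o_def]] by simp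
    have "l2norm M (\<lambda>x. K (K u) x - of_real (m) * u x) \<le>
        (C * C + m) * l2norm M (\<lambda>x. K (g (r n)) x - u x) + C * l2norm M (?d (r n))" for n
    proof -
      let ?w = "K (g (r n))"
      let ?s = "\<lambda>x. ?w x - u x"
      have s: "?s \<in> L2 M" and dL: "?d (r n) \<in> L2 M" using u by auto
      have "(\<lambda>x. K (K u) x - of_real (m) * u x) =
          (\<lambda>x. (K (?d (r n)) x + of_real (m) * ?s x) - K (K ?s) x)"
        using u by (simp add: K_diff K_scale K_diff[of "K _" "\<lambda>x. _ * _ x"]) (simp add: algebra_simps)
      then have "l2norm M (\<lambda>x. K (K u) x - of_real (m) * u x) \<le>
          l2norm M (\<lambda>x. K (?d (r n)) x + of_real (m) * ?s x) + l2norm M (K (K ?s))"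
        using l2norm_triangle[of "\<lambda>x. K (?d (r n)) x + of_real (m) * ?s x" M
            "\<lambda>x. - 1 * K (K ?s) x"] l2norm_cmult[of M "-1" "K (K ?s)"] s dL by (simp)
      also have "\<dots> \<le> (C * l2norm M (?d (r n)) + m * l2norm M ?s) + C * (C * l2norm M ?s)"
      proof (rule add_mono)
        have "l2norm M (\<lambda>x. K (?d (r n)) x + of_real (m) * ?s x) \<le>
            l2norm M (K (?d (r n))) + l2norm M (\<lambda>x. of_real (m) * ?s x)"
          using s dL by (intro l2norm_triangle K_L2 L2_cmult)
        also have "l2norm M (\<lambda>x. of_real (m) * ?s x) = m * l2norm M ?s"
          using m0 by (simp add: l2norm_cmult)
        finally show "l2norm M (\<lambda>x. K (?d (r n)) x + of_real (m) * ?s x) \<le>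
            C * l2norm M (?d (r n)) + m * l2norm M ?s"
          using bounded[OF dL] by linarith
        show "l2norm M (K (K ?s)) \<le> C * (C * l2norm M ?s)"
          using bounded[OF K_L2[OF s]] mult_left_mono[OF bounded[OF s] C0] by linarith
      qed
      finally show ?thesis by (simp add: algebra_simps)
    qed
    moreover have "(\<lambda>n. (C * C + m) * l2norm M (\<lambda>x. K (g (r n)) x - u x) + C * l2norm M (?d (r n))) \<longlonglongrightarrow>
        (C * C + m) * 0 + C * 0"
      by (intro tendsto_intros lim LIMSEQ_subseq_LIMSEQ[OF lim_d r, unfolded o_def])
    ultimately have "l2norm M (\<lambda>x. K (K u) x - of_real (m) * u x) \<le> 0"
      using LIMSEQ_le_const by fastforce
    then have sq: "l2norm M (\<lambda>x. K (K u) x - of_real (m) * u x) = 0"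
      using l2norm_nonneg[of M "\<lambda>x. K (K u) x - of_real (m) * u x"] by linarith
    define p where "p = (\<lambda>x. K u x + of_real \<nu> * u x)"
    have pV: "p \<in> V" unfolding p_def by (intro V_add V_scale KV uV)
    have "(\<lambda>x. K p x - of_real \<nu> * p x) = (\<lambda>x. K (K u) x - of_real (m) * u x)"
      using u by (simp add: p_def K_add K_scale) (simp add: power2_eq_square m_def algebra_simps)
    then have "l2norm M p = 0" using eig0[OF pV, of \<nu>] sq by simp
    moreover have "p = (\<lambda>x. K u x - of_real (- \<nu>) * u x)" by (simp add: p_def)
    ultimately have "l2norm M u = 0" using eig0[OF uV, of "-\<nu>"] by simp
    with Nu \<nu> show False by simp
  qed
  have "v \<in> V" using v orth by (simp add: V_def)
  then show ?thesis
    using K0 eig0[of v 0] by simp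
qed

text \<open>
  The residuals \<open>r\<^sub>n\<close> of a minimizing sequence need not converge, but along a subsequence \<open>K r\<^sub>n\<close> does. Its
  limit is orthogonal to \<open>Y\<close> and hence zero, which makes \<open>K g\<close> a limit of elements of \<open>Y\<close>.
\<close>

theorem range_in_closure_of_eigenvectors:
  assumes Y: "Y \<subseteq> L2 M" and Y0: "(\<lambda>x. 0) \<in> Y"
    and Y_add: "\<And>f g. f \<in> Y \<Longrightarrow> g \<in> Y \<Longrightarrow> (\<lambda>x. f x + g x) \<in> Y"
    and Y_scale: "\<And>f c. f \<in> Y \<Longrightarrow> (\<lambda>x. of_real c * f x) \<in> Y"
    and KY: "\<And>y. y \<in> Y \<Longrightarrow> K y \<in> Y"
    and eig: "\<And>f \<nu>. f \<in> L2 M \<Longrightarrow> (AE x in M. K f x = of_real \<nu> * f x) \<Longrightarrow> f \<in> Y"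
    and g: "g \<in> L2 M" and \<epsilon>: "0 < \<epsilon>"
  shows "\<exists>y\<in>Y. l2norm M (\<lambda>x. K g x - y x) < \<epsilon>"
proof -
  define D where "D = (\<lambda>y. l2norm M (\<lambda>x. g x - y x)) ` Y"
  define d where "d = Inf D"
  have YL2: "y \<in> L2 M" if "y \<in> Y" for y using that Y by blast
  have bdd: "bdd_below D" unfolding D_def by (intro bdd_belowI[of _ 0]) auto
  have ne: "D \<noteq> {}" using Y0 by (auto simp: D_def)
  have d_le: "d \<le> l2norm M (\<lambda>x. g x - y x)" if "y \<in> Y" for y
    unfolding d_def by (rule cInf_lower[OF _ bdd]) (use that in \<open>auto simp: D_def\<close>)
  have d0: "0 \<le> d" unfolding d_def by (rule cInf_greatest[OF ne]) (auto simp: D_def)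
  have "\<exists>y\<in>Y. l2norm M (\<lambda>x. g x - y x) < d + 1 / real (Suc n)" for n
  proof -
    have "Inf D < d + 1 / real (Suc n)" by (simp add: d_def)
    then show ?thesis using cInf_less_iff[OF ne bdd] by (auto simp: D_def)
  qed
  then obtain y where y: "\<And>n. y n \<in> Y" and yd: "\<And>n. l2norm M (\<lambda>x. g x - y n x) < d + 1 / real (Suc n)"
    by metis
  define r where "r n = (\<lambda>x. g x - y n x)" for n
  have rL2 [simp]: "r n \<in> L2 M" for n using g YL2[OF y] by (simp add: r_def)
  have "l2norm M (r n) \<le> d + 1" for n
    using yd[of n] by (simp add: r_def) (smt (verit) divide_le_eq_1 of_nat_0_le_iff)
  then obtain h s where h: "h \<in> L2 M" and s: "strict_mono s"
    and lim: "(\<lambda>n. l2norm M (\<lambda>x. K (r (s n)) x - h x)) \<longlonglongrightarrow> 0"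
    using compact[of r "d+1"] rL2 by blast
  have lim_d: "(\<lambda>n. (l2norm M (r n))\<^sup>2 - d\<^sup>2) \<longlonglongrightarrow> 0"
  proof -
    have "(\<lambda>n. l2norm M (r n)) \<longlonglongrightarrow> d"
    proof (rule tendsto_sandwich[OF _ _ tendsto_const])
      show "(\<lambda>n. d + 1 / real (Suc n)) \<longlonglongrightarrow> d"
        using tendsto_add[OF tendsto_const LIMSEQ_Suc[OF lim_1_over_n], of d] by simp
    qed (use d_le[OF y] yd in \<open>auto simp: r_def less_imp_le\<close>)
    then have "(\<lambda>n. (l2norm M (r n))\<^sup>2 - d\<^sup>2) \<longlonglongrightarrow> d\<^sup>2 - d\<^sup>2" by (intro tendsto_intros)
    then show ?thesis by simp
  qed
  have inner0: "(\<lambda>n. l2inner M (r n) z) \<longlonglongrightarrow> 0" if z: "z \<in> Y" for z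
  proof -
    have "(l2inner M (r n) z)\<^sup>2 \<le> ((l2norm M (r n))\<^sup>2 - d\<^sup>2) * (l2norm M z)\<^sup>2" for n
    proof (rule nonneg_quadratic_discriminant)
      fix t :: real
      have "(\<lambda>x. y n x + of_real t * z x) \<in> Y" by (intro Y_add Y_scale y z)
      from d_le[OF this] have "d \<le> l2norm M (\<lambda>x. r n x - of_real t * z x)"
        by (simp add: r_def algebra_simps)
      then have "d\<^sup>2 \<le> (l2norm M (\<lambda>x. r n x - of_real t * z x))\<^sup>2"
        using d0 by (intro power_mono)
      then show "0 \<le> (l2norm M (r n))\<^sup>2 - d\<^sup>2 - 2 * t * l2inner M (r n) z + t\<^sup>2 * (l2norm M z)\<^sup>2"
        using l2norm_diff_scale_square[OF rL2 YL2[OF z], of n t] by simp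
    qed simp
    then have "(\<lambda>n. (l2inner M (r n) z)\<^sup>2) \<longlonglongrightarrow> 0"
      using tendsto_mult_right[OF lim_d, of "(l2norm M z)\<^sup>2"]
      by (intro tendsto_zero_squeeze[of "\<lambda>n. (l2inner M (r n) z)\<^sup>2"]) auto
    then show ?thesis
      using tendsto_real_sqrt[of "\<lambda>n. (l2inner M (r n) z)\<^sup>2" 0] by (simp add: tendsto_rabs_zero_iff)
  qed
  have "l2inner M h z = 0" if z: "z \<in> Y" for z
  proof -
    have "(\<lambda>n. l2inner M (K (r (s n))) z) \<longlonglongrightarrow> l2inner M h z"
      by (rule tendsto_l2inner[OF _ h YL2[OF z] lim]) auto
    moreover have "(\<lambda>n. l2inner M (K (r (s n))) z) \<longlonglongrightarrow> 0"
      using LIMSEQ_subseq_LIMSEQ[OF inner0[OF KY[OF z]] s] YL2[OF z] by (simp add: o_def symmetric)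
    ultimately show ?thesis by (rule LIMSEQ_unique)
  qed
  then have "l2norm M h = 0"
    by (intro orthogonal_to_eigenvectors[OF Y KY eig h])
  then have "(\<lambda>n. l2norm M (K (r (s n)))) \<longlonglongrightarrow> 0"
    using tendsto_l2norm[OF _ h lim] by simp
  then obtain n where "l2norm M (K (r (s n))) < \<epsilon>"
    using order_tendstoD(2)[OF _ \<epsilon>] eventually_happens'[OF sequentially_bot] by blast
  moreover have "K (r (s n)) = (\<lambda>x. K g x - K (y (s n)) x)"
    using g YL2[OF y] by (simp add: r_def[abs_def] K_diff)
  ultimately show ?thesis using KY[OF y] by auto
qed

end

section \<open>Primitives of square integrable functions\<close>

lemma AE_lebesgue_on_iff_negligible:
  assumes "S \<in> sets lebesgue"
  shows "(AE x in lebesgue_on S. P x) \<longleftrightarrow> (\<exists>N. negligible N \<and> (\<forall>x\<in>S - N. P x))"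
proof -
  have "(AE x in lebesgue_on S. P x) \<longleftrightarrow> (AE x in lebesgue. x \<in> S \<longrightarrow> P x)"
    using assms by (simp add: AE_restrict_space_iff)
  also have "\<dots> \<longleftrightarrow> (\<exists>N. negligible N \<and> {x. \<not> (x \<in> S \<longrightarrow> P x)} \<subseteq> N)"
    by (simp add: eventually_ae_filter negligible_iff_null_sets Bex_def)
  also have "\<dots> \<longleftrightarrow> (\<exists>N. negligible N \<and> (\<forall>x\<in>S - N. P x))"
    by (intro ex_cong1 conj_cong refl) blast
  finally show ?thesis .
qed

lemma L2_lebesgue_on_subset:
  fixes f :: "real \<Rightarrow> complex"
  assumes f: "f \<in> L2 (lebesgue_on S)" and "T \<subseteq> S" and S: "S \<in> sets lebesgue" and T: "T \<in> sets lebesgue"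
  shows "f \<in> L2 (lebesgue_on T)" "l2norm (lebesgue_on T) f \<le> l2norm (lebesgue_on S) f"
proof -
  have meas: "f \<in> borel_measurable (lebesgue_on T)"
    using L2_D(1)[OF f] \<open>T \<subseteq> S\<close> measurable_restrict_mono by blast
  have si: "set_integrable lebesgue S (\<lambda>x. (cmod (f x))\<^sup>2)"
    using L2_D(2)[OF f] S by (simp add: set_integrable_def integrable_restrict_space)
  then have ti: "set_integrable lebesgue T (\<lambda>x. (cmod (f x))\<^sup>2)"
    using set_integrable_subset T \<open>T \<subseteq> S\<close> by blast
  then have "integrable (lebesgue_on T) (\<lambda>x. (cmod (f x))\<^sup>2)"
    using T by (simp add: set_integrable_def integrable_restrict_space)
  then show "f \<in> L2 (lebesgue_on T)"
    using meas by (simp add: L2_def)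
  have "(\<integral>x. (cmod (f x))\<^sup>2 \<partial>lebesgue_on T) \<le> (\<integral>x. (cmod (f x))\<^sup>2 \<partial>lebesgue_on S)"
    using si ti S T \<open>T \<subseteq> S\<close> unfolding set_integrable_def
    by (auto simp: integral_restrict_space intro!: integral_mono split: split_indicator)
  then show "l2norm (lebesgue_on T) f \<le> l2norm (lebesgue_on S) f"
    by (simp add: l2norm_def)
qed

lemma finite_measure_lebesgue_on_bounded:
  fixes S :: "real set"
  assumes "S \<in> lmeasurable"
  shows "finite_measure (lebesgue_on S)"
proof
  have "emeasure (lebesgue_on S) S = emeasure lebesgue S"
    using assms by (intro emeasure_restrict_space) (auto dest: fmeasurableD)
  then show "emeasure (lebesgue_on S) (space (lebesgue_on S)) \<noteq> \<infinity>"
    using fmeasurableD2[OF assms] by (simp only: space_lebesgue_on infinity_ennreal_def simp_thms)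
qed

lemma L2_bounded_measurable:
  assumes "finite_measure M" "f \<in> borel_measurable M" "\<And>x. x \<in> space M \<Longrightarrow> cmod (f x) \<le> C"
  shows "f \<in> L2 M"
proof (rule L2_bound[OF assms(2), where g="\<lambda>_. C\<^sup>2"])
  show "integrable M (\<lambda>_. C\<^sup>2)" using assms(1) by (simp add: finite_measure.integrable_const)
  show "AE x in M. (cmod (f x))\<^sup>2 \<le> C\<^sup>2"
    using assms(3) by (auto intro!: AE_I2 power_mono)
qed

lemma continuous_on_imp_L2:
  fixes f :: "real \<Rightarrow> complex"
  assumes "compact S" "continuous_on S f"
  shows "f \<in> L2 (lebesgue_on S)"
proof -
  have S: "S \<in> lmeasurable" using assms(1) by (rule lmeasurable_compact)
  obtain C where "\<And>x. x \<in> S \<Longrightarrow> cmod (f x) \<le> C"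
    using compact_imp_bounded[OF compact_continuous_image[OF assms(2,1)]] by (metis bounded_iff imageI)
  then show ?thesis
    using S assms(2) by (intro L2_bounded_measurable[where C=C] finite_measure_lebesgue_on_bounded
        continuous_imp_measurable_on_sets_lebesgue) auto
qed

lemma integrable_L2:
  assumes "finite_measure M" "f \<in> L2 M"
  shows "integrable M f"
proof (rule Bochner_Integration.integrable_bound)
  show "integrable M (\<lambda>x. 1 + (cmod (f x))\<^sup>2)"
    using assms by (auto dest: L2_D simp: finite_measure.integrable_const)
  show "f \<in> borel_measurable M" using assms by (auto dest: L2_D)
  have "a \<le> 1 + a\<^sup>2" for a :: real
  proof -
    have "0 \<le> (2 * a - 1)\<^sup>2" by simp
    then have "4 * a \<le> 1 + 4 * (a * a)" by (simp add: power2_eq_square algebra_simps)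
    then show ?thesis using zero_le_square[of a] unfolding power2_eq_square by linarith
  qed
  then show "AE x in M. norm (f x) \<le> norm (1 + (cmod (f x))\<^sup>2)"
    by simp
qed

lemma L2_integrable_on:
  fixes g :: "real \<Rightarrow> complex"
  assumes g: "g \<in> L2 (lebesgue_on {a..b})"
  shows "g integrable_on {a..b}" "(\<lambda>x. (cmod (g x))\<^sup>2) integrable_on {a..b}"
    "integral {a..b} (\<lambda>x. (cmod (g x))\<^sup>2) = (l2norm (lebesgue_on {a..b}) g)\<^sup>2"
proof -
  have "finite_measure (lebesgue_on {a..b})" by (rule finite_measure_lebesgue_on_bounded) simp
  then show "g integrable_on {a..b}"
    by (intro integrable_on_lebesgue_on integrable_L2 g) auto
  show "(\<lambda>x. (cmod (g x))\<^sup>2) integrable_on {a..b}"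
    by (intro integrable_on_lebesgue_on L2_D g) auto
  show "integral {a..b} (\<lambda>x. (cmod (g x))\<^sup>2) = (l2norm (lebesgue_on {a..b}) g)\<^sup>2"
    unfolding l2norm_square' by (rule lebesgue_integral_eq_integral[symmetric]) (auto intro: L2_D g)
qed

lemma L2_continuous_mult:
  fixes g :: "real \<Rightarrow> complex"
  assumes g: "g \<in> L2 (lebesgue_on S)" and S: "S \<in> sets lebesgue" and m: "continuous_on S m"
    and C: "\<And>x. x \<in> S \<Longrightarrow> cmod (m x) \<le> C"
  shows "(\<lambda>x. m x * g x) \<in> L2 (lebesgue_on S)"
    "l2norm (lebesgue_on S) (\<lambda>x. m x * g x) \<le> \<bar>C\<bar> * l2norm (lebesgue_on S) g"
proof -
  have meas: "(\<lambda>x. m x * g x) \<in> borel_measurable (lebesgue_on S)"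
    using L2_D(1)[OF g] continuous_imp_measurable_on_sets_lebesgue[OF m S] by simp
  have int: "integrable (lebesgue_on S) (\<lambda>x. C\<^sup>2 * (cmod (g x))\<^sup>2)"
    using L2_D(2)[OF g] by simp
  have le: "(cmod (m x * g x))\<^sup>2 \<le> C\<^sup>2 * (cmod (g x))\<^sup>2" if "x \<in> S" for x
    using C[OF that] by (simp add: norm_mult power_mult_distrib mult_right_mono power_mono)
  show L: "(\<lambda>x. m x * g x) \<in> L2 (lebesgue_on S)"
    using le S by (intro L2_bound[OF meas int] AE_I2) (auto simp: space_restrict_space)
  have "(l2norm (lebesgue_on S) (\<lambda>x. m x * g x))\<^sup>2 \<le> (\<integral>x. C\<^sup>2 * (cmod (g x))\<^sup>2 \<partial>lebesgue_on S)"
    unfolding l2norm_square'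
    using le S by (intro integral_mono L2_D(2)[OF L] int) (auto simp: space_restrict_space)
  also have "\<dots> = (\<bar>C\<bar> * l2norm (lebesgue_on S) g)\<^sup>2"
    by (simp add: power_mult_distrib l2norm_square')
  finally show "l2norm (lebesgue_on S) (\<lambda>x. m x * g x) \<le> \<bar>C\<bar> * l2norm (lebesgue_on S) g"
    by (rule power2_le_imp_le) simp
qed

text \<open>
  The inequality \<open>\<bar>g\<bar> \<le> t/2 \<bar>g\<bar>\<^sup>2 + 1/(2t)\<close> with a free parameter \<open>t\<close> serves below for absolute
  continuity, equicontinuity and boundedness alike.
\<close>

lemma sum_norm_integral_le:
  fixes g :: "real \<Rightarrow> complex"
  assumes g: "g \<in> L2 (lebesgue_on {a..b})" and t: "0 < t" and I: "finite I"
    and sub: "\<And>i. i \<in> I \<Longrightarrow> p i \<le> q i \<and> {p i..q i} \<subseteq> {a..b}"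
    and dis: "disjoint_family_on (\<lambda>i. {p i<..<q i}) I"
  shows "(\<Sum>i\<in>I. norm (integral {p i..q i} g))
    \<le> t / 2 * (l2norm (lebesgue_on {a..b}) g)\<^sup>2 + (\<Sum>i\<in>I. q i - p i) / (2 * t)"
proof -
  let ?s = "\<lambda>x. (cmod (g x))\<^sup>2"
  have young: "y \<le> t / 2 * y\<^sup>2 + 1 / (2 * t)" for y :: real
  proof -
    have "0 \<le> (t * y - 1)\<^sup>2 / (2 * t)" using t by simp
    also have "\<dots> = t / 2 * y\<^sup>2 + 1 / (2 * t) - y"
      using t by (simp add: power2_eq_square field_simps)
    finally show ?thesis by simp
  qed
  have int: "g integrable_on {p i..q i}" "?s integrable_on {p i..q i}" if "i \<in> I" for i
    using integrable_on_subinterval[OF L2_integrable_on(1)[OF g]]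
      integrable_on_subinterval[OF L2_integrable_on(2)[OF g]] sub[OF that] by auto
  have "(\<Sum>i\<in>I. norm (integral {p i..q i} g)) \<le> (\<Sum>i\<in>I. t / 2 * integral {p i..q i} ?s + (q i - p i) / (2 * t))"
  proof (rule sum_mono)
    fix i assume i: "i \<in> I"
    have h: "((\<lambda>x. t / 2 * ?s x + 1 / (2 * t)) has_integral
        (t / 2 * integral {p i..q i} ?s + (q i - p i) *\<^sub>R (1 / (2 * t)))) {p i..q i}"
      using sub[OF i] has_integral_const_real[of "1 / (2 * t)" "p i" "q i"]
      by (intro has_integral_add has_integral_mult_right integrable_integral int[OF i]) auto
    have "norm (integral {p i..q i} g) \<le> integral {p i..q i} (\<lambda>x. t / 2 * ?s x + 1 / (2 * t))"
      using h int[OF i] young by (intro integral_norm_bound_integral) (auto simp: integrable_on_def)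
    then show "norm (integral {p i..q i} g) \<le> t / 2 * integral {p i..q i} ?s + (q i - p i) / (2 * t)"
      using integral_unique[OF h] by simp
  qed
  also have "\<dots> = t / 2 * (\<Sum>i\<in>I. integral {p i..q i} ?s) + (\<Sum>i\<in>I. q i - p i) / (2 * t)"
    by (simp add: sum.distrib sum_distrib_left sum_divide_distrib)
  also have "\<dots> \<le> t / 2 * (l2norm (lebesgue_on {a..b}) g)\<^sup>2 + (\<Sum>i\<in>I. q i - p i) / (2 * t)"
  proof -
    have "(\<Union>i\<in>I. {p i<..<q i}) \<subseteq> {a..b}"
      using sub by fastforce
    moreover have "(?s has_integral (\<Sum>i\<in>I. integral {p i..q i} ?s)) (\<Union>i\<in>I. {p i<..<q i})"
    proof (rule has_integral_UN[OF I])
      fix i assume i: "i \<in> I"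
      show "(?s has_integral integral {p i..q i} ?s) {p i<..<q i}"
        using integrable_integral[OF int(2)[OF i]] by (simp only: has_integral_Icc_iff_Ioo)
    next
      show "pairwise (\<lambda>i j. negligible ({p i<..<q i} \<inter> {p j<..<q j})) I"
        using dis unfolding disjoint_family_on_def pairwise_def by simp
    qed
    moreover have "(?s has_integral (l2norm (lebesgue_on {a..b}) g)\<^sup>2) {a..b}"
      using L2_integrable_on[OF g] by (metis integrable_integral)
    ultimately have "(\<Sum>i\<in>I. integral {p i..q i} ?s) \<le> (l2norm (lebesgue_on {a..b}) g)\<^sup>2"
      by (rule has_integral_subset_le) auto
    then show ?thesis using t by (simp add: mult_left_mono)
  qed
  finally show ?thesis .
qed

lemma norm_integral_young:
  fixes g :: "real \<Rightarrow> complex"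
  assumes "g \<in> L2 (lebesgue_on {a..b})" "0 < t" "a \<le> p" "p \<le> q" "q \<le> b"
  shows "norm (integral {p..q} g) \<le> t / 2 * (l2norm (lebesgue_on {a..b}) g)\<^sup>2 + (q - p) / (2 * t)"
  using sum_norm_integral_le[OF assms(1,2), of "{()}" "\<lambda>_. p" "\<lambda>_. q"] assms(3-)
  by (auto simp: disjoint_family_on_def)

text \<open>The choice \<open>t = 1 / \<parallel>g\<parallel>\<close> makes the bound linear in the norm of \<open>g\<close>; if the norm is 0, let \<open>t\<close> grow.\<close>

lemma norm_integral_le_l2norm:
  fixes g :: "real \<Rightarrow> complex"
  assumes g: "g \<in> L2 (lebesgue_on {a..b})" and x: "a \<le> x" "x \<le> b"
  shows "norm (integral {a..x} g) \<le> (1 + b - a) * l2norm (lebesgue_on {a..b}) g"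
proof -
  let ?A = "l2norm (lebesgue_on {a..b}) g"
  show ?thesis
  proof (cases "?A = 0")
    case True
    have "norm (integral {a..x} g) \<le> 0 + e" if "0 < e" for e
    proof -
      let ?t = "(x - a + 1) / e"
      have "norm (integral {a..x} g) \<le> (x - a) / (2 * ?t)"
        using norm_integral_young[OF g, of ?t a x] x that True by simp
      also have "\<dots> \<le> e"
        using that x mult_right_mono[of a "x + 2" e] by (simp add: field_simps)
      finally show ?thesis by simp
    qed
    then have "norm (integral {a..x} g) \<le> 0" by (rule field_le_epsilon)
    then show ?thesis using True by simp
  next
    case False
    then have A: "0 < ?A" using l2norm_nonneg[of "lebesgue_on {a..b}" g] by linarith
    have "norm (integral {a..x} g) \<le> 1 / ?A / 2 * ?A\<^sup>2 + (x - a) / (2 * (1 / ?A))"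
      using A x by (intro norm_integral_young[OF g]) auto
    also have "\<dots> = (1 + x - a) / 2 * ?A"
      using A by (simp add: power2_eq_square field_simps)
    also have "\<dots> \<le> (1 + b - a) * ?A"
      using x A by (intro mult_right_mono) auto
    finally show ?thesis .
  qed
qed

lemma integral_diff_interval:
  fixes g :: "real \<Rightarrow> complex"
  assumes "g integrable_on {a..b}" "a \<le> p" "p \<le> q" "q \<le> b"
  shows "integral {a..q} g - integral {a..p} g = integral {p..q} g"
proof -
  have "g integrable_on {a..q}"
    using assms by (auto intro: integrable_on_subinterval)
  then show ?thesis
    using Henstock_Kurzweil_Integration.integral_combine[of a p q g] assms by (metis add_diff_cancel_left')
qed

lemma abs_continuous_on_integral:
  fixes g :: "real \<Rightarrow> complex"
  assumes g: "g \<in> L2 (lebesgue_on {a..b})"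
  shows "abs_continuous_on {a..b} (\<lambda>x. integral {a..x} g)"
  unfolding abs_continuous_on_def
proof (intro allI impI)
  fix \<epsilon> :: real assume \<epsilon>: "0 < \<epsilon>"
  define Q where "Q = (l2norm (lebesgue_on {a..b}) g)\<^sup>2"
  \<comment> \<open>with this \<open>t\<close> the norm term of the bound is at most \<open>\<epsilon>/2\<close>; the length term is small for short intervals\<close>
  define t where "t = \<epsilon> / (Q + 1)"
  have "0 \<le> Q" by (simp add: Q_def)
  with \<epsilon> have t: "0 < t" "t * Q \<le> \<epsilon>"
    by (auto simp: t_def field_simps)
  show "\<exists>\<delta>>0. \<forall>(n::nat) p q. (\<forall>i<n. p i \<le> q i \<and> {p i..q i} \<subseteq> {a..b}) \<and>
      disjoint_family_on (\<lambda>i. {p i<..<q i}) {..<n} \<and> (\<Sum>i<n. q i - p i) < \<delta> \<longrightarrow>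
      (\<Sum>i<n. norm (integral {a..q i} g - integral {a..p i} g)) < \<epsilon>"
  proof (intro exI[of _ "\<epsilon> * t"] conjI allI impI; (elim conjE)?)
    show "0 < \<epsilon> * t" using \<epsilon> t by simp
    fix n :: nat and p q
    assume pq: "\<forall>i<n. p i \<le> q i \<and> {p i..q i} \<subseteq> {a..b}"
      and dis: "disjoint_family_on (\<lambda>i. {p i<..<q i}) {..<n}" and len: "(\<Sum>i<n. q i - p i) < \<epsilon> * t"
    have "(\<Sum>i<n. norm (integral {a..q i} g - integral {a..p i} g)) = (\<Sum>i<n. norm (integral {p i..q i} g))"
    proof (intro sum.cong refl)
      fix i assume "i \<in> {..<n}"
      with pq have "p i \<le> q i" "{p i..q i} \<subseteq> {a..b}" by auto
      then show "norm (integral {a..q i} g - integral {a..p i} g) = norm (integral {p i..q i} g)"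
        using integral_diff_interval[OF L2_integrable_on(1)[OF g], of "p i" "q i"] by simp
    qed
    also have "\<dots> \<le> t / 2 * Q + (\<Sum>i<n. q i - p i) / (2 * t)"
      unfolding Q_def using pq dis by (intro sum_norm_integral_le[OF g t(1)]) auto
    also have "\<dots> < \<epsilon>"
    proof -
      have "(\<Sum>i<n. q i - p i) / (2 * t) < \<epsilon> / 2"
        using len t(1) by (simp add: field_simps)
      then show ?thesis using t(2) by simp
    qed
    finally show "(\<Sum>i<n. norm (integral {a..q i} g - integral {a..p i} g)) < \<epsilon>" .
  qed
qed

text \<open>
  The one-sided differentiation theorem for indefinite integrals, applied to the integrand and to its
  reflection, gives the two-sided derivative.
\<close>

lemma indefinite_integral_has_vector_derivative_AE:
  fixes g :: "real \<Rightarrow> complex"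
  assumes g: "g integrable_on {a..b}"
  obtains N where "negligible N"
    "\<And>x. x \<in> {a<..<b} - N \<Longrightarrow> ((\<lambda>x. integral {a..x} g) has_vector_derivative g x) (at x)"
proof -
  define h where "h x = (if x \<in> {a..b} then g x else 0)" for x
  define h' where "h' x = h (- x)" for x
  have h: "h integrable_on cbox c d" for c d
  proof -
    have "h integrable_on UNIV" unfolding h_def using g by (simp only: integrable_restrict_UNIV)
    then show ?thesis using integrable_on_subcbox by blast
  qed
  have h': "h' integrable_on cbox c d" for c d
    using Henstock_Kurzweil_Integration.integrable_reflect_real[of h "-c" "-d"] h[of "-d" "-c"] by (simp add: h'_def[abs_def])
  obtain N1 where N1: "negligible N1" and r1: "\<And>x e. x \<notin> N1 \<Longrightarrow> 0 < e \<Longrightarrow> \<exists>d>0. \<forall>s. 0 < s \<and> s < d \<longrightarrow>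
      norm (integral (cbox x (x + s *\<^sub>R One)) h /\<^sub>R s ^ DIM(real) - h x) < e"
    using integrable_ccontinuous_explicit[of h] h by blast
  obtain N2 where N2: "negligible N2" and r2: "\<And>x e. x \<notin> N2 \<Longrightarrow> 0 < e \<Longrightarrow> \<exists>d>0. \<forall>s. 0 < s \<and> s < d \<longrightarrow>
      norm (integral (cbox x (x + s *\<^sub>R One)) h' /\<^sub>R s ^ DIM(real) - h' x) < e"
    using integrable_ccontinuous_explicit[of h'] h' by blast
  define N where "N = N1 \<union> uminus ` N2"
  have "negligible N"
    unfolding N_def using N1 N2
    by (intro negligible_Un negligible_differentiable_image_negligible) (auto intro!: derivative_intros)
  moreover have "((\<lambda>x. integral {a..x} g) has_vector_derivative g x) (at x)" if x: "x \<in> {a<..<b} - N" for x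
    unfolding has_vector_derivative_def has_derivative_at_alt
  proof (intro conjI allI impI)
    show "bounded_linear (\<lambda>h. h *\<^sub>R g x)" by (rule bounded_linear_scaleR_left)
    fix e :: real assume e: "0 < e"
    have xN: "x \<notin> N1" "- x \<notin> N2" and hx: "h x = g x" "h' (- x) = g x"
      using x by (auto simp: N_def h_def h'_def image_iff)
    obtain d1 where d1: "0 < d1" "\<And>s. 0 < s \<Longrightarrow> s < d1 \<Longrightarrow> norm (integral {x..x + s} h /\<^sub>R s - g x) < e"
      using r1[OF xN(1) e] hx by auto
    obtain d2 where d2: "0 < d2" "\<And>s. 0 < s \<Longrightarrow> s < d2 \<Longrightarrow> norm (integral {- x..- x + s} h' /\<^sub>R s - g x) < e"
      using r2[OF xN(2) e] hx by auto
    define d where "d = min (min d1 d2) (min (x - a) (b - x))"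
    have "0 < d" using d1 d2 x by (simp add: d_def)
    moreover have "norm (integral {a..y} g - integral {a..x} g - (y - x) *\<^sub>R g x) \<le> e * norm (y - x)"
      if y: "norm (y - x) < d" for y
    proof -
      have gh: "integral {p..q} g = integral {p..q} h" if "a \<le> p" "q \<le> b" for p q
        using that by (intro Henstock_Kurzweil_Integration.integral_cong) (auto simp: h_def)
      have quot: "norm (I - s *\<^sub>R g x) \<le> e * s" if "0 < s" "norm (I /\<^sub>R s - g x) < e" for I s
      proof -
        have "norm (I - s *\<^sub>R g x) = s * norm (I /\<^sub>R s - g x)"
          using that(1) by (simp flip: norm_scaleR[of s, unfolded abs_of_pos[OF that(1)]] add: scaleR_diff_right)
        then show ?thesis using that by (simp add: mult.commute)
      qed
      have ab: "a \<le> y" "y \<le> b" "a \<le> x" "x \<le> b" using y x by (auto simp: d_def)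
      consider "y = x" | "x < y" | "y < x" by linarith
      then show ?thesis
      proof cases
        case 2
        have "integral {a..y} g - integral {a..x} g = integral {x..x + (y - x)} h"
          using integral_diff_interval[OF g, of x y] gh[of x y] ab 2 by simp
        moreover have "norm (integral {x..x + (y - x)} h - (y - x) *\<^sub>R g x) \<le> e * (y - x)"
          using 2 y by (intro quot d1(2)) (auto simp: d_def)
        ultimately show ?thesis using 2 by simp
      next
        case 3
        have "integral {a..x} g - integral {a..y} g = integral {y..x} h"
          using integral_diff_interval[OF g, of y x] gh[of y x] ab 3 by simp
        also have "\<dots> = integral {- x..- x + (x - y)} h'"
          using Henstock_Kurzweil_Integration.integral_reflect_real[of x y h] by (simp add: h'_def[abs_def])
        finally have eq: "integral {a..y} g - integral {a..x} g - (y - x) *\<^sub>R g x =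
            - (integral {- x..- x + (x - y)} h' - (x - y) *\<^sub>R g x)"
          by (simp add: algebra_simps)
        have "norm (integral {- x..- x + (x - y)} h' - (x - y) *\<^sub>R g x) \<le> e * (x - y)"
          using 3 y by (intro quot d2(2)) (auto simp: d_def)
        then show ?thesis using 3 unfolding eq norm_minus_cancel by simp
      qed simp
    qed
    ultimately show "\<exists>d>0. \<forall>y. norm (y - x) < d \<longrightarrow>
        norm (integral {a..y} g - integral {a..x} g - (y - x) *\<^sub>R g x) \<le> e * norm (y - x)"
      by blast
  qed
  ultimately show thesis by (rule that)
qed

text \<open>
  The solution of \<open>u' = c u + q\<close> that vanishes at \<open>a\<close>. Duhamel's formula is used with \<open>q\<close> in \<open>L\<^sup>2\<close>, when
  the equation holds almost everywhere.
\<close>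

definition duhamel :: "complex \<Rightarrow> real \<Rightarrow> (real \<Rightarrow> complex) \<Rightarrow> real \<Rightarrow> complex" where
  "duhamel c a q x = exp (c * of_real x) * integral {a..x} (\<lambda>t. exp (- c * of_real t) * q t)"

lemma exp_has_vector_derivative:
  "((\<lambda>x. exp (c * complex_of_real x)) has_vector_derivative c * exp (c * of_real x)) (at x within S)"
  by (rule has_vector_derivative_real_field) (auto intro!: derivative_eq_intros)

lemma abs_continuous_on_exp: "abs_continuous_on {a..b} (\<lambda>x. exp (c * complex_of_real x))"
  by (rule abs_continuous_on_C1[where f'="\<lambda>x. c * exp (c * of_real x)"])
    (auto intro!: exp_has_vector_derivative continuous_intros)

lemma L2_exp_mult:
  obtains C where "0 < C" "\<And>q. q \<in> L2 (lebesgue_on {a..b}) \<Longrightarrow>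
    (\<lambda>t. exp (c * complex_of_real t) * q t) \<in> L2 (lebesgue_on {a..b}) \<and>
    l2norm (lebesgue_on {a..b}) (\<lambda>t. exp (c * complex_of_real t) * q t) \<le> C * l2norm (lebesgue_on {a..b}) q"
    "\<And>t. t \<in> {a..b} \<Longrightarrow> cmod (exp (c * complex_of_real t)) \<le> C"
proof -
  have cont: "continuous_on {a..b} (\<lambda>t. exp (c * complex_of_real t))" by (intro continuous_intros)
  then have "bounded ((\<lambda>t. exp (c * complex_of_real t)) ` {a..b})"
    using compact_continuous_image compact_imp_bounded by blast
  then obtain C where C: "0 < C" "\<And>t. t \<in> {a..b} \<Longrightarrow> cmod (exp (c * complex_of_real t)) \<le> C"
    by (metis bounded_pos imageI)
  show thesis
    using L2_continuous_mult[OF _ _ cont C(2)] C by (intro that[of C]) auto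
qed

lemma duhamel_solves:
  assumes q: "q \<in> L2 (lebesgue_on {a..b})"
  obtains N where "negligible N" "abs_continuous_on {a..b} (\<lambda>x. exp (c * of_real x) * C0 + duhamel c a q x)"
    "\<And>x. x \<in> {a<..<b} - N \<Longrightarrow> ((\<lambda>x. exp (c * of_real x) * C0 + duhamel c a q x)
       has_vector_derivative c * (exp (c * of_real x) * C0 + duhamel c a q x) + q x) (at x)"
proof -
  let ?w = "\<lambda>t. exp (- c * complex_of_real t) * q t"
  have w: "?w \<in> L2 (lebesgue_on {a..b})" by (rule L2_exp_mult[of a b "-c"]) (use q in blast)
  have eq: "exp (c * of_real x) * C0 + duhamel c a q x = exp (c * of_real x) * (C0 + integral {a..x} ?w)" for x
    by (simp add: duhamel_def algebra_simps)
  obtain N where N: "negligible N"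
    and der: "\<And>x. x \<in> {a<..<b} - N \<Longrightarrow> ((\<lambda>x. integral {a..x} ?w) has_vector_derivative ?w x) (at x)"
    using indefinite_integral_has_vector_derivative_AE[OF L2_integrable_on(1)[OF w]] by blast
  show thesis
  proof (rule that[OF N])
    have "abs_continuous_on {a..b} (\<lambda>x. C0 + integral {a..x} ?w)"
      by (intro abs_continuous_on_add abs_continuous_on_integral w abs_continuous_on_lipschitz[where C=0]) auto
    then show "abs_continuous_on {a..b} (\<lambda>x. exp (c * of_real x) * C0 + duhamel c a q x)"
      unfolding eq by (intro bounded_bilinear.abs_continuous_on_prod_interval[OF bounded_bilinear_mult]
          abs_continuous_on_exp)
    fix x assume x: "x \<in> {a<..<b} - N"
    have "exp (c * of_real x) * exp (- c * of_real x) = 1"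
      by (simp flip: exp_add)
    then have "exp (c * of_real x) * (0 + ?w x) + c * exp (c * of_real x) * (C0 + integral {a..x} ?w) =
        c * (exp (c * of_real x) * (C0 + integral {a..x} ?w)) + q x"
      by (simp add: mult.assoc[symmetric])
    then show "((\<lambda>x. exp (c * of_real x) * C0 + duhamel c a q x)
       has_vector_derivative c * (exp (c * of_real x) * C0 + duhamel c a q x) + q x) (at x)"
      unfolding eq by (intro has_vector_derivative_eq_rhs[OF has_vector_derivative_mult[OF exp_has_vector_derivative
          has_vector_derivative_add[OF has_vector_derivative_const der[OF x]]]])
  qed
qed

text \<open>The fundamental theorem applies to \<open>exp (- c x) u x\<close>, whose derivative is \<open>exp (- c x) q x\<close>.\<close>

lemma linear_equation_unique_solution:
  fixes u :: "real \<Rightarrow> complex"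
  assumes ac: "abs_continuous_on {a..b} u" and N: "negligible N"
    and der: "\<And>x. x \<in> {a<..<b} - N \<Longrightarrow> (u has_vector_derivative c * u x + q x) (at x)"
    and x: "x \<in> {a..b}"
  shows "u x = exp (c * of_real (x - a)) * u a + duhamel c a q x"
proof -
  let ?w = "\<lambda>t. exp (- c * complex_of_real t) * q t"
  let ?v = "\<lambda>t. exp (- c * complex_of_real t) * u t"
  have "abs_continuous_on {a..x} u" using abs_continuous_on_subset[OF ac] x by auto
  then have acv: "abs_continuous_on {a..x} ?v"
    by (intro bounded_bilinear.abs_continuous_on_prod_interval[OF bounded_bilinear_mult] abs_continuous_on_exp)
  have "(?w has_integral ?v x - ?v a) {a..x}"
  proof (rule fundamental_theorem_abs_continuous[OF _ acv])
    show "negligible (N \<union> {a, b})" using N by simp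
    fix t assume "t \<in> {a..x} - (N \<union> {a, b})"
    then have t: "t \<in> {a<..<b} - N" using x by auto
    have "exp (- c * of_real t) * (c * u t + q t) + - c * exp (- c * of_real t) * u t = ?w t"
      by (simp add: algebra_simps)
    then show "(?v has_vector_derivative ?w t) (at t within {a..x})"
      by (intro has_vector_derivative_eq_rhs[OF has_vector_derivative_mult[OF exp_has_vector_derivative
          has_vector_derivative_at_within[OF der[OF t]]]])
  qed (use x in auto)
  then have "duhamel c a q x = exp (c * of_real x) * (?v x - ?v a)"
    unfolding duhamel_def by (simp add: integral_unique)
  also have "\<dots> = exp (c * of_real x) * exp (- c * of_real x) * u x - exp (c * of_real x + - c * of_real a) * u a"
    by (simp only: exp_add) (simp add: algebra_simps)
  also have "\<dots> = u x - exp (c * of_real (x - a)) * u a"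
    by (simp flip: exp_add) (simp add: algebra_simps)
  finally show ?thesis by simp
qed

lemma duhamel_bound:
  obtains C where "0 < C" "\<And>q x. q \<in> L2 (lebesgue_on {a..b}) \<Longrightarrow> x \<in> {a..b} \<Longrightarrow>
    cmod (duhamel c a q x) \<le> C * l2norm (lebesgue_on {a..b}) q"
proof (cases "a \<le> b")
  case False
  then show thesis by (intro that[of 1]) auto
next
  case True
  obtain A where A: "0 < A" "\<And>q. q \<in> L2 (lebesgue_on {a..b}) \<Longrightarrow>
    (\<lambda>t. exp (- c * complex_of_real t) * q t) \<in> L2 (lebesgue_on {a..b}) \<and>
    l2norm (lebesgue_on {a..b}) (\<lambda>t. exp (- c * complex_of_real t) * q t) \<le> A * l2norm (lebesgue_on {a..b}) q"
    by (rule L2_exp_mult[of a b "-c"], rule that)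
  obtain B where B: "0 < B" "\<And>t. t \<in> {a..b} \<Longrightarrow> cmod (exp (c * complex_of_real t)) \<le> B"
    by (rule L2_exp_mult[of a b c], rule that)
  show thesis
  proof (rule that[of "B * ((1 + b - a) * A)"])
    show "0 < B * ((1 + b - a) * A)" using A B True by simp
    fix q x assume q: "q \<in> L2 (lebesgue_on {a..b})" and x: "x \<in> {a..b}"
    have "cmod (integral {a..x} (\<lambda>t. exp (- c * of_real t) * q t)) \<le>
        (1 + b - a) * l2norm (lebesgue_on {a..b}) (\<lambda>t. exp (- c * complex_of_real t) * q t)"
      using A(2)[OF q] x by (intro norm_integral_le_l2norm) auto
    also have "\<dots> \<le> (1 + b - a) * (A * l2norm (lebesgue_on {a..b}) q)"
      using A(2)[OF q] True by (intro mult_left_mono) auto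
    finally have "cmod (duhamel c a q x) \<le> B * ((1 + b - a) * (A * l2norm (lebesgue_on {a..b}) q))"
      unfolding duhamel_def norm_mult using B x by (intro mult_mono) auto
    then show "cmod (duhamel c a q x) \<le> B * ((1 + b - a) * A) * l2norm (lebesgue_on {a..b}) q"
      by (simp add: mult.assoc)
  qed
qed

section \<open>The momentum operator as a first order differential operator\<close>

lemma two_intervals_lmeasurable [simp]: "two_intervals \<alpha> \<beta> \<in> lmeasurable"
  by (simp add: two_intervals_def fmeasurable.Un)

lemma two_intervals_sets [simp]: "two_intervals \<alpha> \<beta> \<in> sets lebesgue"
  using two_intervals_lmeasurable by (rule fmeasurableD)

lemma two_intervals_compact: "compact (two_intervals \<alpha> \<beta>)"
  by (simp add: two_intervals_def compact_Un)

lemma finite_measure_two_intervals: "finite_measure (lebesgue_on (two_intervals \<alpha> \<beta>))"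
  by (intro finite_measure_lebesgue_on_bounded) simp

lemma borel_measurable_lebesgue_on_cong_AE:
  fixes f g :: "real \<Rightarrow> complex"
  assumes f: "f \<in> borel_measurable (lebesgue_on S)" and S: "S \<in> sets lebesgue"
    and eq: "AE x in lebesgue_on S. f x = g x"
  shows "g \<in> borel_measurable (lebesgue_on S)"
proof -
  have "(\<lambda>x. if x \<in> S then f x else 0) \<in> borel_measurable lebesgue"
    using f S by (simp add: borel_measurable_if)
  moreover have "AE x in lebesgue. (if x \<in> S then f x else 0) = (if x \<in> S then g x else 0)"
    using eq S by (auto simp: AE_restrict_space_iff)
  ultimately have "(\<lambda>x. if x \<in> S then g x else 0) \<in> borel_measurable lebesgue"
    by (rule borel_measurable_AE)
  then show ?thesis using S by (simp add: borel_measurable_if)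
qed

lemma L2_lebesgue_on_cong_AE:
  fixes f g :: "real \<Rightarrow> complex"
  assumes f: "f \<in> L2 (lebesgue_on S)" and S: "S \<in> sets lebesgue"
    and eq: "AE x in lebesgue_on S. f x = g x"
  shows "g \<in> L2 (lebesgue_on S)"
  using borel_measurable_lebesgue_on_cong_AE[OF L2_D(1)[OF f] S eq] L2_D(2)[OF f]
  by (rule L2_bound) (use eq in auto)

lemma l2norm_le_bound:
  fixes f :: "real \<Rightarrow> complex"
  assumes "f \<in> L2 (lebesgue_on S)" "S \<in> lmeasurable" "0 \<le> C" "\<And>x. x \<in> S \<Longrightarrow> cmod (f x) \<le> C"
  shows "l2norm (lebesgue_on S) f \<le> C * sqrt (measure lebesgue S)"
proof (rule power2_le_imp_le)
  interpret finite_measure "lebesgue_on S" by (rule finite_measure_lebesgue_on_bounded) fact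
  have S: "S \<in> sets lebesgue" using assms(2) by (rule fmeasurableD)
  have "(l2norm (lebesgue_on S) f)\<^sup>2 \<le> (\<integral>x. C\<^sup>2 \<partial>lebesgue_on S)"
    unfolding l2norm_square'
    using assms(4) by (intro integral_mono L2_D(2)[OF assms(1)]) (auto simp: space_restrict_space intro!: power_mono)
  also have "\<dots> = (C * sqrt (measure lebesgue S))\<^sup>2"
    using S by (simp add: space_restrict_space measure_restrict_space power_mult_distrib)
  finally show "(l2norm (lebesgue_on S) f)\<^sup>2 \<le> (C * sqrt (measure lebesgue S))\<^sup>2" .
qed (use assms in auto)

lemma at_within_two_intervals:
  assumes "x \<in> {0<..<1} \<union> {\<alpha><..<\<beta>}"
  shows "at x within two_intervals \<alpha> \<beta> = at x"
proof (rule at_within_interior)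
  have "open ({0<..<1} \<union> {\<alpha><..<\<beta>})" by auto
  moreover have "{0<..<1} \<union> {\<alpha><..<\<beta>} \<subseteq> two_intervals \<alpha> \<beta>" by (auto simp: two_intervals_def)
  ultimately show "x \<in> interior (two_intervals \<alpha> \<beta>)"
    using interior_maximal assms by blast
qed

text \<open>An interval inside the union lies in one of the two components, by the gap between 1 and \<open>\<alpha>\<close>.\<close>

lemma abs_continuous_on_two_intervals:
  fixes f :: "real \<Rightarrow> complex"
  assumes "1 < \<alpha>" and f1: "abs_continuous_on {0..1} f" and f2: "abs_continuous_on {\<alpha>..\<beta>} f"
  shows "abs_continuous_on (two_intervals \<alpha> \<beta>) f"
  unfolding abs_continuous_on_def
proof (intro allI impI)
  fix \<epsilon> :: real assume "0 < \<epsilon>"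
  then have e: "0 < \<epsilon> / 2" by simp
  from abs_continuous_onD[OF f1 e, where 'i=nat]
  obtain \<delta>1 where \<delta>1: "0 < \<delta>1" and 1: "\<forall>(I::nat set) p q. finite I \<longrightarrow> (\<forall>i\<in>I. p i \<le> q i \<and> {p i..q i} \<subseteq> {0..1}) \<longrightarrow>
      disjoint_family_on (\<lambda>i. {p i<..<q i}) I \<longrightarrow> (\<Sum>i\<in>I. q i - p i) < \<delta>1 \<longrightarrow>
      (\<Sum>i\<in>I. norm (f (q i) - f (p i))) < \<epsilon> / 2"
    by blast
  from abs_continuous_onD[OF f2 e, where 'i=nat]
  obtain \<delta>2 where \<delta>2: "0 < \<delta>2" and 2: "\<forall>(I::nat set) p q. finite I \<longrightarrow> (\<forall>i\<in>I. p i \<le> q i \<and> {p i..q i} \<subseteq> {\<alpha>..\<beta>}) \<longrightarrow>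
      disjoint_family_on (\<lambda>i. {p i<..<q i}) I \<longrightarrow> (\<Sum>i\<in>I. q i - p i) < \<delta>2 \<longrightarrow>
      (\<Sum>i\<in>I. norm (f (q i) - f (p i))) < \<epsilon> / 2"
    by blast
  show "\<exists>\<delta>>0. \<forall>(n::nat) p q. (\<forall>i<n. p i \<le> q i \<and> {p i..q i} \<subseteq> two_intervals \<alpha> \<beta>) \<and>
      disjoint_family_on (\<lambda>i. {p i<..<q i}) {..<n} \<and> (\<Sum>i<n. q i - p i) < \<delta> \<longrightarrow>
      (\<Sum>i<n. norm (f (q i) - f (p i))) < \<epsilon>"
  proof (intro exI[of _ "min \<delta>1 \<delta>2"] conjI allI impI; (elim conjE)?)
    show "0 < min \<delta>1 \<delta>2" using \<delta>1 \<delta>2 by simp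
    fix n :: nat and p q
    assume pq: "\<forall>i<n. p i \<le> q i \<and> {p i..q i} \<subseteq> two_intervals \<alpha> \<beta>"
      and dis: "disjoint_family_on (\<lambda>i. {p i<..<q i}) {..<n}"
      and len: "(\<Sum>i<n. q i - p i) < min \<delta>1 \<delta>2"
    define I J where "I = {i \<in> {..<n}. q i \<le> 1}" and "J = {i \<in> {..<n}. \<not> q i \<le> 1}"
    have IJ: "{..<n} = I \<union> J" "I \<inter> J = {}" "finite I" "finite J" by (auto simp: I_def J_def)
    have split: "(\<Sum>i<n. h i) = sum h I + sum h J" for h :: "nat \<Rightarrow> real"
      unfolding IJ(1) using IJ by (intro sum.union_disjoint) auto
    have nonneg: "0 \<le> (\<Sum>i\<in>I. q i - p i)" "0 \<le> (\<Sum>i\<in>J. q i - p i)"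
      using pq by (auto intro!: sum_nonneg simp: I_def J_def)
    have subI: "p i \<le> q i \<and> {p i..q i} \<subseteq> {0..1}" if "i \<in> I" for i
      using pq that assms(1) by (fastforce simp: I_def two_intervals_def)
    have subJ: "p i \<le> q i \<and> {p i..q i} \<subseteq> {\<alpha>..\<beta>}" if "i \<in> J" for i
    proof -
      have pqi: "p i \<le> q i" "{p i..q i} \<subseteq> {0..1} \<union> {\<alpha>..\<beta>}" "1 < q i"
        using pq that by (auto simp: J_def two_intervals_def)
      have "\<not> p i < \<alpha>"
      proof
        assume "p i < \<alpha>"
        \<comment> \<open>a point of the interval that lies in the gap\<close>
        define m where "m = (max (p i) 1 + min (q i) \<alpha>) / 2"
        have "max (p i) 1 < min (q i) \<alpha> \<or> max (p i) 1 = q i"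
          using pqi(1,3) \<open>p i < \<alpha>\<close> assms(1) by auto
        then have "m \<in> {p i..q i}" "1 < m" "m < \<alpha>"
          using pqi(1,3) \<open>p i < \<alpha>\<close> assms(1) by (auto simp: m_def)
        then show False using pqi(2) by auto
      qed
      moreover have "q i \<in> {0..1} \<union> {\<alpha>..\<beta>}" using pqi(1,2) by auto
      ultimately show ?thesis using pqi(1,3) by auto
    qed
    have disI: "disjoint_family_on (\<lambda>i. {p i<..<q i}) I" and disJ: "disjoint_family_on (\<lambda>i. {p i<..<q i}) J"
      by (rule disjoint_family_on_mono[OF _ dis], auto simp: I_def J_def)+
    have "(\<Sum>i\<in>I. norm (f (q i) - f (p i))) < \<epsilon> / 2"
      using subI len nonneg unfolding split by (intro 1[rule_format, OF IJ(3) _ disI]) auto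
    moreover have "(\<Sum>i\<in>J. norm (f (q i) - f (p i))) < \<epsilon> / 2"
      using subJ len nonneg unfolding split by (intro 2[rule_format, OF IJ(4) _ disJ]) auto
    ultimately show "(\<Sum>i<n. norm (f (q i) - f (p i))) < \<epsilon>"
      unfolding split by simp
  qed
qed

text \<open>
  The domain of the maximal operator is accessed only through this rule and its converse
  \<open>momentum_max_domD\<close>. The four endpoints form a null set, so derivatives within the two intervals
  may be replaced by two-sided ones.
\<close>

lemma momentum_max_domI:
  fixes f v :: "real \<Rightarrow> complex"
  assumes "1 < \<alpha>" and f: "abs_continuous_on {0..1} f" "abs_continuous_on {\<alpha>..\<beta>} f"
    and v: "v \<in> L2 (lebesgue_on (two_intervals \<alpha> \<beta>))" and N: "negligible N"
    and der: "\<And>x. x \<in> ({0<..<1} \<union> {\<alpha><..<\<beta>}) - N \<Longrightarrow> (f has_vector_derivative v x) (at x)"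
  shows "f \<in> op_dom (momentum_max \<alpha> \<beta>)"
    and "AE x in lebesgue_on (two_intervals \<alpha> \<beta>). derivative_on (two_intervals \<alpha> \<beta>) f x = v x"
proof -
  let ?S = "two_intervals \<alpha> \<beta>"
  define N' where "N' = N \<union> {0, 1, \<alpha>, \<beta>}"
  have N': "negligible N'" using N by (simp add: N'_def)
  have int: "x \<in> ({0<..<1} \<union> {\<alpha><..<\<beta>}) - N" if "x \<in> ?S - N'" for x
    using that by (auto simp: two_intervals_def N'_def)
  have "(f has_vector_derivative v x) (at x within ?S)" if "x \<in> ?S - N'" for x
    using der[OF int[OF that]] by (rule has_vector_derivative_at_within)
  then have "\<forall>x\<in>?S - N'. f differentiable (at x within ?S)"
    by (auto simp: has_vector_derivative_def differentiable_def)
  with N' have ae: "AE x in lebesgue_on ?S. f differentiable (at x within ?S)"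
    by (subst AE_lebesgue_on_iff_negligible) auto
  have "derivative_on ?S f x = v x" if "x \<in> ?S - N'" for x
    using der[OF int[OF that]] at_within_two_intervals[of x \<alpha> \<beta>] int[OF that]
    by (auto simp: derivative_on_def vector_derivative_at)
  with N' show eq: "AE x in lebesgue_on ?S. derivative_on ?S f x = v x"
    by (subst AE_lebesgue_on_iff_negligible) auto
  have "derivative_on ?S f \<in> L2 (lebesgue_on ?S)"
    by (rule L2_lebesgue_on_cong_AE[OF v]) (use eq in auto)
  then show "f \<in> op_dom (momentum_max \<alpha> \<beta>)"
    using ae abs_continuous_on_two_intervals[OF assms(1) f] by (simp add: momentum_max_def)
qed

lemma momentum_max_domD:
  fixes f :: "real \<Rightarrow> complex"
  assumes f: "f \<in> op_dom (momentum_max \<alpha> \<beta>)"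
  shows "abs_continuous_on {0..1} f" "abs_continuous_on {\<alpha>..\<beta>} f"
    and "derivative_on (two_intervals \<alpha> \<beta>) f \<in> L2 (lebesgue_on (two_intervals \<alpha> \<beta>))"
    and "\<exists>N. negligible N \<and> (\<forall>x\<in>({0<..<1} \<union> {\<alpha><..<\<beta>}) - N.
      (f has_vector_derivative derivative_on (two_intervals \<alpha> \<beta>) f x) (at x))"
proof -
  let ?S = "two_intervals \<alpha> \<beta>"
  have ac: "abs_continuous_on ?S f" and ae: "AE x in lebesgue_on ?S. f differentiable (at x within ?S)"
    using f by (auto simp: momentum_max_def)
  show "abs_continuous_on {0..1} f" "abs_continuous_on {\<alpha>..\<beta>} f"
    using ac by (auto intro: abs_continuous_on_subset simp: two_intervals_def)
  show "derivative_on ?S f \<in> L2 (lebesgue_on ?S)"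
    using f by (simp add: momentum_max_def)
  obtain N where N: "negligible N" "\<forall>x\<in>?S - N. f differentiable (at x within ?S)"
    using ae by (subst (asm) AE_lebesgue_on_iff_negligible) auto
  have "(f has_vector_derivative derivative_on ?S f x) (at x)" if "x \<in> ({0<..<1} \<union> {\<alpha><..<\<beta>}) - N" for x
  proof -
    have "x \<in> ?S - N" using that by (auto simp: two_intervals_def)
    then have "f differentiable (at x within ?S)" using N(2) by blast
    then show ?thesis
      using at_within_two_intervals[of x \<alpha> \<beta>] that
      by (simp add: derivative_on_def vector_derivative_works)
  qed
  with N(1) show "\<exists>N. negligible N \<and> (\<forall>x\<in>({0<..<1} \<union> {\<alpha><..<\<beta>}) - N.
      (f has_vector_derivative derivative_on ?S f x) (at x))"
    by blast
qed

lemma momentum_max_dom_continuous: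
  assumes "f \<in> op_dom (momentum_max \<alpha> \<beta>)"
  shows "continuous_on (two_intervals \<alpha> \<beta>) f"
  unfolding two_intervals_def
  using momentum_max_domD(1,2)[OF assms]
  by (intro continuous_on_closed_Un abs_continuous_on_imp_continuous_on) auto

lemma momentum_max_dom_L2:
  "f \<in> op_dom (momentum_max \<alpha> \<beta>) \<Longrightarrow> f \<in> L2 (lebesgue_on (two_intervals \<alpha> \<beta>))"
  by (intro continuous_on_imp_L2 two_intervals_compact momentum_max_dom_continuous)

text \<open>
  Cramer's rule as an equivalence: one direction gives solvability, the other the uniqueness and
  the size of the solution.
\<close>

lemma two_by_two_system:
  fixes t11 t12 t21 t22 r1 r2 c1 c2 :: "'a::field"
  assumes d: "t11 * t22 - t12 * t21 \<noteq> 0"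
  shows "t11 * c1 + t12 * c2 = r1 \<and> t21 * c1 + t22 * c2 = r2 \<longleftrightarrow>
    c1 = (t22 * r1 - t12 * r2) / (t11 * t22 - t12 * t21) \<and>
    c2 = (t11 * r2 - t21 * r1) / (t11 * t22 - t12 * t21)"
    (is "?L \<longleftrightarrow> ?R")
proof
  assume L: ?L
  have "(t11 * t22 - t12 * t21) * c1 = t22 * (t11 * c1 + t12 * c2) - t12 * (t21 * c1 + t22 * c2)"
    "(t11 * t22 - t12 * t21) * c2 = t11 * (t21 * c1 + t22 * c2) - t21 * (t11 * c1 + t12 * c2)"
    by (simp_all add: algebra_simps)
  with L d show ?R by (simp add: nonzero_eq_divide_eq mult.commute)
next
  assume R: ?R
  then have "(t11 * t22 - t12 * t21) * (t11 * c1 + t12 * c2) = (t11 * t22 - t12 * t21) * r1"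
    "(t11 * t22 - t12 * t21) * (t21 * c1 + t22 * c2) = (t11 * t22 - t12 * t21) * r2"
    using d
    by (simp_all add: distrib_left mult.left_commute[of _ t11] mult.left_commute[of _ t12]
        mult.left_commute[of _ t21] mult.left_commute[of _ t22]) (simp_all add: algebra_simps)
  then show ?L using d by simp
qed

text \<open>A nonzero row \<open>(u, v)\<close> of a singular matrix provides the vector \<open>(- v, u)\<close> of the kernel.\<close>

lemma two_by_two_kernel:
  fixes t11 t12 t21 t22 :: "'a::field"
  assumes "t11 * t22 - t12 * t21 = 0"
  shows "\<exists>c1 c2. (c1 \<noteq> 0 \<or> c2 \<noteq> 0) \<and> t11 * c1 + t12 * c2 = 0 \<and> t21 * c1 + t22 * c2 = 0"
proof (cases "t11 = 0 \<and> t12 = 0")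
  case False
  then show ?thesis
    using assms by (intro exI[of _ "- t12"] exI[of _ t11]) (auto simp: algebra_simps)
next
  case True
  show ?thesis
  proof (cases "t21 = 0 \<and> t22 = 0")
    case False
    then show ?thesis
      using True by (intro exI[of _ "- t22"] exI[of _ t21]) (auto simp: algebra_simps)
  next
    case zero: True
    show ?thesis using True zero by (intro exI[of _ 1] exI[of _ 0]) auto
  qed
qed

definition two_pi_i :: complex where "two_pi_i = \<i> * 2 * of_real pi"

lemma two_pi_i_nonzero [simp]: "two_pi_i \<noteq> 0"
  by (simp add: two_pi_i_def)

lemma shifted_momentum_iff:
  "shifted (momentum \<alpha> \<beta> B) z f x = g \<longleftrightarrow>
    derivative_on (two_intervals \<alpha> \<beta>) f x = two_pi_i * z * f x + two_pi_i * g"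
proof -
  have "shifted (momentum \<alpha> \<beta> B) z f x = derivative_on (two_intervals \<alpha> \<beta>) f x / two_pi_i - z * f x"
    by (simp add: shifted_def momentum_def momentum_max_def two_pi_i_def)
  also have "\<dots> = g \<longleftrightarrow> derivative_on (two_intervals \<alpha> \<beta>) f x = two_pi_i * z * f x + two_pi_i * g"
    by (simp add: diff_eq_eq divide_eq_eq algebra_simps)
  finally show ?thesis .
qed

text \<open>
  For a square matrix, preserving norms is being unitary, the condition under which the boundary
  condition makes \<open>P\<close> symmetric.
\<close>

locale momentum_operator =
  fixes \<alpha> \<beta> :: real and B :: "complex^2^2"
  assumes \<alpha>: "1 < \<alpha>" and \<beta>: "\<alpha> < \<beta>" and isometric: "\<And>v. norm (B *v v) = norm v"
begin

abbreviation "S \<equiv> two_intervals \<alpha> \<beta>"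
abbreviation "M \<equiv> lebesgue_on S"
abbreviation "P \<equiv> momentum \<alpha> \<beta> B"

lemma restrict_L2:
  assumes "g \<in> L2 M"
  shows "g \<in> L2 (lebesgue_on {0..1})" "g \<in> L2 (lebesgue_on {\<alpha>..\<beta>})"
    "l2norm (lebesgue_on {0..1}) g \<le> l2norm M g" "l2norm (lebesgue_on {\<alpha>..\<beta>}) g \<le> l2norm M g"
  using L2_lebesgue_on_subset[OF assms, of "{0..1}"] L2_lebesgue_on_subset[OF assms, of "{\<alpha>..\<beta>}"]
  by (auto simp: two_intervals_def)

lemma boundary_condition_iff:
  "B *v vector [x1, x2] = vector [y1, y2] \<longleftrightarrow>
    B$1$1 * x1 + B$1$2 * x2 = y1 \<and> B$2$1 * x1 + B$2$2 * x2 = y2"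
  by (simp add: vec_eq_iff forall_2 matrix_vector_mult_def sum_2 vector_2)

lemma dom_iff: "f \<in> op_dom P \<longleftrightarrow> f \<in> op_dom (momentum_max \<alpha> \<beta>) \<and>
    B$1$1 * f 1 + B$1$2 * f \<beta> = f 0 \<and> B$2$1 * f 1 + B$2$2 * f \<beta> = f \<alpha>"
  by (simp add: momentum_def boundary_condition_iff)

lemma dom_L2: "f \<in> op_dom P \<Longrightarrow> f \<in> L2 M"
  by (intro momentum_max_dom_L2) (simp add: dom_iff)

lemma shifted_L2: "f \<in> op_dom P \<Longrightarrow> shifted P z f \<in> L2 M"
proof -
  assume f: "f \<in> op_dom P"
  then have "derivative_on S f \<in> L2 M" using momentum_max_domD(3) by (simp add: dom_iff)
  then have "(\<lambda>x. inverse two_pi_i * derivative_on S f x - z * f x) \<in> L2 M"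
    using dom_L2[OF f] by (intro L2_diff L2_cmult)
  also have "(\<lambda>x. inverse two_pi_i * derivative_on S f x - z * f x) = shifted P z f"
    by (simp add: shifted_def momentum_def momentum_max_def two_pi_i_def fun_eq_iff field_simps)
  finally show ?thesis .
qed

text \<open>
  The contribution of the right-hand side \<open>g\<close> to a solution of \<open>(P - z) f = g\<close>, started with the
  value 0 at the left endpoint of each interval.
\<close>

definition source :: "complex \<Rightarrow> (real \<Rightarrow> complex) \<Rightarrow> real \<Rightarrow> complex" where
  "source z g x = (if x \<le> 1 then duhamel (two_pi_i * z) 0 (\<lambda>t. two_pi_i * g t) x
    else duhamel (two_pi_i * z) \<alpha> (\<lambda>t. two_pi_i * g t) x)"

text \<open>The solution with prescribed values \<open>c1\<close> at 0 and \<open>c2\<close> at \<open>\<alpha>\<close>.\<close>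

definition solution :: "complex \<Rightarrow> (real \<Rightarrow> complex) \<Rightarrow> complex \<Rightarrow> complex \<Rightarrow> real \<Rightarrow> complex" where
  "solution z g c1 c2 x =
    (if x \<le> 1 then exp (two_pi_i * z * of_real x) * c1 else exp (two_pi_i * z * of_real (x - \<alpha>)) * c2)
      + source z g x"

lemma solution_unique:
  assumes f: "f \<in> op_dom (momentum_max \<alpha> \<beta>)" and eq: "AE x in M. shifted P z f x = g x" and x: "x \<in> S"
  shows "f x = solution z g (f 0) (f \<alpha>) x"
proof -
  obtain N1 where N1: "negligible N1" "\<forall>x\<in>({0<..<1} \<union> {\<alpha><..<\<beta>}) - N1.
      (f has_vector_derivative derivative_on S f x) (at x)"
    using momentum_max_domD(4)[OF f] by blast
  obtain N2 where N2: "negligible N2" "\<forall>x\<in>S - N2. shifted P z f x = g x"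
    using eq by (subst (asm) AE_lebesgue_on_iff_negligible) auto
  have der: "(f has_vector_derivative two_pi_i * z * f x + two_pi_i * g x) (at x)"
    if "x \<in> ({0<..<1} \<union> {\<alpha><..<\<beta>}) - (N1 \<union> N2)" for x
  proof -
    have "x \<in> S - N2" using that by (auto simp: two_intervals_def)
    then have "derivative_on S f x = two_pi_i * z * f x + two_pi_i * g x"
      using N2(2) shifted_momentum_iff by blast
    then show ?thesis using N1(2) that by force
  qed
  have N: "negligible (N1 \<union> N2)" using N1 N2 by simp
  show ?thesis
  proof (cases "x \<le> 1")
    case True
    then have "x \<in> {0..1}" using x \<alpha> by (auto simp: two_intervals_def)
    then show ?thesis
      using linear_equation_unique_solution[OF momentum_max_domD(1)[OF f] N,
          of "two_pi_i * z" "\<lambda>t. two_pi_i * g t" x] der True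
      by (auto simp: solution_def source_def)
  next
    case False
    then have "x \<in> {\<alpha>..\<beta>}" using x by (auto simp: two_intervals_def)
    then show ?thesis
      using linear_equation_unique_solution[OF momentum_max_domD(2)[OF f] N,
          of "two_pi_i * z" "\<lambda>t. two_pi_i * g t" x] der False
      by (auto simp: solution_def source_def)
  qed
qed

lemma source_left [simp]: "source z g 0 = 0" "source z g \<alpha> = 0"
  using \<alpha> by (auto simp: source_def duhamel_def)

lemma solution_values:
  "solution z g c1 c2 0 = c1" "solution z g c1 c2 \<alpha> = c2"
  "solution z g c1 c2 1 = exp (two_pi_i * z) * c1 + source z g 1"
  "solution z g c1 c2 \<beta> = exp (two_pi_i * z * of_real (\<beta> - \<alpha>)) * c2 + source z g \<beta>"
  using \<alpha> \<beta> by (auto simp: solution_def)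

lemma solution_solves:
  assumes g: "g \<in> L2 M"
  shows "solution z g c1 c2 \<in> op_dom (momentum_max \<alpha> \<beta>)"
    "AE x in M. shifted P z (solution z g c1 c2) x = g x"
proof -
  let ?c = "two_pi_i * z" and ?q = "\<lambda>t. two_pi_i * g t"
  let ?u = "solution z g c1 c2"
  let ?u1 = "\<lambda>x. exp (?c * of_real x) * c1 + duhamel ?c 0 ?q x"
  let ?u2 = "\<lambda>x. exp (?c * of_real x) * (exp (- ?c * of_real \<alpha>) * c2) + duhamel ?c \<alpha> ?q x"
  have q: "?q \<in> L2 (lebesgue_on {0..1})" "?q \<in> L2 (lebesgue_on {\<alpha>..\<beta>})"
    using restrict_L2[OF g] by auto
  have u1: "?u x = ?u1 x" if "x \<le> 1" for x using that by (simp add: solution_def source_def)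
  have u2: "?u x = ?u2 x" if "1 < x" for x
  proof -
    have "exp (?c * of_real (x - \<alpha>)) = exp (?c * of_real x) * exp (- ?c * of_real \<alpha>)"
      by (simp flip: exp_add add: algebra_simps)
    then show ?thesis using that by (simp add: solution_def source_def)
  qed
  obtain N1 where N1: "negligible N1" "abs_continuous_on {0..1} ?u1"
    "\<And>x. x \<in> {0<..<1} - N1 \<Longrightarrow> (?u1 has_vector_derivative ?c * ?u1 x + ?q x) (at x)"
    using duhamel_solves[OF q(1), of ?c c1] by blast
  obtain N2 where N2: "negligible N2" "abs_continuous_on {\<alpha>..\<beta>} ?u2"
    "\<And>x. x \<in> {\<alpha><..<\<beta>} - N2 \<Longrightarrow> (?u2 has_vector_derivative ?c * ?u2 x + ?q x) (at x)"
    using duhamel_solves[OF q(2), of ?c "exp (- ?c * of_real \<alpha>) * c2"] by blast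
  have ac: "abs_continuous_on {0..1} ?u" "abs_continuous_on {\<alpha>..\<beta>} ?u"
    using u1 u2 \<alpha> by (auto intro: abs_continuous_on_transform[OF N1(2)] abs_continuous_on_transform[OF N2(2)])
  have "continuous_on S ?u"
    unfolding two_intervals_def using ac by (intro continuous_on_closed_Un abs_continuous_on_imp_continuous_on) auto
  then have "?u \<in> L2 M" by (intro continuous_on_imp_L2 two_intervals_compact)
  then have v: "(\<lambda>x. ?c * ?u x + ?q x) \<in> L2 M" using g by (intro L2_add L2_cmult)
  have N: "negligible (N1 \<union> N2)" using N1 N2 by simp
  have der: "(?u has_vector_derivative ?c * ?u x + ?q x) (at x)"
    if x: "x \<in> ({0<..<1} \<union> {\<alpha><..<\<beta>}) - (N1 \<union> N2)" for x
  proof (cases "x < 1")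
    case True
    then have "(?u1 has_vector_derivative ?c * ?u1 x + ?q x) (at x)" using x \<alpha> by (intro N1(3)) auto
    then have "(?u has_vector_derivative ?c * ?u1 x + ?q x) (at x)"
      by (rule has_vector_derivative_transform_within_open[of _ _ _ "{..<1}"]) (use True u1 in auto)
    then show ?thesis using u1[of x] True by simp
  next
    case False
    then have x2: "x \<in> {\<alpha><..<\<beta>} - N2" using x by auto
    then have "(?u has_vector_derivative ?c * ?u2 x + ?q x) (at x)"
      by (intro has_vector_derivative_transform_within_open[OF N2(3), of x "{1<..}"]) (use u2 \<alpha> in auto)
    then show ?thesis using u2[of x] x2 \<alpha> by simp
  qed
  show "?u \<in> op_dom (momentum_max \<alpha> \<beta>)"
    by (rule momentum_max_domI(1)[OF \<alpha> ac v N der])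
  have "AE x in M. derivative_on S ?u x = ?c * ?u x + ?q x"
    by (rule momentum_max_domI(2)[OF \<alpha> ac v N der])
  then show "AE x in M. shifted P z ?u x = g x"
    by (simp add: shifted_momentum_iff)
qed

text \<open>
  On solutions the boundary condition becomes a linear system for the two initial values;
  \<open>chi z\<close> is its determinant.
\<close>

definition chi :: "complex \<Rightarrow> complex" where
  "chi z = (B$1$1 * exp (two_pi_i * z) - 1) * (B$2$2 * exp (two_pi_i * z * of_real (\<beta> - \<alpha>)) - 1)
    - (B$1$2 * exp (two_pi_i * z * of_real (\<beta> - \<alpha>))) * (B$2$1 * exp (two_pi_i * z))"

lemma solution_in_dom_iff:
  assumes g: "g \<in> L2 M"
  shows "solution z g c1 c2 \<in> op_dom P \<longleftrightarrow>
    (B$1$1 * exp (two_pi_i * z) - 1) * c1 + (B$1$2 * exp (two_pi_i * z * of_real (\<beta> - \<alpha>))) * c2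
      = - (B$1$1 * source z g 1 + B$1$2 * source z g \<beta>) \<and>
    (B$2$1 * exp (two_pi_i * z)) * c1 + (B$2$2 * exp (two_pi_i * z * of_real (\<beta> - \<alpha>)) - 1) * c2
      = - (B$2$1 * source z g 1 + B$2$2 * source z g \<beta>)"
  unfolding dom_iff using solution_solves(1)[OF g]
  by (simp add: solution_values eq_neg_iff_add_eq_0 algebra_simps del: of_real_diff)

lemma dom_solution:
  assumes f: "f \<in> op_dom P" and g: "g \<in> L2 M" and eq: "AE x in M. shifted P z f x = g x"
  shows "solution z g (f 0) (f \<alpha>) \<in> op_dom P"
proof -
  have "f \<in> op_dom (momentum_max \<alpha> \<beta>)" using f by (simp add: dom_iff)
  note u = solution_unique[OF this eq]
  have "0 \<in> S" "1 \<in> S" "\<alpha> \<in> S" "\<beta> \<in> S" using \<alpha> \<beta> by (auto simp: two_intervals_def)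
  then show ?thesis
    using f solution_solves(1)[OF g] u[of 0] u[of 1] u[of \<alpha>] u[of \<beta>] by (simp add: dom_iff)
qed

lemma source_bound:
  obtains C where "0 < C" "\<And>g x. g \<in> L2 M \<Longrightarrow> x \<in> S \<Longrightarrow> cmod (source z g x) \<le> C * l2norm M g"
proof -
  let ?c = "two_pi_i * z" and ?q = "\<lambda>g t. two_pi_i * g t"
  obtain C1 where C1: "0 < C1" "\<And>q x. q \<in> L2 (lebesgue_on {0..1}) \<Longrightarrow> x \<in> {0..1} \<Longrightarrow>
      cmod (duhamel ?c 0 q x) \<le> C1 * l2norm (lebesgue_on {0..1}) q"
    using duhamel_bound by blast
  obtain C2 where C2: "0 < C2" "\<And>q x. q \<in> L2 (lebesgue_on {\<alpha>..\<beta>}) \<Longrightarrow> x \<in> {\<alpha>..\<beta>} \<Longrightarrow>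
      cmod (duhamel ?c \<alpha> q x) \<le> C2 * l2norm (lebesgue_on {\<alpha>..\<beta>}) q"
    using duhamel_bound by blast
  let ?C = "(C1 + C2) * cmod two_pi_i"
  show thesis
  proof (rule that[of ?C])
    show "0 < ?C" using C1 C2 by simp
    fix g x assume g: "g \<in> L2 M" and x: "x \<in> S"
    note r = restrict_L2[OF g]
    show "cmod (source z g x) \<le> ?C * l2norm M g"
    proof (cases "x \<le> 1")
      case True
      then have "x \<in> {0..1}" using x \<alpha> by (auto simp: two_intervals_def)
      then have "cmod (source z g x) \<le> C1 * (cmod two_pi_i * l2norm (lebesgue_on {0..1}) g)"
        using C1(2)[of "?q g" x] r True by (simp add: source_def l2norm_cmult)
      also have "\<dots> \<le> (C1 + C2) * (cmod two_pi_i * l2norm M g)"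
        using r C1 C2 by (intro mult_mono mult_left_mono) auto
      finally show ?thesis by (simp add: mult.assoc)
    next
      case False
      then have "x \<in> {\<alpha>..\<beta>}" using x by (auto simp: two_intervals_def)
      then have "cmod (source z g x) \<le> C2 * (cmod two_pi_i * l2norm (lebesgue_on {\<alpha>..\<beta>}) g)"
        using C2(2)[of "?q g" x] r False by (simp add: source_def l2norm_cmult)
      also have "\<dots> \<le> (C1 + C2) * (cmod two_pi_i * l2norm M g)"
        using r C1 C2 by (intro mult_mono mult_left_mono) auto
      finally show ?thesis by (simp add: mult.assoc)
    qed
  qed
qed

lemma chi_nonzero_solvable:
  assumes "chi z \<noteq> 0" "g \<in> L2 M"
  shows "\<exists>f\<in>op_dom P. AE x in M. shifted P z f x = g x"
proof -
  from assms(1) have "\<exists>c1 c2. solution z g c1 c2 \<in> op_dom P"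
    unfolding solution_in_dom_iff[OF assms(2)] chi_def
    by (subst two_by_two_system) auto
  then show ?thesis using solution_solves(2)[OF assms(2)] by blast
qed

text \<open>By Cramer's rule the initial values are bounded by the source terms at the right endpoints.\<close>

lemma chi_nonzero_bound:
  assumes chi: "chi z \<noteq> 0"
  obtains C where "0 < C" "\<And>f g x. f \<in> op_dom P \<Longrightarrow> g \<in> L2 M \<Longrightarrow> (AE x in M. shifted P z f x = g x) \<Longrightarrow>
    x \<in> S \<Longrightarrow> cmod (f x) \<le> C * l2norm M g"
proof -
  let ?E1 = "exp (two_pi_i * z)" and ?E2 = "exp (two_pi_i * z * of_real (\<beta> - \<alpha>))"
  obtain K where K: "0 < K" "\<And>g x. g \<in> L2 M \<Longrightarrow> x \<in> S \<Longrightarrow> cmod (source z g x) \<le> K * l2norm M g"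
    using source_bound by blast
  \<comment> \<open>\<open>b\<close> and \<open>t\<close> bound the coefficients in the right-hand sides and in Cramer's rule, so that \<open>D \<parallel>g\<parallel>\<close>
    bounds the initial values\<close>
  define b where "b = cmod (B$1$1) + cmod (B$1$2) + cmod (B$2$1) + cmod (B$2$2)"
  define t where "t = cmod (B$1$1 * ?E1 - 1) + cmod (B$1$2 * ?E2) + cmod (B$2$1 * ?E1) + cmod (B$2$2 * ?E2 - 1)"
  obtain A1 where A1: "0 < A1" "\<And>x. x \<in> {0..1} \<Longrightarrow> cmod (exp (two_pi_i * z * of_real x)) \<le> A1"
    by (rule L2_exp_mult[of 0 1 "two_pi_i * z"], rule that)
  obtain A2 where A2: "0 < A2" "\<And>x. x \<in> {0..\<beta> - \<alpha>} \<Longrightarrow> cmod (exp (two_pi_i * z * of_real x)) \<le> A2"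
    by (rule L2_exp_mult[of 0 "\<beta> - \<alpha>" "two_pi_i * z"], rule that)
  define D where "D = t * (b * K) / cmod (chi z)"
  have bt: "0 \<le> b" "0 \<le> t" by (simp_all add: b_def t_def)
  have D: "0 \<le> D" using bt K by (simp add: D_def)
  show thesis
  proof (rule that[of "(A1 + A2) * D + K"])
    show "0 < (A1 + A2) * D + K" using A1 A2 D K by (intro add_nonneg_pos) auto
    fix f g x assume f: "f \<in> op_dom P" and g: "g \<in> L2 M" and eq: "AE x in M. shifted P z f x = g x" and x: "x \<in> S"
    define r1 where "r1 = - (B$1$1 * source z g 1 + B$1$2 * source z g \<beta>)"
    define r2 where "r2 = - (B$2$1 * source z g 1 + B$2$2 * source z g \<beta>)"
    have S: "1 \<in> S" "\<beta> \<in> S" using \<alpha> \<beta> by (auto simp: two_intervals_def)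
    have r: "cmod (u * source z g 1 + v * source z g \<beta>) \<le> b * K * l2norm M g"
      if "cmod u + cmod v \<le> b" for u v
    proof -
      have "cmod (u * source z g 1 + v * source z g \<beta>) \<le> cmod u * (K * l2norm M g) + cmod v * (K * l2norm M g)"
        using K(2)[OF g S(1)] K(2)[OF g S(2)]
        by (intro norm_triangle_mono) (simp_all add: norm_mult mult_left_mono)
      also have "\<dots> = (cmod u + cmod v) * (K * l2norm M g)" by (simp add: algebra_simps)
      also have "\<dots> \<le> b * (K * l2norm M g)" using that K(1) by (intro mult_right_mono) auto
      finally show ?thesis by (simp add: mult.assoc)
    qed
    have r1: "cmod r1 \<le> b * K * l2norm M g" and r2: "cmod r2 \<le> b * K * l2norm M g"
      unfolding r1_def r2_def norm_minus_cancel by (rule r; simp add: b_def)+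
    have bd: "cmod ((u * s1 - v * s2) / chi z) \<le> D * l2norm M g"
      if "cmod u + cmod v \<le> t" "cmod s1 \<le> b * K * l2norm M g" "cmod s2 \<le> b * K * l2norm M g" for u v s1 s2
    proof -
      have "cmod (u * s1 - v * s2) \<le> cmod u * (b * K * l2norm M g) + cmod v * (b * K * l2norm M g)"
        using that by (intro order_trans[OF norm_triangle_ineq4] add_mono) (simp_all add: norm_mult mult_left_mono)
      also have "\<dots> = (cmod u + cmod v) * (b * K * l2norm M g)" by (simp add: algebra_simps)
      also have "\<dots> \<le> t * (b * K * l2norm M g)" using that K(1) bt by (intro mult_right_mono) auto
      finally have "cmod ((u * s1 - v * s2) / chi z) \<le> t * (b * K * l2norm M g) / cmod (chi z)"
        by (simp add: norm_divide divide_right_mono)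
      then show ?thesis by (simp add: D_def mult.assoc)
    qed
    have "f 0 = ((B$2$2 * ?E2 - 1) * r1 - (B$1$2 * ?E2) * r2) / chi z \<and>
        f \<alpha> = ((B$1$1 * ?E1 - 1) * r2 - (B$2$1 * ?E1) * r1) / chi z"
      using dom_solution[OF f g eq] chi unfolding solution_in_dom_iff[OF g] chi_def r1_def r2_def
      by (subst (asm) two_by_two_system) auto
    then have c: "cmod (f 0) \<le> D * l2norm M g" "cmod (f \<alpha>) \<le> D * l2norm M g"
      using bd[OF _ r1 r2, of "B$2$2 * ?E2 - 1" "B$1$2 * ?E2"] bd[OF _ r2 r1, of "B$1$1 * ?E1 - 1" "B$2$1 * ?E1"]
      by (auto simp: t_def)
    have e: "cmod (if x \<le> 1 then exp (two_pi_i * z * of_real x) * f 0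
        else exp (two_pi_i * z * of_real (x - \<alpha>)) * f \<alpha>) \<le> (A1 + A2) * (D * l2norm M g)"
    proof (cases "x \<le> 1")
      case True
      then have "x \<in> {0..1}" using x \<alpha> by (auto simp: two_intervals_def)
      then have "cmod (exp (two_pi_i * z * of_real x)) * cmod (f 0) \<le> (A1 + A2) * (D * l2norm M g)"
        using A1 A2 c by (intro mult_mono) (auto intro: add_increasing2)
      then show ?thesis using True by (simp add: norm_mult)
    next
      case False
      then have "x - \<alpha> \<in> {0..\<beta> - \<alpha>}" using x by (auto simp: two_intervals_def)
      then have "cmod (exp (two_pi_i * z * of_real (x - \<alpha>))) * cmod (f \<alpha>) \<le> (A1 + A2) * (D * l2norm M g)"
        using A1 A2(1) A2(2)[of "x - \<alpha>"] c by (intro mult_mono) (auto intro: add_increasing simp del: of_real_diff)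
      then show ?thesis using False by (simp add: norm_mult del: of_real_diff)
    qed
    have "f x = solution z g (f 0) (f \<alpha>) x"
      using f by (intro solution_unique[OF _ eq x]) (simp add: dom_iff)
    then have "cmod (f x) \<le> (A1 + A2) * (D * l2norm M g) + K * l2norm M g"
      unfolding solution_def using e K(2)[OF g x] by (metis norm_triangle_mono)
    then show "cmod (f x) \<le> ((A1 + A2) * D + K) * l2norm M g"
      by (simp add: algebra_simps)
  qed
qed

lemma chi_nonzero_resolvent:
  assumes "chi z \<noteq> 0"
  shows "z \<in> resolvent_set M P"
proof -
  obtain C where C: "0 < C" "\<And>f g x. f \<in> op_dom P \<Longrightarrow> g \<in> L2 M \<Longrightarrow> (AE x in M. shifted P z f x = g x) \<Longrightarrow>
    x \<in> S \<Longrightarrow> cmod (f x) \<le> C * l2norm M g"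
    using chi_nonzero_bound[OF assms] by blast
  have "AE x in M. f x = 0" if "f \<in> op_dom P" "AE x in M. shifted P z f x = 0" for f
  proof -
    have "f x = 0" if "x \<in> S" for x
      using C(2)[OF \<open>f \<in> op_dom P\<close> L2_zero] \<open>AE x in M. shifted P z f x = 0\<close> that l2norm_eq_0_iff[OF L2_zero, of M]
      by auto
    then show ?thesis by (intro AE_I2) (simp add: space_restrict_space)
  qed
  moreover have "l2norm M f \<le> (C * sqrt (measure lebesgue S)) * l2norm M (shifted P z f)" if f: "f \<in> op_dom P" for f
  proof -
    have "l2norm M f \<le> C * l2norm M (shifted P z f) * sqrt (measure lebesgue S)"
      using C(1) by (intro l2norm_le_bound dom_L2 f C(2)[OF f shifted_L2[OF f]]) auto
    then show ?thesis by (simp add: mult.commute mult.left_commute)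
  qed
  ultimately show ?thesis
    unfolding resolvent_set_def using chi_nonzero_solvable[OF assms] by blast
qed

lemma eigenvector_imp_chi_zero:
  assumes "eigenvector M P z f"
  shows "chi z = 0"
proof (rule ccontr)
  assume "chi z \<noteq> 0"
  then have "z \<in> resolvent_set M P" by (rule chi_nonzero_resolvent)
  moreover have "AE x in M. shifted P z f x = 0"
    using assms by (auto simp: eigenvector_def shifted_def)
  ultimately show False
    using assms by (auto simp: resolvent_set_def eigenvector_def)
qed

lemma source_zero [simp]: "source z (\<lambda>_. 0) x = 0"
  by (simp add: source_def duhamel_def)

lemma chi_zero_eigenvector:
  assumes "chi z = 0"
  shows "\<exists>c1 c2. (c1 \<noteq> 0 \<or> c2 \<noteq> 0) \<and> solution z (\<lambda>_. 0) c1 c2 \<in> op_dom P"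
  unfolding solution_in_dom_iff[OF L2_zero]
  using two_by_two_kernel[OF assms[unfolded chi_def]]
  by simp

lemma chi_zero_point_spectrum:
  assumes "chi z = 0"
  shows "z \<in> point_spectrum M P"
proof -
  obtain c1 c2 where c: "c1 \<noteq> 0 \<or> c2 \<noteq> 0" and f: "solution z (\<lambda>_. 0) c1 c2 \<in> op_dom P"
    using chi_zero_eigenvector[OF assms] by blast
  let ?f = "solution z (\<lambda>_. 0) c1 c2"
  have "\<not> (AE x in M. ?f x = 0)"
  proof
    assume "AE x in M. ?f x = 0"
    then obtain N where N: "negligible N" "\<forall>x\<in>S - N. ?f x = 0"
      by (subst (asm) AE_lebesgue_on_iff_negligible) auto
    have "\<not> {0<..<1::real} \<subseteq> N" "\<not> {\<alpha><..<\<beta>} \<subseteq> N"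
      using negligible_subset[OF N(1)] \<beta> open_not_negligible[of "{0<..<1::real}"] open_not_negligible[of "{\<alpha><..<\<beta>}"]
      by (auto simp: greaterThanLessThan_empty_iff)
    then obtain x y where "x \<in> {0<..<1} - N" "y \<in> {\<alpha><..<\<beta>} - N" by blast
    then have "?f x = 0" "?f y = 0" "x \<le> 1" "\<not> y \<le> 1"
      using N(2) \<alpha> by (auto simp: two_intervals_def)
    then show False using c by (simp add: solution_def)
  qed
  moreover have "AE x in M. op_app P ?f x = z * ?f x"
    using solution_solves(2)[OF L2_zero] by (simp add: shifted_def)
  ultimately show ?thesis
    unfolding point_spectrum_def eigenvector_def using f by blast
qed

lemma spectrum_eq_chi_zeros: "spectrum M P = {z. chi z = 0}" "point_spectrum M P = {z. chi z = 0}"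
proof -
  show "point_spectrum M P = {z. chi z = 0}"
    using chi_zero_point_spectrum eigenvector_imp_chi_zero by (auto simp: point_spectrum_def)
  have "z \<notin> resolvent_set M P" if chi: "chi z = 0" for z
  proof -
    obtain f where "eigenvector M P z f"
      using chi_zero_point_spectrum[OF chi] by (auto simp: point_spectrum_def)
    then show ?thesis
      by (auto simp: resolvent_set_def eigenvector_def shifted_def)
  qed
  then show "spectrum M P = {z. chi z = 0}"
    using chi_nonzero_resolvent by (auto simp: spectrum_def)
qed

lemma norm_vector_2: "(norm (vector [x, y] :: complex^2))\<^sup>2 = (cmod x)\<^sup>2 + (cmod y)\<^sup>2"
  by (simp add: norm_vec_def L2_set_def sum_2 vector_2)

text \<open>
  For an eigenfunction the two exponentials at the right endpoints both shrink or both grow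
  unless the eigenvalue is real, while the boundary condition preserves the norm.
\<close>

lemma chi_zero_real:
  assumes "chi z = 0"
  shows "Im z = 0"
proof (rule ccontr)
  assume Im: "Im z \<noteq> 0"
  obtain c1 c2 where c: "c1 \<noteq> 0 \<or> c2 \<noteq> 0" and f: "solution z (\<lambda>_. 0) c1 c2 \<in> op_dom P"
    using chi_zero_eigenvector[OF assms] by blast
  let ?E1 = "exp (two_pi_i * z)" and ?E2 = "exp (two_pi_i * z * of_real (\<beta> - \<alpha>))"
  have "B *v vector [?E1 * c1, ?E2 * c2] = vector [c1, c2]"
    using f unfolding dom_iff boundary_condition_iff solution_values
    by simp
  then have "(norm (vector [?E1 * c1, ?E2 * c2] :: complex^2))\<^sup>2 = (norm (vector [c1, c2] :: complex^2))\<^sup>2"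
    using isometric by metis
  then have eq: "(cmod ?E1)\<^sup>2 * (cmod c1)\<^sup>2 + (cmod ?E2)\<^sup>2 * (cmod c2)\<^sup>2 = (cmod c1)\<^sup>2 + (cmod c2)\<^sup>2"
    by (simp only: norm_vector_2 norm_mult power_mult_distrib)
  have E: "cmod ?E1 = exp (- 2 * pi * Im z)" "cmod ?E2 = exp (- 2 * pi * Im z * (\<beta> - \<alpha>))"
    by (simp_all add: norm_exp_eq_Re two_pi_i_def algebra_simps)
  define s where "s = (if 0 < Im z then 1 else - 1 :: real)"
  have "s * ((cmod ?E1)\<^sup>2 - 1) < 0" "s * ((cmod ?E2)\<^sup>2 - 1) < 0"
  proof -
    have "s * (x\<^sup>2 - 1) < 0" if "x = exp (- (r * Im z))" "0 < r" for x r
    proof (cases "0 < Im z")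
      case True
      then have "x < 1" "0 < x" using that by (auto simp: mult_pos_pos)
      then have "x\<^sup>2 < 1" by (simp add: power_less_one_iff abs_square_less_1)
      then show ?thesis using True by (simp add: s_def)
    next
      case False
      then have "1 < x" using that Im by (auto simp: mult_pos_neg)
      then have "1 < x\<^sup>2" by (simp add: one_less_power)
      then show ?thesis using False by (simp add: s_def)
    qed
    from this[of "cmod ?E1" "2 * pi"] this[of "cmod ?E2" "2 * pi * (\<beta> - \<alpha>)"]
    show "s * ((cmod ?E1)\<^sup>2 - 1) < 0" "s * ((cmod ?E2)\<^sup>2 - 1) < 0"
      unfolding E using \<beta> by (auto simp: algebra_simps)
  qed
  moreover have "u * x + v * y < 0" if "u < 0" "v < 0" "0 \<le> x" "0 \<le> y" "0 < x \<or> 0 < y" for u v x y :: real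
    using mult_nonpos_nonneg[of u x] mult_nonpos_nonneg[of v y] mult_neg_pos[of u x] mult_neg_pos[of v y] that
    by linarith
  ultimately have "s * ((cmod ?E1)\<^sup>2 - 1) * (cmod c1)\<^sup>2 + s * ((cmod ?E2)\<^sup>2 - 1) * (cmod c2)\<^sup>2 < 0"
    using c by (simp only: zero_less_power2 norm_eq_zero zero_le_power2)
  moreover have "s * ((cmod ?E1)\<^sup>2 - 1) * (cmod c1)\<^sup>2 + s * ((cmod ?E2)\<^sup>2 - 1) * (cmod c2)\<^sup>2 =
      s * (((cmod ?E1)\<^sup>2 * (cmod c1)\<^sup>2 + (cmod ?E2)\<^sup>2 * (cmod c2)\<^sup>2) - ((cmod c1)\<^sup>2 + (cmod c2)\<^sup>2))"
    by (simp add: algebra_simps)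
  ultimately show False using eq by simp
qed

end

section \<open>The resolvent is compact and symmetric\<close>

lemma inner_vector_2: "(vector [x1, x2] :: complex^2) \<bullet> vector [y1, y2] = x1 \<bullet> y1 + x2 \<bullet> y2"
  by (simp add: inner_vec_def sum_2 vector_2)

context momentum_operator
begin

lemma isometric_inner: "(B *v x) \<bullet> (B *v y) = x \<bullet> y"
proof -
  have "norm (B *v x + B *v y) = norm (x + y)"
    using isometric[of "x + y"] by (simp add: matrix_vector_right_distrib)
  then show ?thesis by (simp add: dot_norm isometric)
qed

text \<open>
  The determinant is entire and has no zeros off the real axis, so it cannot vanish on the whole
  real axis.
\<close>

lemma exists_real_chi_nonzero: "\<exists>\<mu>::real. chi (of_real \<mu>) \<noteq> 0"
proof (rule ccontr)
  assume "\<not> ?thesis"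
  then have zero: "chi w = 0" if "w \<in> range complex_of_real" for w using that by auto
  have hol: "chi holomorphic_on UNIV"
    unfolding chi_def[abs_def] by (intro holomorphic_intros)
  have lim: "0 islimpt range complex_of_real"
    unfolding islimpt_approachable
  proof (intro allI impI)
    fix e :: real assume "0 < e"
    then show "\<exists>x'\<in>range complex_of_real. x' \<noteq> 0 \<and> dist x' 0 < e"
      by (intro bexI[of _ "complex_of_real (e / 2)"] rangeI) auto
  qed
  have "chi \<i> = 0"
    by (rule analytic_continuation[OF hol open_UNIV connected_UNIV subset_UNIV UNIV_I lim zero UNIV_I])
  then show False using chi_zero_real[of \<i>] by simp
qed

lemma dom_derivative:
  assumes "f \<in> op_dom P"
  obtains N where "negligible N"
    "\<And>x. x \<in> ({0<..<1} \<union> {\<alpha><..<\<beta>}) - N \<Longrightarrow> (f has_vector_derivative derivative_on S f x) (at x)"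
proof -
  have "f \<in> op_dom (momentum_max \<alpha> \<beta>)" using assms by (simp add: dom_iff)
  from momentum_max_domD(4)[OF this] show thesis using that by blast
qed

lemma dom_abs_continuous:
  assumes "f \<in> op_dom P"
  shows "abs_continuous_on {0..1} f" "abs_continuous_on {\<alpha>..\<beta>} f" "derivative_on S f \<in> L2 M"
  using assms momentum_max_domD(1-3) by (auto simp: dom_iff)

lemma dom_combine:
  assumes f: "f \<in> op_dom P" and g: "g \<in> op_dom P"
  shows "(\<lambda>x. f x + c * g x) \<in> op_dom P"
    "AE x in M. shifted P z (\<lambda>x. f x + c * g x) x = shifted P z f x + c * shifted P z g x"
proof -
  let ?h = "\<lambda>x. f x + c * g x"
  let ?v = "\<lambda>x. derivative_on S f x + c * derivative_on S g x"
  obtain N1 where N1: "negligible N1"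
    "\<And>x. x \<in> ({0<..<1} \<union> {\<alpha><..<\<beta>}) - N1 \<Longrightarrow> (f has_vector_derivative derivative_on S f x) (at x)"
    by (rule dom_derivative[OF f], rule that)
  obtain N2 where N2: "negligible N2"
    "\<And>x. x \<in> ({0<..<1} \<union> {\<alpha><..<\<beta>}) - N2 \<Longrightarrow> (g has_vector_derivative derivative_on S g x) (at x)"
    by (rule dom_derivative[OF g], rule that)
  have ac: "abs_continuous_on {0..1} ?h" "abs_continuous_on {\<alpha>..\<beta>} ?h"
    using dom_abs_continuous[OF f] dom_abs_continuous[OF g]
    by (auto intro!: abs_continuous_on_add bounded_bilinear.abs_continuous_on_prod_interval[OF bounded_bilinear_mult]
        abs_continuous_on_lipschitz[of _ "\<lambda>_. c" 0])
  have v: "?v \<in> L2 M" using dom_abs_continuous(3)[OF f] dom_abs_continuous(3)[OF g] by auto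
  have N: "negligible (N1 \<union> N2)" using N1 N2 by simp
  have der: "(?h has_vector_derivative ?v x) (at x)" if "x \<in> ({0<..<1} \<union> {\<alpha><..<\<beta>}) - (N1 \<union> N2)" for x
    using that by (intro has_vector_derivative_add has_vector_derivative_mult_right N1(2) N2(2)) auto
  have "?h \<in> op_dom (momentum_max \<alpha> \<beta>)" by (rule momentum_max_domI(1)[OF \<alpha> ac v N der])
  moreover have "u * (f 1 + c * g 1) + v * (f \<beta> + c * g \<beta>) = (u * f 1 + v * f \<beta>) + c * (u * g 1 + v * g \<beta>)" for u v
    by (simp add: algebra_simps)
  ultimately show "?h \<in> op_dom P"
    using f g by (simp add: dom_iff)
  have "AE x in M. derivative_on S ?h x = ?v x" by (rule momentum_max_domI(2)[OF \<alpha> ac v N der])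
  then show "AE x in M. shifted P z ?h x = shifted P z f x + c * shifted P z g x"
    by eventually_elim (simp add: shifted_def momentum_def momentum_max_def algebra_simps add_divide_distrib)
qed

lemma dom_zero: "(\<lambda>_. 0) \<in> op_dom P" "AE x in M. shifted P z (\<lambda>_. 0) x = 0"
proof -
  have "abs_continuous_on A (\<lambda>_. 0::complex)" for A
    by (rule abs_continuous_on_lipschitz[where C=0]) simp
  note domI = momentum_max_domI[OF \<alpha> this this L2_zero negligible_empty, of \<beta>]
  have "(\<lambda>_. 0) \<in> op_dom (momentum_max \<alpha> \<beta>)" by (rule domI(1)) simp
  then show "(\<lambda>_. 0) \<in> op_dom P" by (simp add: dom_iff)
  have "AE x in M. derivative_on S (\<lambda>_. 0) x = 0" by (rule domI(2)) simp
  then show "AE x in M. shifted P z (\<lambda>_. 0) x = 0"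
    by (simp add: shifted_momentum_iff)
qed

text \<open>Integration by parts on the two intervals.\<close>

lemma green_identity:
  assumes ac: "abs_continuous_on {0..1} f" "abs_continuous_on {\<alpha>..\<beta>} f"
      "abs_continuous_on {0..1} g" "abs_continuous_on {\<alpha>..\<beta>} g"
    and L2: "f \<in> L2 M" "g \<in> L2 M" "f' \<in> L2 M" "g' \<in> L2 M" and N: "negligible N"
    and df: "\<And>x. x \<in> ({0<..<1} \<union> {\<alpha><..<\<beta>}) - N \<Longrightarrow> (f has_vector_derivative f' x) (at x)"
    and dg: "\<And>x. x \<in> ({0<..<1} \<union> {\<alpha><..<\<beta>}) - N \<Longrightarrow> (g has_vector_derivative g' x) (at x)"
  shows "l2inner M f g' + l2inner M f' g = (f 1 \<bullet> g 1 + f \<beta> \<bullet> g \<beta>) - (f 0 \<bullet> g 0 + f \<alpha> \<bullet> g \<alpha>)"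
proof -
  let ?F = "\<lambda>x. f x \<bullet> g x" and ?F' = "\<lambda>x. f x \<bullet> g' x + f' x \<bullet> g x"
  have int: "(?F' has_integral ?F b - ?F a) {a..b}"
    if ab: "a \<le> b" "{a<..<b} \<subseteq> {0<..<1} \<union> {\<alpha><..<\<beta>}" "abs_continuous_on {a..b} f" "abs_continuous_on {a..b} g" for a b
  proof (rule fundamental_theorem_abs_continuous[OF ab(1)])
    show "abs_continuous_on {a..b} ?F"
      by (intro bounded_bilinear.abs_continuous_on_prod_interval[OF bounded_bilinear_inner] ab)
    show "negligible (N \<union> {a, b})" using N by simp
    fix x assume "x \<in> {a..b} - (N \<union> {a, b})"
    then have "x \<in> ({0<..<1} \<union> {\<alpha><..<\<beta>}) - N" using ab(2) by (auto simp: subset_iff)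
    then show "(?F has_vector_derivative ?F' x) (at x within {a..b})"
      by (intro bounded_bilinear.has_vector_derivative[OF bounded_bilinear_inner
          has_vector_derivative_at_within[OF df] has_vector_derivative_at_within[OF dg]])
  qed
  have "(?F' has_integral (?F 1 - ?F 0) + (?F \<beta> - ?F \<alpha>)) ({0..1} \<union> {\<alpha>..\<beta>})"
    by (rule has_integral_Un[OF int[of 0 1] int[of \<alpha> \<beta>]]) (use \<alpha> \<beta> ac in auto)
  then have "integral S ?F' = (?F 1 - ?F 0) + (?F \<beta> - ?F \<alpha>)"
    by (simp add: two_intervals_def integral_unique)
  moreover have "integrable M (\<lambda>x. f x \<bullet> g' x)" "integrable M (\<lambda>x. f' x \<bullet> g x)"
    by (intro integrable_inner_L2 L2)+
  then have "integral S ?F' = l2inner M f g' + l2inner M f' g"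
    unfolding l2inner_def by (subst lebesgue_integral_eq_integral[symmetric]) auto
  ultimately show ?thesis by simp
qed

text \<open>
  Integration by parts for the real inner product, applied to \<open>\<i> a\<close> and \<open>b\<close>. Both satisfy the
  boundary condition, so the boundary terms at the right endpoints cancel those at the left ones.
\<close>

lemma momentum_symmetric:
  assumes a: "a \<in> op_dom P" and b: "b \<in> op_dom P"
  shows "l2inner M (op_app P a) b = l2inner M a (op_app P b)"
proof -
  let ?a' = "derivative_on S a" and ?b' = "derivative_on S b"
  let ?ia = "\<lambda>x. 0 + \<i> * a x" and ?ia' = "\<lambda>x. \<i> * ?a' x"
  have ia: "?ia \<in> op_dom P" using dom_combine(1)[OF dom_zero(1) a, of \<i>] .
  obtain N1 where N1: "negligible N1"
    "\<And>x. x \<in> ({0<..<1} \<union> {\<alpha><..<\<beta>}) - N1 \<Longrightarrow> (a has_vector_derivative ?a' x) (at x)"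
    by (rule dom_derivative[OF a], rule that)
  obtain N2 where N2: "negligible N2"
    "\<And>x. x \<in> ({0<..<1} \<union> {\<alpha><..<\<beta>}) - N2 \<Longrightarrow> (b has_vector_derivative ?b' x) (at x)"
    by (rule dom_derivative[OF b], rule that)
  have "l2inner M ?ia ?b' + l2inner M ?ia' b = (?ia 1 \<bullet> b 1 + ?ia \<beta> \<bullet> b \<beta>) - (?ia 0 \<bullet> b 0 + ?ia \<alpha> \<bullet> b \<alpha>)"
  proof (rule green_identity)
    show "negligible (N1 \<union> N2)" using N1 N2 by simp
    fix x assume x: "x \<in> ({0<..<1} \<union> {\<alpha><..<\<beta>}) - (N1 \<union> N2)"
    then show "(b has_vector_derivative ?b' x) (at x)" by (intro N2(2)) auto
    have "(a has_vector_derivative ?a' x) (at x)" using x by (intro N1(2)) auto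
    then show "(?ia has_vector_derivative ?ia' x) (at x)"
      by (simp add: has_vector_derivative_mult_right)
  qed (use dom_abs_continuous[OF ia] dom_abs_continuous[OF a] dom_abs_continuous[OF b] dom_L2[OF ia] dom_L2[OF b]
      in auto)
  also have "\<dots> = 0"
  proof -
    have "(vector [?ia 0, ?ia \<alpha>] :: complex^2) \<bullet> vector [b 0, b \<alpha>] = (vector [?ia 1, ?ia \<beta>] :: complex^2) \<bullet> vector [b 1, b \<beta>]"
      using ia b isometric_inner[of "vector [?ia 1, ?ia \<beta>]" "vector [b 1, b \<beta>]"]
      by (simp add: momentum_def)
    then show ?thesis by (simp add: inner_vector_2)
  qed
  finally have zero: "l2inner M ?ia ?b' + l2inner M ?ia' b = 0" .
  have app: "op_app P f = (\<lambda>x. of_real (- 1 / (2 * pi)) * (\<i> * derivative_on S f x))" for f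
  proof
    fix x
    have "1 / (\<i> * 2 * complex_of_real pi) = of_real (- 1 / (2 * pi)) * \<i>"
      by (simp add: field_simps)
    then show "op_app P f x = of_real (- 1 / (2 * pi)) * (\<i> * derivative_on S f x)"
      by (simp only: momentum_def momentum_max_def snd_conv mult.assoc)
  qed
  have i: "u \<bullet> (\<i> * v) = - ((\<i> * u) \<bullet> v)" for u v :: complex
    by (simp add: inner_complex_def)
  have "l2inner M a (op_app P b) = - 1 / (2 * pi) * l2inner M a (\<lambda>x. \<i> * ?b' x)"
    unfolding app by (rule l2inner_scale_right)
  also have "l2inner M a (\<lambda>x. \<i> * ?b' x) = - l2inner M ?ia ?b'"
    by (simp add: l2inner_def i)
  also have "- 1 / (2 * pi) * - l2inner M ?ia ?b' = - 1 / (2 * pi) * l2inner M ?ia' b"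
    using zero by (simp add: add_eq_0_iff)
  also have "\<dots> = l2inner M (op_app P a) b"
    unfolding app by (rule l2inner_scale_left[symmetric])
  finally show ?thesis by simp
qed

lemma shifted_symmetric:
  assumes a: "a \<in> op_dom P" and b: "b \<in> op_dom P"
  shows "l2inner M (shifted P (of_real \<mu>) a) b = l2inner M a (shifted P (of_real \<mu>) b)"
proof -
  have sh: "shifted P (of_real \<mu>) f = (\<lambda>x. op_app P f x - of_real \<mu> * f x)" for f
    by (simp add: shifted_def fun_eq_iff)
  have "op_app P f \<in> L2 M" if "f \<in> op_dom P" for f
    using L2_add[OF shifted_L2[OF that, of 0] L2_zero] by (simp add: shifted_def)
  then show ?thesis
    unfolding sh using momentum_symmetric[OF a b] a b
    by (simp add: l2inner_diff_left l2inner_diff_right l2inner_scale_left l2inner_scale_right dom_L2)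
qed

text \<open>
  The gap has length \<open>\<alpha> - 1\<close>, so two points that are closer than this lie in the same interval.
\<close>

lemma dom_increment_bound:
  assumes f: "f \<in> op_dom P" and t: "0 < t" and xy: "x \<in> S" "y \<in> S" "x \<le> y" "y - x < \<alpha> - 1"
  shows "cmod (f y - f x) \<le> t / 2 * (l2norm M (derivative_on S f))\<^sup>2 + (y - x) / (2 * t)"
proof -
  let ?f' = "derivative_on S f"
  obtain N where N: "negligible N"
    "\<And>x. x \<in> ({0<..<1} \<union> {\<alpha><..<\<beta>}) - N \<Longrightarrow> (f has_vector_derivative ?f' x) (at x)"
    by (rule dom_derivative[OF f], rule that)
  have main: "cmod (f y - f x) \<le> t / 2 * (l2norm M ?f')\<^sup>2 + (y - x) / (2 * t)"
    if ab: "a \<le> x" "y \<le> b" "{a<..<b} \<subseteq> {0<..<1} \<union> {\<alpha><..<\<beta>}" "abs_continuous_on {a..b} f"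
      "?f' \<in> L2 (lebesgue_on {a..b})" "l2norm (lebesgue_on {a..b}) ?f' \<le> l2norm M ?f'" for a b
  proof -
    have "(?f' has_integral f y - f x) {x..y}"
    proof (rule fundamental_theorem_abs_continuous[OF xy(3)])
      show "abs_continuous_on {x..y} f" using ab by (auto intro: abs_continuous_on_subset)
      show "negligible (N \<union> {x, y})" using N by simp
      fix s assume "s \<in> {x..y} - (N \<union> {x, y})"
      then have "s \<in> ({0<..<1} \<union> {\<alpha><..<\<beta>}) - N" using ab(1-3) by (auto simp: subset_iff)
      then show "(f has_vector_derivative ?f' s) (at s within {x..y})"
        by (rule has_vector_derivative_at_within[OF N(2)])
    qed
    then have "cmod (f y - f x) = cmod (integral {x..y} ?f')" by (simp add: integral_unique)
    also have "\<dots> \<le> t / 2 * (l2norm (lebesgue_on {a..b}) ?f')\<^sup>2 + (y - x) / (2 * t)"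
      using xy ab by (intro norm_integral_young t) auto
    also have "\<dots> \<le> t / 2 * (l2norm M ?f')\<^sup>2 + (y - x) / (2 * t)"
      using t ab(6) by (intro add_right_mono mult_left_mono power_mono) auto
    finally show ?thesis .
  qed
  note r = restrict_L2[OF dom_abs_continuous(3)[OF f]]
  show ?thesis
  proof (cases "y \<le> 1")
    case True
    then have "0 \<le> x" using xy \<alpha> by (auto simp: two_intervals_def)
    with True show ?thesis by (intro main[of 0 1] dom_abs_continuous f r) auto
  next
    case False
    then have "\<alpha> \<le> x" "y \<le> \<beta>" using xy \<alpha> by (auto simp: two_intervals_def)
    then show ?thesis by (intro main[of \<alpha> \<beta>] dom_abs_continuous f r) auto
  qed
qed

end

locale momentum_resolvent = momentum_operator +
  fixes \<mu> :: real
  assumes chi_\<mu>: "chi (of_real \<mu>) \<noteq> 0"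
begin

abbreviation "T \<equiv> shifted P (of_real \<mu>)"

definition resolve :: "(real \<Rightarrow> complex) \<Rightarrow> real \<Rightarrow> complex" where
  "resolve g = (SOME f. f \<in> op_dom P \<and> (AE x in M. T f x = g x))"

text \<open>
  Solutions are unique only on the two intervals. With the value 0 outside, the resolvent is
  linear pointwise.
\<close>

definition res :: "(real \<Rightarrow> complex) \<Rightarrow> real \<Rightarrow> complex" where
  "res g x = (if x \<in> S then resolve g x else 0)"

lemma resolve:
  assumes "g \<in> L2 M"
  shows "resolve g \<in> op_dom P" "AE x in M. T (resolve g) x = g x"
  using someI_ex[of "\<lambda>f. f \<in> op_dom P \<and> (AE x in M. T f x = g x)"] chi_nonzero_solvable[OF chi_\<mu> assms]
  unfolding resolve_def by blast+

lemma res_eq: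
  assumes g: "g \<in> L2 M" and f: "f \<in> op_dom P" and eq: "AE x in M. T f x = g x" and x: "x \<in> S"
  shows "res g x = f x"
proof -
  obtain C where C: "0 < C" "\<And>f g x. f \<in> op_dom P \<Longrightarrow> g \<in> L2 M \<Longrightarrow> (AE x in M. T f x = g x) \<Longrightarrow>
    x \<in> S \<Longrightarrow> cmod (f x) \<le> C * l2norm M g"
    by (rule chi_nonzero_bound[OF chi_\<mu>], rule that)
  let ?h = "\<lambda>x. resolve g x + (- 1) * f x"
  have "?h \<in> op_dom P" by (intro dom_combine resolve g f)
  moreover have "AE x in M. T ?h x = 0"
    using dom_combine(2)[OF resolve(1)[OF g] f, of "of_real \<mu>" "- 1"] resolve(2)[OF g] eq
    by eventually_elim simp
  ultimately have "cmod (?h x) \<le> C * l2norm M (\<lambda>_. 0)" by (intro C(2) x) auto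
  then have "?h x = 0" using l2norm_eq_0_iff[OF L2_zero, of M] by simp
  then show ?thesis using x by (simp add: res_def)
qed

lemma res_combine:
  assumes f: "f \<in> L2 M" and g: "g \<in> L2 M"
  shows "res (\<lambda>x. f x + c * g x) = (\<lambda>x. res f x + c * res g x)"
proof
  fix x
  show "res (\<lambda>x. f x + c * g x) x = res f x + c * res g x"
  proof (cases "x \<in> S")
    case True
    have "AE x in M. T (\<lambda>x. resolve f x + c * resolve g x) x = f x + c * g x"
      using dom_combine(2)[OF resolve(1)[OF f] resolve(1)[OF g], of "of_real \<mu>" c]
        resolve(2)[OF f] resolve(2)[OF g]
      by eventually_elim simp
    then have "res (\<lambda>x. f x + c * g x) x = resolve f x + c * resolve g x"
      using f g by (intro res_eq[OF _ _ _ True] dom_combine resolve) auto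
    then show ?thesis using True by (simp add: res_def)
  qed (simp add: res_def)
qed

lemma res_AE: "AE x in M. res g x = resolve g x"
  by (intro AE_I2) (simp add: res_def space_restrict_space)

lemma res_L2: "g \<in> L2 M \<Longrightarrow> res g \<in> L2 M"
  by (rule L2_lebesgue_on_cong_AE[OF dom_L2[OF resolve(1)]]) (use res_AE[of g] in \<open>auto elim: eventually_mono\<close>)

lemma resolve_sup_bound:
  obtains C where "0 < C" "\<And>g x. g \<in> L2 M \<Longrightarrow> x \<in> S \<Longrightarrow> cmod (resolve g x) \<le> C * l2norm M g"
proof -
  obtain C where C: "0 < C" "\<And>f g x. f \<in> op_dom P \<Longrightarrow> g \<in> L2 M \<Longrightarrow> (AE x in M. T f x = g x) \<Longrightarrow>
    x \<in> S \<Longrightarrow> cmod (f x) \<le> C * l2norm M g"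
    by (rule chi_nonzero_bound[OF chi_\<mu>], rule that)
  show thesis by (rule that[OF C(1)]) (intro C(2) resolve)
qed

lemma res_symmetric:
  assumes f: "f \<in> L2 M" and g: "g \<in> L2 M"
  shows "l2inner M (res f) g = l2inner M f (res g)"
proof -
  let ?a = "resolve f" and ?b = "resolve g"
  have a: "?a \<in> op_dom P" and b: "?b \<in> op_dom P" by (intro resolve f g)+
  have gb: "AE x in M. g x = T ?b x" using resolve(2)[OF g] by eventually_elim simp
  have bR: "AE x in M. ?b x = res g x" using res_AE[of g] by eventually_elim simp
  have "l2inner M (res f) g = l2inner M ?a g"
    by (rule l2inner_cong_AE[OF res_L2[OF f] dom_L2[OF a] g res_AE])
  also have "\<dots> = l2inner M (T ?b) ?a"
    unfolding l2inner_commute[of M ?a g]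
    by (rule l2inner_cong_AE[OF g shifted_L2[OF b] dom_L2[OF a] gb])
  also have "\<dots> = l2inner M (T ?a) ?b"
    using shifted_symmetric[OF a b, of \<mu>] by (simp add: l2inner_commute)
  also have "\<dots> = l2inner M f ?b"
    by (rule l2inner_cong_AE[OF shifted_L2[OF a] f dom_L2[OF b] resolve(2)[OF f]])
  also have "\<dots> = l2inner M (res g) f"
    unfolding l2inner_commute[of M f ?b]
    by (rule l2inner_cong_AE[OF dom_L2[OF b] res_L2[OF g] f bR])
  finally show ?thesis by (simp add: l2inner_commute)
qed

text \<open>
  Solutions with bounded right-hand sides are bounded, and since their derivatives are bounded in
  \<open>L\<^sup>2\<close> they are equicontinuous; the Arzela-Ascoli theorem applies.
\<close>

lemma res_compact:
  assumes g: "\<And>n::nat. g n \<in> L2 M" and gA: "\<And>n. l2norm M (g n) \<le> A"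
  shows "\<exists>h\<in>L2 M. \<exists>r::nat \<Rightarrow> nat. strict_mono r \<and> (\<lambda>n. l2norm M (\<lambda>x. res (g (r n)) x - h x)) \<longlonglongrightarrow> 0"
proof -
  let ?f = "\<lambda>n. resolve (g n)"
  obtain C where C: "0 < C" "\<And>g x. g \<in> L2 M \<Longrightarrow> x \<in> S \<Longrightarrow> cmod (resolve g x) \<le> C * l2norm M g"
    by (rule resolve_sup_bound, rule that)
  have A: "0 \<le> A" using gA[of 0] l2norm_nonneg[of M "g 0"] by linarith
  have dom: "?f n \<in> op_dom P" for n by (intro resolve g)
  have sup: "cmod (?f n x) \<le> C * A" if "x \<in> S" for n x
    using C(2)[OF g that] mult_left_mono[OF gA, of C n] C(1) by (meson order_trans less_imp_le)
  define D where "D = cmod (two_pi_i * of_real \<mu>) * (C * A * sqrt (measure lebesgue S)) + cmod two_pi_i * A"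
  have D: "0 \<le> D" using C A by (simp add: D_def)
  have der: "l2norm M (derivative_on S (?f n)) \<le> D" for n
  proof -
    have "AE x in M. derivative_on S (?f n) x = two_pi_i * of_real \<mu> * ?f n x + two_pi_i * g n x"
      using resolve(2)[OF g] by (simp add: shifted_momentum_iff)
    then have "l2norm M (derivative_on S (?f n)) = l2norm M (\<lambda>x. two_pi_i * of_real \<mu> * ?f n x + two_pi_i * g n x)"
      using dom_abs_continuous(3)[OF dom] dom_L2[OF dom] g by (intro l2norm_cong_AE) (auto intro!: L2_D(1))
    also have "\<dots> \<le> l2norm M (\<lambda>x. two_pi_i * of_real \<mu> * ?f n x) + l2norm M (\<lambda>x. two_pi_i * g n x)"
      using dom_L2[OF dom] g by (intro l2norm_triangle L2_cmult)
    also have "\<dots> \<le> D"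
      unfolding l2norm_cmult D_def using C A
      by (intro add_mono mult_left_mono gA l2norm_le_bound dom_L2 dom sup) auto
    finally show ?thesis .
  qed
  have equi: "\<exists>d>0. \<forall>n y. y \<in> S \<and> norm (x - y) < d \<longrightarrow> cmod (?f n x - ?f n y) < e"
    if x: "x \<in> S" and e: "0 < e" for x e
  proof -
    define t where "t = e / (D\<^sup>2 + 1)"
    have D2: "0 < D\<^sup>2 + 1" by (simp add: add_nonneg_pos)
    have t: "0 < t" using e D2 by (simp add: t_def)
    have tD: "t * D\<^sup>2 \<le> e"
      using e D2 by (simp add: t_def pos_divide_le_eq)
    have step: "cmod (?f n v - ?f n u) < e"
      if uv: "u \<in> S" "v \<in> S" "u \<le> v" "v - u < \<alpha> - 1" "v - u < e * t" for n u v
    proof -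
      have "cmod (?f n v - ?f n u) \<le> t / 2 * (l2norm M (derivative_on S (?f n)))\<^sup>2 + (v - u) / (2 * t)"
        by (intro dom_increment_bound dom t uv)
      also have "\<dots> \<le> t / 2 * D\<^sup>2 + (v - u) / (2 * t)"
        using t der by (intro add_right_mono mult_left_mono power_mono) auto
      also have "\<dots> < e"
      proof -
        have q: "(v - u) / (2 * t) < e / 2" using uv(5) t by (simp add: pos_divide_less_eq)
        have "t / 2 * D\<^sup>2 \<le> e / 2" using tD by simp
        from add_le_less_mono[OF this q] show ?thesis by (simp only: field_sum_of_halves)
      qed
      finally show ?thesis .
    qed
    have "cmod (?f n x - ?f n y) < e" if "y \<in> S" "norm (x - y) < min (\<alpha> - 1) (e * t)" for n y
    proof (cases "x \<le> y")
      case True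
      then show ?thesis using step[of x y n] x that by (simp add: norm_minus_commute)
    next
      case False
      then show ?thesis using step[of y x n] x that by simp
    qed
    moreover have "0 < min (\<alpha> - 1) (e * t)" using \<alpha> e t by simp
    ultimately show ?thesis by blast
  qed
  obtain h r where h: "continuous_on S h" and r: "strict_mono (r :: nat \<Rightarrow> nat)"
    and lim: "\<And>e. 0 < e \<Longrightarrow> \<exists>N. \<forall>n x. n \<ge> N \<and> x \<in> S \<longrightarrow> norm (?f (r n) x - h x) < e"
    using Arzela_Ascoli[OF two_intervals_compact sup equi] by blast
  have hL2: "h \<in> L2 M" by (rule continuous_on_imp_L2[OF two_intervals_compact h])
  have "(\<lambda>n. l2norm M (\<lambda>x. res (g (r n)) x - h x)) \<longlonglongrightarrow> 0"
  proof (rule LIMSEQ_I)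
    fix e :: real assume e: "0 < e"
    let ?m = "sqrt (measure lebesgue S)"
    let ?e = "e / (?m + 1)"
    have m: "0 \<le> ?m" by simp
    then have m1: "0 < ?m + 1" by linarith
    have e': "0 < ?e" using e m1 by simp
    obtain N where N: "\<forall>n x. n \<ge> N \<and> x \<in> S \<longrightarrow> norm (?f (r n) x - h x) < ?e"
      using lim[OF e'] by blast
    have "l2norm M (\<lambda>x. res (g (r n)) x - h x) < e" if "N \<le> n" for n
    proof -
      have "l2norm M (\<lambda>x. res (g (r n)) x - h x) \<le> ?e * ?m"
        using N that e' by (intro l2norm_le_bound L2_diff res_L2 g hL2) (auto simp: res_def less_imp_le)
      also have "\<dots> < ?e * (?m + 1)" using e' by (intro mult_strict_left_mono) auto
      also have "\<dots> = e" using m1 by (intro nonzero_divide_eq_eq[THEN iffD1, OF _ refl, symmetric]) simp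
      finally show ?thesis .
    qed
    then show "\<exists>no. \<forall>n\<ge>no. norm (l2norm M (\<lambda>x. res (g (r n)) x - h x) - 0) < e" by auto
  qed
  then show ?thesis using hL2 r by blast
qed

lemma compact_symmetric_res: "\<exists>C. compact_symmetric M res C"
proof -
  obtain C where C: "0 < C" "\<And>g x. g \<in> L2 M \<Longrightarrow> x \<in> S \<Longrightarrow> cmod (resolve g x) \<le> C * l2norm M g"
    by (rule resolve_sup_bound, rule that)
  have "compact_symmetric M res (C * sqrt (measure lebesgue S))"
  proof
    fix f g assume f: "f \<in> L2 M" and g: "g \<in> L2 M"
    show "res (\<lambda>x. f x + g x) = (\<lambda>x. res f x + res g x)"
      using res_combine[OF f g, of 1] by simp
    show "l2inner M (res f) g = l2inner M f (res g)" by (intro res_symmetric f g)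
  next
    fix f assume f: "f \<in> L2 M"
    show "res f \<in> L2 M" by (intro res_L2 f)
    have "res (\<lambda>_. 0) = (\<lambda>_. 0)" using res_combine[OF L2_zero L2_zero, of 1] by (simp add: fun_eq_iff)
    then show "res (\<lambda>x. complex_of_real c * f x) = (\<lambda>x. complex_of_real c * res f x)" for c
      using res_combine[OF L2_zero f, of "complex_of_real c"] by simp
    have "l2norm M (res f) \<le> C * l2norm M f * sqrt (measure lebesgue S)"
      using C f by (intro l2norm_le_bound res_L2) (auto simp: res_def)
    then show "l2norm M (res f) \<le> C * sqrt (measure lebesgue S) * l2norm M f"
      by (simp add: mult.commute mult.left_commute)
  next
    fix s A
    assume "\<And>n::nat. s n \<in> L2 M" "\<And>n. l2norm M (s n) \<le> A"
    then show "\<exists>h\<in>L2 M. \<exists>r. strict_mono r \<and> (\<lambda>n. l2norm M (\<lambda>x. res (s (r n)) x - h x)) \<longlonglongrightarrow> 0"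
      by (rule res_compact)
  qed
  then show ?thesis by blast
qed

section \<open>Completeness of the eigenfunctions\<close>

definition combination :: "(real \<Rightarrow> complex) set \<Rightarrow> ((real \<Rightarrow> complex) \<Rightarrow> complex) \<Rightarrow> real \<Rightarrow> complex" where
  "combination F c x = (\<Sum>f\<in>F. c f * f x)"

definition eigenfunctions :: "(real \<Rightarrow> complex) set" where
  "eigenfunctions = {f. \<exists>z. eigenvector M P z f}"

text \<open>
  The span is closed under equality almost everywhere, since an eigenvector of the resolvent agrees
  only almost everywhere with an eigenfunction in the domain of \<open>P\<close>.
\<close>

definition eigen_span :: "(real \<Rightarrow> complex) set" where
  "eigen_span = {h \<in> L2 M. \<exists>F c. finite F \<and> F \<subseteq> eigenfunctions \<and> (AE x in M. h x = combination F c x)}"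

lemma eigenfunctions_eigenvalue:
  assumes "f \<in> eigenfunctions"
  obtains z where "f \<in> op_dom P" "z \<noteq> of_real \<mu>" "AE x in M. T f x = (z - of_real \<mu>) * f x"
proof -
  obtain z where z: "eigenvector M P z f" using assms by (auto simp: eigenfunctions_def)
  show thesis
  proof (rule that)
    show "f \<in> op_dom P" using z by (simp add: eigenvector_def)
    show "z \<noteq> of_real \<mu>" using eigenvector_imp_chi_zero[OF z] chi_\<mu> by auto
    have "AE x in M. op_app P f x = z * f x" using z by (simp add: eigenvector_def)
    then show "AE x in M. T f x = (z - of_real \<mu>) * f x"
      by eventually_elim (simp add: shifted_def algebra_simps)
  qed
qed

text \<open>The resolvent divides the coefficient of an eigenfunction with eigenvalue \<open>z\<close> by \<open>z - \<mu>\<close>.\<close>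

lemma res_combination:
  assumes "finite F" "F \<subseteq> eigenfunctions"
  shows "\<exists>c'. combination F c' \<in> op_dom P \<and> (AE x in M. T (combination F c') x = combination F c x)"
  using assms
proof (induction F)
  case empty
  have "combination {} c = (\<lambda>_. 0)" for c by (simp add: combination_def fun_eq_iff)
  then show ?case using dom_zero by auto
next
  case (insert f F)
  then obtain c' where c': "combination F c' \<in> op_dom P" "AE x in M. T (combination F c') x = combination F c x"
    by auto
  obtain z where f: "f \<in> op_dom P" and z: "z \<noteq> of_real \<mu>" and T: "AE x in M. T f x = (z - of_real \<mu>) * f x"
    using eigenfunctions_eigenvalue[of f] insert.prems by blast
  let ?d = "c f / (z - of_real \<mu>)"
  have eq: "combination (insert f F) (c'(f := ?d)) = (\<lambda>x. combination F c' x + ?d * f x)"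
  proof
    fix x
    have "(\<Sum>h\<in>F. (c'(f := ?d)) h * h x) = combination F c' x"
      unfolding combination_def using insert.hyps by (intro sum.cong) auto
    then show "combination (insert f F) (c'(f := ?d)) x = combination F c' x + ?d * f x"
      using insert.hyps by (simp add: combination_def add.commute)
  qed
  have "AE x in M. T (\<lambda>x. combination F c' x + ?d * f x) x = combination (insert f F) c x"
    using dom_combine(2)[OF c'(1) f, of "of_real \<mu>" ?d] c'(2) T
    by eventually_elim (use z insert.hyps in \<open>simp add: combination_def add.commute\<close>)
  then show ?case
    using dom_combine(1)[OF c'(1) f, of ?d] unfolding eq[symmetric] by blast
qed

lemma res_maps_eigen_span:
  assumes "h \<in> eigen_span"
  shows "res h \<in> eigen_span"
proof -
  obtain F c where h: "h \<in> L2 M" and F: "finite F" "F \<subseteq> eigenfunctions" and eq: "AE x in M. h x = combination F c x"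
    using assms by (auto simp: eigen_span_def)
  obtain c' where c': "combination F c' \<in> op_dom P" "AE x in M. T (combination F c') x = combination F c x"
    using res_combination[OF F] by blast
  have "AE x in M. T (combination F c') x = h x" using c'(2) eq by eventually_elim simp
  then have "res h x = combination F c' x" if "x \<in> S" for x by (intro res_eq[OF h c'(1) _ that])
  then have "AE x in M. res h x = combination F c' x" by (intro AE_I2) (simp add: space_restrict_space)
  then show ?thesis using F res_L2[OF h] by (auto simp: eigen_span_def)
qed

lemma eigen_span_add:
  assumes "f \<in> eigen_span" "g \<in> eigen_span"
  shows "(\<lambda>x. f x + g x) \<in> eigen_span"
proof -
  obtain F c where F: "f \<in> L2 M" "finite F" "F \<subseteq> eigenfunctions" "AE x in M. f x = combination F c x"
    using assms(1) by (auto simp: eigen_span_def)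
  obtain G d where G: "g \<in> L2 M" "finite G" "G \<subseteq> eigenfunctions" "AE x in M. g x = combination G d x"
    using assms(2) by (auto simp: eigen_span_def)
  define b where "b h = (if h \<in> F then c h else 0) + (if h \<in> G then d h else 0)" for h
  have comb: "combination (F \<union> G) b x = combination F c x + combination G d x" for x
  proof -
    have "combination (F \<union> G) b x =
        (\<Sum>h\<in>F \<union> G. (if h \<in> F then c h else 0) * h x) + (\<Sum>h\<in>F \<union> G. (if h \<in> G then d h else 0) * h x)"
      by (simp add: combination_def b_def distrib_right sum.distrib)
    also have "(\<Sum>h\<in>F \<union> G. (if h \<in> F then c h else 0) * h x) = combination F c x"
      unfolding combination_def using F(2) G(2) by (intro sum.mono_neutral_cong_right) auto
    also have "(\<Sum>h\<in>F \<union> G. (if h \<in> G then d h else 0) * h x) = combination G d x"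
      unfolding combination_def using F(2) G(2) by (intro sum.mono_neutral_cong_right) auto
    finally show ?thesis .
  qed
  have "AE x in M. f x + g x = combination (F \<union> G) b x"
    using F(4) G(4) by eventually_elim (simp add: comb)
  moreover have "finite (F \<union> G)" "F \<union> G \<subseteq> eigenfunctions" using F G by auto
  ultimately show ?thesis
    using F(1) G(1) by (auto simp: eigen_span_def intro!: exI[of _ "F \<union> G"] exI[of _ b])
qed

lemma eigen_span_scale:
  assumes "f \<in> eigen_span"
  shows "(\<lambda>x. a * f x) \<in> eigen_span"
proof -
  obtain F c where F: "f \<in> L2 M" "finite F" "F \<subseteq> eigenfunctions" "AE x in M. f x = combination F c x"
    using assms by (auto simp: eigen_span_def)
  have "AE x in M. a * f x = combination F (\<lambda>h. a * c h) x"
    using F(4) by eventually_elim (simp add: combination_def sum_distrib_left mult.assoc)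
  then show ?thesis using F unfolding eigen_span_def by blast
qed

lemma AE_zero_in_eigen_span: "f \<in> L2 M \<Longrightarrow> (AE x in M. f x = 0) \<Longrightarrow> f \<in> eigen_span"
  unfolding eigen_span_def by (auto intro!: exI[of _ "{}"] simp: combination_def)

text \<open>By continuity \<open>f\<close> vanishes everywhere inside the intervals, and so does its derivative.\<close>

lemma dom_AE_zero:
  assumes f: "f \<in> op_dom P" and zero: "AE x in M. f x = 0"
  shows "AE x in M. T f x = 0"
proof -
  obtain N where N: "negligible N" "\<forall>x\<in>S - N. f x = 0"
    using zero by (subst (asm) AE_lebesgue_on_iff_negligible) auto
  have f0: "f x = 0" if ab: "{a..b} \<subseteq> S" "abs_continuous_on {a..b} f" "x \<in> {a<..<b}" for a b x
  proof -
    have "((\<lambda>x. (cmod (f x))\<^sup>2) has_integral 0) {a..b}"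
      by (rule has_integral_spike[OF N(1) _ has_integral_0]) (use N(2) ab in auto)
    then have "((\<lambda>x. (cmod (f x))\<^sup>2) has_integral 0) (cbox a b)" by simp
    then have "(cmod (f x))\<^sup>2 = 0"
      using ab abs_continuous_on_imp_continuous_on[OF ab(2)]
      by (intro has_integral_0_cbox_imp_0[of a b "\<lambda>x. (cmod (f x))\<^sup>2"]) (auto intro!: continuous_intros)
    then show ?thesis by simp
  qed
  have zero: "f x = 0" if "x \<in> {0<..<1} \<union> {\<alpha><..<\<beta>}" for x
    using that f0[of 0 1 x] f0[of \<alpha> \<beta> x] dom_abs_continuous[OF f] by (auto simp: two_intervals_def)
  have "AE x in M. derivative_on S f x = 0"
  proof (rule momentum_max_domI(2)[OF \<alpha> dom_abs_continuous(1,2)[OF f] L2_zero negligible_empty])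
    fix x assume x: "x \<in> ({0<..<1} \<union> {\<alpha><..<\<beta>}) - {}"
    show "(f has_vector_derivative 0) (at x)"
      by (rule has_vector_derivative_transform_within_open[OF has_vector_derivative_const[of 0],
            of "{0<..<1} \<union> {\<alpha><..<\<beta>}"]) (use x zero in auto)
  qed
  then show ?thesis
    using assms(2) by eventually_elim (simp add: shifted_momentum_iff)
qed

text \<open>
  An eigenvalue \<open>\<nu>\<close> of the resolvent corresponds to the eigenvalue \<open>\<mu> + 1/\<nu>\<close> of \<open>P\<close>. The eigenvalue
  \<open>\<nu> = 0\<close> does not occur because the resolvent is injective.
\<close>

lemma res_eigenvector_in_eigen_span:
  assumes g: "g \<in> L2 M" and eig: "AE x in M. res g x = of_real \<nu> * g x"
  shows "g \<in> eigen_span"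
proof (cases "AE x in M. resolve g x = 0")
  case True
  have "AE x in M. g x = 0"
    using dom_AE_zero[OF resolve(1)[OF g] True] resolve(2)[OF g] by eventually_elim simp
  then show ?thesis by (rule AE_zero_in_eigen_span[OF g])
next
  case False
  have fg: "AE x in M. resolve g x = of_real \<nu> * g x" using eig res_AE[of g] by eventually_elim simp
  have \<nu>: "\<nu> \<noteq> 0" using fg False by auto
  have "AE x in M. op_app P (resolve g) x = (of_real \<mu> + 1 / of_real \<nu>) * resolve g x"
    using resolve(2)[OF g] fg by eventually_elim (use \<nu> in \<open>simp add: shifted_def field_simps\<close>)
  then have "resolve g \<in> eigenfunctions"
    using resolve(1)[OF g] False by (auto simp: eigenfunctions_def eigenvector_def)
  moreover have "AE x in M. g x = combination {resolve g} (\<lambda>_. 1 / of_real \<nu>) x"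
    using fg by eventually_elim (use \<nu> in \<open>simp add: combination_def\<close>)
  ultimately show ?thesis using g unfolding eigen_span_def by (auto intro!: exI[of _ "{resolve g}"])
qed

text \<open>Each \<open>u\<close> in the domain is in the range of the resolvent, as the image of \<open>(P - \<mu>) u\<close>.\<close>

lemma dom_approximation:
  assumes u: "u \<in> op_dom P" and \<epsilon>: "0 < \<epsilon>"
  shows "\<exists>y\<in>eigen_span. l2norm M (\<lambda>x. u x - y x) < \<epsilon>"
proof -
  obtain C where "compact_symmetric M res C" using compact_symmetric_res by blast
  then interpret compact_symmetric M res C .
  have T: "T u \<in> L2 M" by (rule shifted_L2[OF u])
  have "\<exists>y\<in>eigen_span. l2norm M (\<lambda>x. res (T u) x - y x) < \<epsilon>"
  proof (rule range_in_closure_of_eigenvectors[OF _ _ eigen_span_add eigen_span_scale res_maps_eigen_span res_eigenvector_in_eigen_span T \<epsilon>])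
    show "eigen_span \<subseteq> L2 M" by (auto simp: eigen_span_def)
    show "(\<lambda>x. 0) \<in> eigen_span" by (intro AE_zero_in_eigen_span) auto
  qed
  then obtain y where y: "y \<in> eigen_span" "l2norm M (\<lambda>x. res (T u) x - y x) < \<epsilon>" by blast
  have yL: "y \<in> L2 M" using y(1) by (simp add: eigen_span_def)
  have "AE x in M. res (T u) x = u x"
    using res_eq[OF T u] by (intro AE_I2) (simp add: space_restrict_space)
  then have "AE x in M. res (T u) x - y x = u x - y x" by eventually_elim simp
  then have "l2norm M (\<lambda>x. res (T u) x - y x) = l2norm M (\<lambda>x. u x - y x)"
    using yL dom_L2[OF u] res_L2[OF T] by (intro l2norm_cong_AE) (auto intro: L2_D)
  then show ?thesis using y by auto
qed

end

section \<open>Density of the domain\<close>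

lemma l2norm_dominated_convergence:
  assumes meas: "\<And>n::nat. f n \<in> borel_measurable M" "g \<in> borel_measurable M"
    and w: "integrable M (\<lambda>x. (w x)\<^sup>2)" and le: "\<And>n x. x \<in> space M \<Longrightarrow> cmod (g x - f n x) \<le> w x"
    and lim: "AE x in M. (\<lambda>n. f n x) \<longlonglongrightarrow> g x"
  shows "(\<lambda>n. l2norm M (\<lambda>x. g x - f n x)) \<longlonglongrightarrow> 0"
proof -
  have "(\<lambda>n. \<integral>x. (cmod (g x - f n x))\<^sup>2 \<partial>M) \<longlonglongrightarrow> (\<integral>x. 0 \<partial>M)"
  proof (rule integral_dominated_convergence[OF _ _ w])
    show "AE x in M. (\<lambda>n. (cmod (g x - f n x))\<^sup>2) \<longlonglongrightarrow> 0"
      using lim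
    proof eventually_elim
      case (elim x)
      then have "(\<lambda>n. (cmod (g x - f n x))\<^sup>2) \<longlonglongrightarrow> (cmod (g x - g x))\<^sup>2" by (intro tendsto_intros)
      then show ?case by simp
    qed
    show "AE x in M. norm ((cmod (g x - f n x))\<^sup>2) \<le> (w x)\<^sup>2" for n
      using le by (intro AE_I2) (simp add: power_mono)
  qed (use meas in simp_all)
  then have "(\<lambda>n. sqrt (\<integral>x. (cmod (g x - f n x))\<^sup>2 \<partial>M)) \<longlonglongrightarrow> sqrt 0"
    by (intro tendsto_real_sqrt) simp
  then show ?thesis by (simp add: l2norm_def)
qed

definition L2_closure :: "'a measure \<Rightarrow> ('a \<Rightarrow> complex) set \<Rightarrow> ('a \<Rightarrow> complex) set" where
  "L2_closure M D = {g \<in> L2 M. \<forall>\<epsilon>>0. \<exists>u\<in>D. l2norm M (\<lambda>x. g x - u x) < \<epsilon>}"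

lemma L2_closure_approx:
  assumes D: "D \<subseteq> L2 M" and g: "g \<in> L2 M"
    and approx: "\<And>\<epsilon>. 0 < \<epsilon> \<Longrightarrow> \<exists>f\<in>L2_closure M D. l2norm M (\<lambda>x. g x - f x) < \<epsilon>"
  shows "g \<in> L2_closure M D"
  unfolding L2_closure_def
proof (intro CollectI conjI g allI impI)
  fix \<epsilon> :: real assume "0 < \<epsilon>"
  then have e: "0 < \<epsilon> / 2" by simp
  obtain f where f: "f \<in> L2_closure M D" "l2norm M (\<lambda>x. g x - f x) < \<epsilon> / 2"
    using approx[OF e] by blast
  then obtain u where u: "u \<in> D" "l2norm M (\<lambda>x. f x - u x) < \<epsilon> / 2"
    using e unfolding L2_closure_def by blast
  have "l2norm M (\<lambda>x. g x - u x) < \<epsilon>"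
    using l2norm_triangle_diff[of g M f u] g f u D by (auto simp: L2_closure_def)
  then show "\<exists>u\<in>D. l2norm M (\<lambda>x. g x - u x) < \<epsilon>" using u by blast
qed

lemma L2_closure_limit:
  assumes D: "D \<subseteq> L2 M" and g: "g \<in> L2 M" and f: "\<And>n::nat. f n \<in> L2_closure M D"
    and lim: "(\<lambda>n. l2norm M (\<lambda>x. g x - f n x)) \<longlonglongrightarrow> 0"
  shows "g \<in> L2_closure M D"
proof (rule L2_closure_approx[OF D g])
  fix \<epsilon> :: real assume "0 < \<epsilon>"
  then obtain n where "l2norm M (\<lambda>x. g x - f n x) < \<epsilon>"
    using order_tendstoD(2)[OF lim] eventually_happens'[OF sequentially_bot] by blast
  then show "\<exists>f\<in>L2_closure M D. l2norm M (\<lambda>x. g x - f x) < \<epsilon>" using f by blast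
qed

lemma L2_closure_superset: "D \<subseteq> L2 M \<Longrightarrow> u \<in> D \<Longrightarrow> u \<in> L2_closure M D"
  unfolding L2_closure_def by (auto intro!: bexI[of _ u] simp: l2norm_def)

context momentum_operator
begin

lemma piecewise_polynomial_in_dom:
  fixes p1 p2 :: "real \<Rightarrow> complex"
  assumes p: "polynomial_function p1" "polynomial_function p2"
    and zero: "p1 0 = 0" "p1 1 = 0" "p2 \<alpha> = 0" "p2 \<beta> = 0"
  shows "(\<lambda>x. if x \<le> 1 then p1 x else p2 x) \<in> op_dom P"
proof -
  let ?u = "\<lambda>x. if x \<le> 1 then p1 x else p2 x"
  obtain p1' where p1': "polynomial_function p1'" "\<And>x. (p1 has_vector_derivative p1' x) (at x)"
    using has_vector_derivative_polynomial_function[OF p(1)] by blast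
  obtain p2' where p2': "polynomial_function p2'" "\<And>x. (p2 has_vector_derivative p2' x) (at x)"
    using has_vector_derivative_polynomial_function[OF p(2)] by blast
  let ?v = "\<lambda>x. if x \<le> 1 then p1' x else p2' x"
  have ac: "abs_continuous_on {0..1} ?u" "abs_continuous_on {\<alpha>..\<beta>} ?u"
    using \<alpha> p1' p2' continuous_on_polymonial_function
    by (auto intro!: abs_continuous_on_transform[OF abs_continuous_on_C1[of 0 1 p1 p1']]
        abs_continuous_on_transform[OF abs_continuous_on_C1[of \<alpha> \<beta> p2 p2']])
  have "continuous_on {0..1} ?v" "continuous_on {\<alpha>..\<beta>} ?v"
    using \<alpha> continuous_on_polymonial_function[OF p1'(1), of "{0..1}"] continuous_on_polymonial_function[OF p2'(1), of "{\<alpha>..\<beta>}"]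
    by (auto elim!: continuous_on_eq)
  then have v: "?v \<in> L2 M"
    by (intro continuous_on_imp_L2 two_intervals_compact) (auto simp: two_intervals_def intro: continuous_on_closed_Un)
  have "?u \<in> op_dom (momentum_max \<alpha> \<beta>)"
  proof (rule momentum_max_domI(1)[OF \<alpha> ac v negligible_empty])
    fix x assume "x \<in> ({0<..<1} \<union> {\<alpha><..<\<beta>}) - {}"
    then consider "x < 1" | "1 < x" using \<alpha> by auto
    then show "(?u has_vector_derivative ?v x) (at x)"
    proof cases
      case 1
      have "(?u has_vector_derivative p1' x) (at x)"
        by (rule has_vector_derivative_transform_within_open[OF p1'(2), of "{..<1}"]) (use 1 in auto)
      then show ?thesis using 1 by simp
    next
      case 2
      have "(?u has_vector_derivative p2' x) (at x)"
        by (rule has_vector_derivative_transform_within_open[OF p2'(2), of "{1<..}"]) (use 2 in auto)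
      then show ?thesis using 2 by simp
    qed
  qed
  then show ?thesis using zero \<alpha> \<beta> by (simp add: dom_iff)
qed

text \<open>
  A polynomial is cut off at the four endpoints by factors \<open>1 - s\<^sup>m\<close> with even \<open>m\<close>, where \<open>s\<close> maps each of
  the two intervals affinely onto \<open>[-1, 1]\<close>. Inside the intervals the factors tend to 1 as \<open>m\<close> grows.
\<close>

lemma polynomial_in_closure:
  fixes p :: "real \<Rightarrow> complex"
  assumes p: "polynomial_function p"
  shows "p \<in> L2_closure M (op_dom P)"
proof -
  define s where "s x = (if x \<le> 1 then 2 * x - 1 else (2 * x - \<alpha> - \<beta>) / (\<beta> - \<alpha>))" for x
  define u where "u n x = (1 - s x ^ (2 * n + 2)) *\<^sub>R p x" for n x
  have D: "op_dom P \<subseteq> L2 M" using dom_L2 by blast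
  have cont: "continuous_on S p" by (rule continuous_on_polymonial_function[OF p])
  have pL2: "p \<in> L2 M" by (rule continuous_on_imp_L2[OF two_intervals_compact cont])
  have dom: "u n \<in> op_dom P" for n
  proof -
    let ?p1 = "\<lambda>x. (1 - (2 * x - 1) ^ (2 * n + 2)) *\<^sub>R p x"
    let ?p2 = "\<lambda>x. (1 - ((2 * x - \<alpha> - \<beta>) / (\<beta> - \<alpha>)) ^ (2 * n + 2)) *\<^sub>R p x"
    have lin: "polynomial_function (\<lambda>x::real. c * x + d)" for c d :: real
      by (intro polynomial_function_add polynomial_function_const) (simp add: polynomial_function_bounded_linear bounded_linear_mult_right)
    have pow: "polynomial_function (\<lambda>x. f x ^ k)" if "polynomial_function f" for f :: "real \<Rightarrow> real" and k
      using that real_polynomial_function_power by (simp flip: real_polynomial_function_eq)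
    have "polynomial_function ?p1"
    proof -
      have "polynomial_function (\<lambda>x::real. 2 * x - 1)" using lin[of 2 "- 1"] by simp
      then show ?thesis
        by (intro polynomial_function_mult polynomial_function_diff[OF polynomial_function_const pow] p)
    qed
    moreover have "polynomial_function ?p2"
    proof -
      have "(\<lambda>x. (2 * x - \<alpha> - \<beta>) / (\<beta> - \<alpha>)) = (\<lambda>x. (2 / (\<beta> - \<alpha>)) * x + (- (\<alpha> + \<beta>) / (\<beta> - \<alpha>)))"
        by (auto simp: fun_eq_iff diff_divide_distrib add_divide_distrib)
      then have "polynomial_function (\<lambda>x. (2 * x - \<alpha> - \<beta>) / (\<beta> - \<alpha>))" using lin by metis
      then show ?thesis
        by (intro polynomial_function_mult polynomial_function_diff pow
            polynomial_function_const p)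
    qed
    moreover have "(2 * \<alpha> - \<alpha> - \<beta>) / (\<beta> - \<alpha>) = - 1" "(2 * \<beta> - \<alpha> - \<beta>) / (\<beta> - \<alpha>) = 1"
      using \<beta> by (simp_all add: divide_eq_eq)
    ultimately have "(\<lambda>x. if x \<le> 1 then ?p1 x else ?p2 x) \<in> op_dom P"
      by (intro piecewise_polynomial_in_dom) simp_all
    also have "(\<lambda>x. if x \<le> 1 then ?p1 x else ?p2 x) = u n"
      by (auto simp: u_def s_def fun_eq_iff)
    finally show ?thesis .
  qed
  have s_le: "\<bar>s x\<bar> \<le> 1" if "x \<in> S" for x
    using that \<alpha> \<beta> by (auto simp: s_def two_intervals_def abs_le_iff divide_le_eq le_divide_eq minus_divide_left)
  have s_less: "\<bar>s x\<bar> < 1" if "x \<in> S - {0, 1, \<alpha>, \<beta>}" for x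
    using that \<alpha> \<beta> by (auto simp: s_def two_intervals_def abs_less_iff divide_less_eq less_divide_eq minus_divide_left)
  have "(\<lambda>n. l2norm M (\<lambda>x. p x - u n x)) \<longlonglongrightarrow> 0"
  proof (rule l2norm_dominated_convergence)
    show "integrable M (\<lambda>x. (cmod (p x))\<^sup>2)" by (rule L2_D(2)[OF pL2])
    fix n x assume "x \<in> space M"
    then have x: "x \<in> S" by simp
    have "p x - u n x = (s x ^ (2 * n + 2)) *\<^sub>R p x" by (simp add: u_def algebra_simps)
    then have "cmod (p x - u n x) = \<bar>s x\<bar> ^ (2 * n + 2) * cmod (p x)" by (simp add: power_abs abs_mult)
    also have "\<dots> \<le> 1 * cmod (p x)"
      by (rule mult_right_mono[OF power_le_one]) (use s_le[OF x] in auto)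
    finally show "cmod (p x - u n x) \<le> cmod (p x)" by simp
  next
    have "(\<lambda>n. u n x) \<longlonglongrightarrow> p x" if x: "x \<in> S - {0, 1, \<alpha>, \<beta>}" for x
    proof -
      have "(s x)\<^sup>2 < 1" using s_less[OF x] by (simp add: abs_square_less_1)
      then have "(\<lambda>n. ((s x)\<^sup>2) ^ Suc n) \<longlonglongrightarrow> 0"
        by (intro LIMSEQ_Suc LIMSEQ_power_zero) simp
      then have "(\<lambda>n. s x ^ (2 * n + 2)) \<longlonglongrightarrow> 0"
        by (simp add: power_mult[symmetric] del: power_Suc)
      then have "(\<lambda>n. u n x) \<longlonglongrightarrow> (1 - 0) *\<^sub>R p x" unfolding u_def by (intro tendsto_intros)
      then show ?thesis by simp
    qed
    then show "AE x in M. (\<lambda>n. u n x) \<longlonglongrightarrow> p x"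
      by (subst AE_lebesgue_on_iff_negligible) (auto intro!: exI[of _ "{0, 1, \<alpha>, \<beta>}"])
  qed (use dom_L2[OF dom] pL2 in \<open>auto dest: L2_D\<close>)
  then show ?thesis by (rule L2_closure_limit[OF D pL2 L2_closure_superset[OF D dom]])
qed

text \<open>The remaining steps are the theorem of Weierstrass, pointwise limits of continuous functions, and truncation.\<close>

lemma continuous_in_closure:
  fixes f :: "real \<Rightarrow> complex"
  assumes f: "continuous_on S f"
  shows "f \<in> L2_closure M (op_dom P)"
proof (rule L2_closure_approx)
  show "op_dom P \<subseteq> L2 M" using dom_L2 by blast
  show fL2: "f \<in> L2 M" by (rule continuous_on_imp_L2[OF two_intervals_compact f])
  fix \<epsilon> :: real assume \<epsilon>: "0 < \<epsilon>"
  let ?m = "sqrt (measure lebesgue S)"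
  let ?e = "\<epsilon> / (?m + 1)"
  have m1: "0 < ?m + 1" by (simp add: add_nonneg_pos)
  then have e: "0 < ?e" using \<epsilon> by simp
  obtain p where p: "polynomial_function p" "\<forall>x\<in>S. norm (f x - p x) < ?e"
    using Stone_Weierstrass_polynomial_function[OF two_intervals_compact f e] by blast
  have pL2: "p \<in> L2 M"
    by (rule continuous_on_imp_L2[OF two_intervals_compact continuous_on_polymonial_function[OF p(1)]])
  have "l2norm M (\<lambda>x. f x - p x) \<le> ?e * ?m"
    using p e by (intro l2norm_le_bound L2_diff fL2 pL2) (auto simp: less_imp_le)
  also have "\<dots> < ?e * (?m + 1)" using e by (intro mult_strict_left_mono) auto
  also have "\<dots> = \<epsilon>" using m1 by (intro nonzero_divide_eq_eq[THEN iffD1, OF _ refl, symmetric]) simp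
  finally show "\<exists>p\<in>L2_closure M (op_dom P). l2norm M (\<lambda>x. f x - p x) < \<epsilon>"
    using polynomial_in_closure[OF p(1)] by blast
qed

lemma bounded_measurable_in_closure:
  fixes g :: "real \<Rightarrow> complex"
  assumes g: "g \<in> borel_measurable M" and A: "\<And>x. x \<in> S \<Longrightarrow> cmod (g x) \<le> A" and "0 < A"
  shows "g \<in> L2_closure M (op_dom P)"
proof -
  have D: "op_dom P \<subseteq> L2 M" using dom_L2 by blast
  have gL2: "g \<in> L2 M"
    using A by (intro L2_bounded_measurable[OF finite_measure_two_intervals g]) auto
  have "g measurable_on S" using g by (simp add: measurable_on_iff_borel_measurable)
  then obtain N \<phi> where N: "negligible N" and \<phi>: "\<And>n. continuous_on UNIV (\<phi> n)"
    and lim: "\<And>x. x \<notin> N \<Longrightarrow> (\<lambda>n. \<phi> n x) \<longlonglongrightarrow> (if x \<in> S then g x else 0)"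
    unfolding measurable_on_def by blast
  \<comment> \<open>the radial retraction onto the disc of radius \<open>A\<close>\<close>
  define clamp where "clamp z = (A / max A (cmod z)) *\<^sub>R z" for z :: complex
  have cont: "continuous_on UNIV clamp"
    unfolding clamp_def[abs_def] using \<open>0 < A\<close> by (intro continuous_intros) auto
  have clamp_le: "cmod (clamp z) \<le> A" for z
  proof -
    have "A * cmod z \<le> A * max A (cmod z)" using \<open>0 < A\<close> by (intro mult_left_mono) auto
    then show ?thesis using \<open>0 < A\<close> by (simp add: clamp_def pos_divide_le_eq)
  qed
  have clamp_id: "clamp z = z" if "cmod z \<le> A" for z
    using that \<open>0 < A\<close> by (simp add: clamp_def max_absorb1)
  let ?f = "\<lambda>n x. clamp (\<phi> n x)"
  have f_cont: "continuous_on S (?f n)" for n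
    by (rule continuous_on_compose2[OF cont continuous_on_subset[OF \<phi>]]) auto
  have "(\<lambda>n. l2norm M (\<lambda>x. g x - ?f n x)) \<longlonglongrightarrow> 0"
  proof (rule l2norm_dominated_convergence)
    show "?f n \<in> borel_measurable M" for n
      using continuous_on_imp_L2[OF two_intervals_compact f_cont] by (rule L2_D)
    show "integrable M (\<lambda>x. (A + A)\<^sup>2)"
      using finite_measure_two_intervals by (simp add: finite_measure.integrable_const)
    show "cmod (g x - ?f n x) \<le> A + A" if "x \<in> space M" for n x
      using A[of x] clamp_le[of "\<phi> n x"] that norm_triangle_ineq4[of "g x" "?f n x"] by simp
    have "(\<lambda>n. ?f n x) \<longlonglongrightarrow> g x" if "x \<in> S - N" for x
    proof -
      have "isCont clamp (g x)" using cont by (simp add: continuous_on_eq_continuous_at)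
      moreover have "(\<lambda>n. \<phi> n x) \<longlonglongrightarrow> g x" using lim[of x] that by simp
      ultimately have "(\<lambda>n. ?f n x) \<longlonglongrightarrow> clamp (g x)" by (rule isCont_tendsto_compose)
      then show ?thesis using clamp_id A that by simp
    qed
    then show "AE x in M. (\<lambda>n. ?f n x) \<longlonglongrightarrow> g x"
      using N by (subst AE_lebesgue_on_iff_negligible) auto
  qed (rule g)
  then show ?thesis by (rule L2_closure_limit[OF D gL2 continuous_in_closure[OF f_cont]])
qed

theorem dom_dense:
  assumes g: "g \<in> L2 M"
  shows "g \<in> L2_closure M (op_dom P)"
proof -
  have D: "op_dom P \<subseteq> L2 M" using dom_L2 by blast
  let ?f = "\<lambda>n x. if cmod (g x) \<le> real (Suc n) then g x else 0"
  have meas: "?f n \<in> borel_measurable M" for n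
    using L2_D(1)[OF g] by measurable
  have "(\<lambda>n. l2norm M (\<lambda>x. g x - ?f n x)) \<longlonglongrightarrow> 0"
  proof (rule l2norm_dominated_convergence[OF meas L2_D(1)[OF g] L2_D(2)[OF g]])
    have "(\<lambda>n. ?f n x) \<longlonglongrightarrow> g x" for x
    proof (rule tendsto_eventually)
      show "\<forall>\<^sub>F n in sequentially. ?f n x = g x"
        using eventually_ge_at_top[of "nat \<lceil>cmod (g x)\<rceil>"] by eventually_elim (auto simp: nat_le_iff ceiling_le_iff)
    qed
    then show "AE x in M. (\<lambda>n. ?f n x) \<longlonglongrightarrow> g x" by simp
  qed auto
  moreover have "?f n \<in> L2_closure M (op_dom P)" for n
    by (rule bounded_measurable_in_closure[OF meas, of _ "real (Suc n)"]) auto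
  ultimately show ?thesis by (intro L2_closure_limit[OF D g]) auto
qed

theorem pure_point: "pure_point_spectrum M P"
  unfolding pure_point_spectrum_def
proof (intro conjI ballI allI impI)
  show "spectrum M P = point_spectrum M P" by (simp add: spectrum_eq_chi_zeros)
  fix g and \<epsilon> :: real assume g: "g \<in> L2 M" and "0 < \<epsilon>"
  then have e: "0 < \<epsilon> / 2" by simp
  obtain \<mu> :: real where "chi (of_real \<mu>) \<noteq> 0" using exists_real_chi_nonzero by blast
  then interpret momentum_resolvent \<alpha> \<beta> B \<mu> by unfold_locales
  obtain u where u: "u \<in> op_dom P" "l2norm M (\<lambda>x. g x - u x) < \<epsilon> / 2"
    using dom_dense[OF g] e unfolding L2_closure_def by blast
  obtain y where y: "y \<in> eigen_span" "l2norm M (\<lambda>x. u x - y x) < \<epsilon> / 2"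
    using dom_approximation[OF u(1) e] by blast
  obtain F c where yL: "y \<in> L2 M" and F: "finite F" "F \<subseteq> eigenfunctions" and eq: "AE x in M. y x = combination F c x"
    using y(1) by (auto simp: eigen_span_def)
  have comb: "combination F c \<in> L2 M" by (rule L2_lebesgue_on_cong_AE[OF yL]) (use eq in auto)
  have "AE x in M. g x - y x = g x - (\<Sum>f\<in>F. c f * f x)"
    using eq by eventually_elim (simp add: combination_def)
  then have "l2norm M (\<lambda>x. g x - (\<Sum>f\<in>F. c f * f x)) = l2norm M (\<lambda>x. g x - y x)"
    using g yL comb by (intro l2norm_cong_AE[symmetric]) (auto intro!: borel_measurable_diff L2_D simp flip: combination_def)
  also have "\<dots> < \<epsilon>"
    using l2norm_triangle_diff[OF g dom_L2[OF u(1)] yL] u(2) y(2) by simp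
  finally show "\<exists>F c. finite F \<and> F \<subseteq> {f. \<exists>z. eigenvector M P z f} \<and>
      l2norm M (\<lambda>x. g x - (\<Sum>f\<in>F. c f * f x)) < \<epsilon>"
    using F unfolding eigenfunctions_def by blast
qed

end

section \<open>The boundary matrices\<close>

lemma cmod_e [simp]: "cmod (e x) = 1"
  by (simp add: e_def norm_exp_eq_Re)

lemma e_add: "e (x + y) = e x * e y"
  by (simp add: e_def algebra_simps exp_add)

lemma boundary_matrix_entries:
  "boundary_matrix w \<phi> \<psi> \<theta> $ 1 $ 1 = of_real w * e \<phi>"
  "boundary_matrix w \<phi> \<psi> \<theta> $ 1 $ 2 = - of_real (sqrt (1 - w\<^sup>2)) * e (\<theta> - \<psi>)"
  "boundary_matrix w \<phi> \<psi> \<theta> $ 2 $ 1 = of_real (sqrt (1 - w\<^sup>2)) * e \<psi>"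
  "boundary_matrix w \<phi> \<psi> \<theta> $ 2 $ 2 = of_real w * e (\<theta> - \<phi>)"
  by (simp_all add: boundary_matrix_def vector_2)

lemma boundary_matrix_isometric:
  assumes "0 \<le> w" "w \<le> 1"
  shows "norm (boundary_matrix w \<phi> \<psi> \<theta> *v v) = norm v"
proof -
  let ?B = "boundary_matrix w \<phi> \<psi> \<theta>"
  define x y where "x = v $ 1" and "y = v $ 2"
  define r where "r = sqrt (1 - w\<^sup>2)"
  have r: "w\<^sup>2 + r\<^sup>2 = 1" using assms by (simp add: r_def power_le_one)
  \<comment> \<open>after phases are absorbed into the coordinates and into the second component, the matrix is a rotation\<close>
  define p q where "p = e \<phi> * x" and "q = e (\<theta> - \<psi>) * y"
  have u: "e (\<psi> - \<phi>) * e \<phi> = e \<psi>" "e (\<psi> - \<phi>) * e (\<theta> - \<psi>) = e (\<theta> - \<phi>)"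
    by (simp_all flip: e_add)
  have c1: "(?B *v v) $ 1 = of_real w * p - of_real r * q"
    by (simp add: matrix_vector_mult_def sum_2 boundary_matrix_entries p_def q_def r_def x_def y_def)
  have c2: "(?B *v v) $ 2 = e (\<psi> - \<phi>) * (of_real r * p + of_real w * q)"
  proof -
    have "(?B *v v) $ 2 = of_real r * e \<psi> * x + of_real w * e (\<theta> - \<phi>) * y"
      by (simp add: matrix_vector_mult_def sum_2 boundary_matrix_entries r_def x_def y_def)
    then show ?thesis
      unfolding u[symmetric] p_def q_def by (simp add: algebra_simps)
  qed
  have sq: "(cmod z)\<^sup>2 = (Re z)\<^sup>2 + (Im z)\<^sup>2" for z by (rule cmod_power2)
  have "(norm (?B *v v))\<^sup>2 = (cmod (of_real w * p - of_real r * q))\<^sup>2 + (cmod (of_real r * p + of_real w * q))\<^sup>2"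
    by (simp add: norm_vec_def L2_set_def sum_2 c1 c2 norm_mult)
  also have "\<dots> = (w\<^sup>2 + r\<^sup>2) * ((cmod p)\<^sup>2 + (cmod q)\<^sup>2)"
    unfolding sq by (simp add: power2_eq_square algebra_simps)
  also have "\<dots> = (norm v)\<^sup>2"
    by (simp add: r p_def q_def norm_mult norm_vec_def L2_set_def sum_2 x_def y_def)
  finally show ?thesis by (simp add: power2_eq_iff_nonneg)
qed

theorem theorem2p4:
  fixes \<alpha> \<beta> w \<phi> \<psi> \<theta> :: real
  assumes "1 < \<alpha>" and "\<alpha> < \<beta>" and "0 \<le> w" and "w \<le> 1"
  shows "pure_point_spectrum (lebesgue_on (two_intervals \<alpha> \<beta>))
           (momentum \<alpha> \<beta> (boundary_matrix w \<phi> \<psi> \<theta>)) \<and>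
         spectrum (lebesgue_on (two_intervals \<alpha> \<beta>))
           (momentum \<alpha> \<beta> (boundary_matrix w \<phi> \<psi> \<theta>)) =
         complex_of_real ` {\<mu>::real. (e (\<phi> + \<mu>) - of_real w) * e (\<theta> - \<phi> + (\<beta> - \<alpha>) * \<mu>)
                                     = of_real w * e (\<phi> + \<mu>) - 1}"
proof -
  interpret momentum_operator \<alpha> \<beta> "boundary_matrix w \<phi> \<psi> \<theta>"
    using assms boundary_matrix_isometric by unfold_locales auto
  have chi: "chi (of_real \<mu>) = (e (\<phi> + \<mu>) - of_real w) * e (\<theta> - \<phi> + (\<beta> - \<alpha>) * \<mu>) - (of_real w * e (\<phi> + \<mu>) - 1)"
    for \<mu> :: real
  proof -
    define a b where "a = e (\<phi> + \<mu>)" and "b = e (\<theta> - \<phi> + (\<beta> - \<alpha>) * \<mu>)"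
    have r: "complex_of_real (sqrt (1 - w\<^sup>2)) * of_real (sqrt (1 - w\<^sup>2)) = 1 - (of_real w)\<^sup>2"
      using assms(3,4) by (simp flip: of_real_mult add: power_le_one)
    have E: "exp (two_pi_i * of_real \<mu>) = e \<mu>" "exp (two_pi_i * of_real \<mu> * of_real (\<beta> - \<alpha>)) = e ((\<beta> - \<alpha>) * \<mu>)"
      by (simp_all add: e_def two_pi_i_def algebra_simps)
    have ab: "e \<phi> * e \<mu> = a" "e (\<theta> - \<phi>) * e ((\<beta> - \<alpha>) * \<mu>) = b"
      "e (\<theta> - \<psi>) * e ((\<beta> - \<alpha>) * \<mu>) * (e \<psi> * e \<mu>) = a * b"
      by (simp_all add: a_def b_def flip: e_add) (simp add: algebra_simps)
    have "chi (of_real \<mu>) =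
        (of_real w * (e \<phi> * e \<mu>) - 1) * (of_real w * (e (\<theta> - \<phi>) * e ((\<beta> - \<alpha>) * \<mu>)) - 1)
        + (of_real (sqrt (1 - w\<^sup>2)) * of_real (sqrt (1 - w\<^sup>2)))
          * (e (\<theta> - \<psi>) * e ((\<beta> - \<alpha>) * \<mu>) * (e \<psi> * e \<mu>))"
      unfolding chi_def boundary_matrix_entries E by (simp add: mult_ac)
    also have "\<dots> = (of_real w * a - 1) * (of_real w * b - 1)
        + (of_real (sqrt (1 - w\<^sup>2)) * of_real (sqrt (1 - w\<^sup>2))) * (a * b)"
      unfolding ab ..
    also have "\<dots> = (a - of_real w) * b - (of_real w * a - 1)"
      unfolding r by (simp add: power2_eq_square algebra_simps)
    finally show ?thesis by (simp add: a_def b_def)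
  qed
  have "{z. chi z = 0} = complex_of_real ` {\<mu>. chi (of_real \<mu>) = 0}"
  proof (intro equalityI subsetI)
    fix z assume z: "z \<in> {z. chi z = 0}"
    then have "z = of_real (Re z)" using chi_zero_real[of z] by (simp add: complex_eq_iff)
    with z show "z \<in> complex_of_real ` {\<mu>. chi (of_real \<mu>) = 0}" by (metis (mono_tags) imageI mem_Collect_eq)
  qed auto
  then show ?thesis
    using pure_point spectrum_eq_chi_zeros(1) by (simp add: chi)
qed

end
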